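(* Let $A$ be a generalized quasi-dihedral group on a finite subgroup $K$, and let $G = A\ast_K A$ be the free product with amalgamation of two copies of $A$ along $K$. Then every connected Cayley graph of $G$ (i.e. $\mathsf{Cay}(G;S)$ for every finite generating set $S$ of $G$) contains a Hamiltonian double ray.
   Context: All groups are finitely generated. A group $A$ is generalized quasi-dihedral on a subgroup $K$ if $K$ is abelian, $[A:K]=2$, and there is an element $b\in A\setminus K$ such that $bkb^{-1}k=1$ for all $k\in K$. The group $A\ast_K A$ is the pushout of two copies of the inclusion $K\hookrightarrow A$: two copies of $A$ are amalgamated by identifying the two copies of $K$ via the identity map of $K$. For a finite generating set $S$ with $1\notin S$, $\mathsf{Cay}(G;S)$ is the undirected simple graph with vertex set $G$ in which $g$ and $gs$ are adjacent for all $g\in G$, $s\in S$. A double ray is a two-way infinite path (an infinite connected 2-regular graph); a double ray that is a subgraph of a graph is Hamiltonian if it contains all vertices of the graph. *)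

theory Defs
  imports
    "HOL-Algebra.Coset"
    "HOL-Algebra.Generated_Groups"
    "Graph_Theory.Graph_Theory"
begin

section \<open>Generalized quasi-dihedral groups\<close>

definition generalized_quasi_dihedral :: "('a, 'm) monoid_scheme \<Rightarrow> 'a set \<Rightarrow> bool" where
  "generalized_quasi_dihedral A K \<longleftrightarrow>
     group A \<and> subgroup K A \<and> comm_group (A\<lparr>carrier := K\<rparr>) \<and> card (rcosets\<^bsub>A\<^esub> K) = 2 \<and>
     (\<exists>b \<in> carrier A - K. \<forall>k\<in>K. b \<otimes>\<^bsub>A\<^esub> k \<otimes>\<^bsub>A\<^esub> inv\<^bsub>A\<^esub> b \<otimes>\<^bsub>A\<^esub> k = \<one>\<^bsub>A\<^esub>)"


section \<open>The amalgamated free product of two copies of a group along a subgroup\<close>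

text \<open>
  A letter \<open>(i, a)\<close> stands for the element \<open>a\<close> of the copy of \<open>A\<close> numbered \<open>i\<close>.  The
  amalgamated product is the monoid of words in these letters modulo the congruence generated by
  the multiplication tables of both copies and the identification of the two copies of \<open>K\<close>.
\<close>

definition amalgam_words :: "('a, 'm) monoid_scheme \<Rightarrow> (bool \<times> 'a) list set" where
  "amalgam_words A = lists (UNIV \<times> carrier A)"

inductive amalgam_eq ::
  "('a, 'm) monoid_scheme \<Rightarrow> 'a set \<Rightarrow> (bool \<times> 'a) list \<Rightarrow> (bool \<times> 'a) list \<Rightarrow> bool"
  for A :: "('a, 'm) monoid_scheme" and K :: "'a set" where
  refl: "w \<in> amalgam_words A \<Longrightarrow> amalgam_eq A K w w"
| sym: "amalgam_eq A K v w \<Longrightarrow> amalgam_eq A K w v"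
| trans: "amalgam_eq A K u v \<Longrightarrow> amalgam_eq A K v w \<Longrightarrow> amalgam_eq A K u w"
| one: "u \<in> amalgam_words A \<Longrightarrow> v \<in> amalgam_words A \<Longrightarrow>
    amalgam_eq A K (u @ [(i, \<one>\<^bsub>A\<^esub>)] @ v) (u @ v)"
| mult: "u \<in> amalgam_words A \<Longrightarrow> v \<in> amalgam_words A \<Longrightarrow> a \<in> carrier A \<Longrightarrow> b \<in> carrier A \<Longrightarrow>
    amalgam_eq A K (u @ [(i, a), (i, b)] @ v) (u @ [(i, a \<otimes>\<^bsub>A\<^esub> b)] @ v)"
| glue: "u \<in> amalgam_words A \<Longrightarrow> v \<in> amalgam_words A \<Longrightarrow> k \<in> K \<Longrightarrow> k \<in> carrier A \<Longrightarrow>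
    amalgam_eq A K (u @ [(i, k)] @ v) (u @ [(j, k)] @ v)"

definition amalgam_rel ::
  "('a, 'm) monoid_scheme \<Rightarrow> 'a set \<Rightarrow> ((bool \<times> 'a) list \<times> (bool \<times> 'a) list) set" where
  "amalgam_rel A K = {(v, w). amalgam_eq A K v w}"

definition amalgam :: "('a, 'm) monoid_scheme \<Rightarrow> 'a set \<Rightarrow> (bool \<times> 'a) list set monoid" where
  "amalgam A K =
     \<lparr>carrier = amalgam_words A // amalgam_rel A K,
      monoid.mult = (\<lambda>X Y. \<Union>v\<in>X. \<Union>w\<in>Y. amalgam_rel A K `` {v @ w}),
      one = amalgam_rel A K `` {[]}\<rparr>"

definition amalgam_incl :: "('a, 'm) monoid_scheme \<Rightarrow> 'a set \<Rightarrow> bool \<Rightarrow> 'a \<Rightarrow> (bool \<times> 'a) list set"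
  where "amalgam_incl A K i a = amalgam_rel A K `` {[(i, a)]}"

lemma amalgam_words_simps [simp]:
  "[] \<in> amalgam_words A"
  "(x # w) \<in> amalgam_words A \<longleftrightarrow> snd x \<in> carrier A \<and> w \<in> amalgam_words A"
  "v @ w \<in> amalgam_words A \<longleftrightarrow> v \<in> amalgam_words A \<and> w \<in> amalgam_words A"
  by (auto simp: amalgam_words_def mem_Times_iff)

lemma amalgam_eq_words:
  assumes "group A" "amalgam_eq A K v w"
  shows "v \<in> amalgam_words A \<and> w \<in> amalgam_words A"
proof -
  interpret group A by fact
  show ?thesis using assms(2) by induction auto
qed

lemma amalgam_eq_context:
  assumes "amalgam_eq A K v w" "x \<in> amalgam_words A" "y \<in> amalgam_words A"
  shows "amalgam_eq A K (x @ v @ y) (x @ w @ y)"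
  using assms
proof induction
  case (one u v i)
  then show ?case using amalgam_eq.one[of "x @ u" A "v @ y" K i] by simp
next
  case (mult u v a b i)
  then show ?case using amalgam_eq.mult[of "x @ u" A "v @ y" a b K i] by simp
next
  case (glue u v k i j)
  then show ?case using amalgam_eq.glue[of "x @ u" A "v @ y" k K i j] by simp
qed (auto intro: amalgam_eq.intros)

lemma amalgam_eq_append:
  assumes "group A" "amalgam_eq A K v v'" "amalgam_eq A K w w'"
  shows "amalgam_eq A K (v @ w) (v' @ w')"
proof -
  have "amalgam_eq A K (v @ w) (v' @ w)"
    using amalgam_eq_context[OF assms(2), of "[]" w] amalgam_eq_words[OF assms(1,3)] by simp
  moreover have "amalgam_eq A K (v' @ w) (v' @ w')"
    using amalgam_eq_context[OF assms(3), of v' "[]"] amalgam_eq_words[OF assms(1,2)] by simp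
  ultimately show ?thesis by (rule amalgam_eq.trans)
qed

lemma equiv_amalgam_rel:
  assumes "group A"
  shows "equiv (amalgam_words A) (amalgam_rel A K)"
proof (rule equivI)
  show "amalgam_rel A K \<subseteq> amalgam_words A \<times> amalgam_words A"
    using amalgam_eq_words[OF assms] by (auto simp: amalgam_rel_def)
  show "refl_on (amalgam_words A) (amalgam_rel A K)"
    by (auto simp: refl_on_def amalgam_rel_def intro: amalgam_eq.refl)
  show "sym (amalgam_rel A K)"
    by (auto simp: sym_def amalgam_rel_def intro: amalgam_eq.sym)
  show "trans (amalgam_rel A K)"
    by (auto simp: trans_def amalgam_rel_def intro: amalgam_eq.trans)
qed

lemma amalgam_class_eq_iff:
  assumes "group A" "v \<in> amalgam_words A" "w \<in> amalgam_words A"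
  shows "amalgam_rel A K `` {v} = amalgam_rel A K `` {w} \<longleftrightarrow> amalgam_eq A K v w"
  using eq_equiv_class_iff[OF equiv_amalgam_rel[OF assms(1)] assms(2,3)]
  by (simp add: amalgam_rel_def)

lemma amalgam_one: "\<one>\<^bsub>amalgam A K\<^esub> = amalgam_rel A K `` {[]}"
  by (simp add: amalgam_def)

lemma amalgam_carrierE:
  assumes "X \<in> carrier (amalgam A K)"
  obtains w where "w \<in> amalgam_words A" "X = amalgam_rel A K `` {w}"
  using assms by (auto simp: amalgam_def elim: quotientE)

lemma amalgam_class_closed:
  "w \<in> amalgam_words A \<Longrightarrow> amalgam_rel A K `` {w} \<in> carrier (amalgam A K)"
  by (simp add: amalgam_def quotientI)

lemma amalgam_mult:
  assumes "group A" "v \<in> amalgam_words A" "w \<in> amalgam_words A"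
  shows "(amalgam_rel A K `` {v}) \<otimes>\<^bsub>amalgam A K\<^esub> (amalgam_rel A K `` {w})
         = amalgam_rel A K `` {v @ w}"
proof -
  have cl: "amalgam_rel A K `` {v' @ w'} = amalgam_rel A K `` {v @ w}"
    if "amalgam_eq A K v v'" "amalgam_eq A K w w'" for v' w'
    using amalgam_eq_append[OF assms(1) that] amalgam_eq_words[OF assms(1)] that
    by (subst amalgam_class_eq_iff[OF assms(1)]) (auto intro: amalgam_eq.sym)
  have "amalgam_eq A K v v" "amalgam_eq A K w w"
    using assms by (auto intro: amalgam_eq.refl)
  then have "(\<Union>v'\<in>{v'. amalgam_eq A K v v'}. \<Union>w'\<in>{w'. amalgam_eq A K w w'}.
               amalgam_rel A K `` {v' @ w'}) = amalgam_rel A K `` {v @ w}"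
    using cl by blast
  moreover have "amalgam_rel A K `` {x} = {y. amalgam_eq A K x y}" for x
    by (auto simp: amalgam_rel_def)
  ultimately show ?thesis by (simp add: amalgam_def)
qed

lemma amalgam_left_inverse:
  assumes "group A" "w \<in> amalgam_words A"
  shows "\<exists>v\<in>amalgam_words A. amalgam_eq A K (v @ w) []"
proof -
  interpret group A by fact
  show ?thesis using assms(2)
  proof (induction w)
    case Nil
    then show ?case by (auto intro!: bexI[of _ "[]"] amalgam_eq.refl)
  next
    case (Cons x w)
    obtain i a where x: "x = (i, a)" by force
    with Cons obtain v where v: "v \<in> amalgam_words A" "amalgam_eq A K (v @ w) []"
      and a: "a \<in> carrier A" and w: "w \<in> amalgam_words A" by auto
    have "amalgam_eq A K (v @ [(i, inv\<^bsub>A\<^esub> a), (i, a)] @ w) (v @ [(i, \<one>\<^bsub>A\<^esub>)] @ w)"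
      using amalgam_eq.mult[of v A w "inv\<^bsub>A\<^esub> a" a K i] v a w by (simp add: l_inv)
    moreover have "amalgam_eq A K (v @ [(i, \<one>\<^bsub>A\<^esub>)] @ w) (v @ w)"
      using v w by (intro amalgam_eq.one)
    ultimately have "amalgam_eq A K ((v @ [(i, inv\<^bsub>A\<^esub> a)]) @ x # w) []"
      using v(2) x by (auto intro: amalgam_eq.trans)
    then show ?case using v a by (intro bexI[of _ "v @ [(i, inv\<^bsub>A\<^esub> a)]"]) auto
  qed
qed

lemma group_amalgam:
  assumes "group A"
  shows "group (amalgam A K)"
proof (rule groupI)
  fix X Y assume "X \<in> carrier (amalgam A K)" "Y \<in> carrier (amalgam A K)"
  then show "X \<otimes>\<^bsub>amalgam A K\<^esub> Y \<in> carrier (amalgam A K)"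
    by (auto elim!: amalgam_carrierE simp: amalgam_mult[OF assms] intro!: amalgam_class_closed)
next
  show "\<one>\<^bsub>amalgam A K\<^esub> \<in> carrier (amalgam A K)"
    by (simp add: amalgam_one amalgam_class_closed)
next
  fix X Y Z
  assume "X \<in> carrier (amalgam A K)" "Y \<in> carrier (amalgam A K)" "Z \<in> carrier (amalgam A K)"
  then show "X \<otimes>\<^bsub>amalgam A K\<^esub> Y \<otimes>\<^bsub>amalgam A K\<^esub> Z
             = X \<otimes>\<^bsub>amalgam A K\<^esub> (Y \<otimes>\<^bsub>amalgam A K\<^esub> Z)"
    by (auto elim!: amalgam_carrierE simp: amalgam_mult[OF assms])
next
  fix X assume "X \<in> carrier (amalgam A K)"
  then show "\<one>\<^bsub>amalgam A K\<^esub> \<otimes>\<^bsub>amalgam A K\<^esub> X = X"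
    by (auto elim!: amalgam_carrierE simp: amalgam_mult[OF assms] amalgam_one)
next
  fix X assume "X \<in> carrier (amalgam A K)"
  then obtain w where w: "w \<in> amalgam_words A" "X = amalgam_rel A K `` {w}"
    by (rule amalgam_carrierE)
  obtain v where v: "v \<in> amalgam_words A" "amalgam_eq A K (v @ w) []"
    using amalgam_left_inverse[OF assms w(1)] by blast
  have "(amalgam_rel A K `` {v}) \<otimes>\<^bsub>amalgam A K\<^esub> X = \<one>\<^bsub>amalgam A K\<^esub>"
    using v w amalgam_class_eq_iff[OF assms, of "v @ w" "[]" K]
    by (simp add: amalgam_mult[OF assms] amalgam_one)
  then show "\<exists>Y\<in>carrier (amalgam A K). Y \<otimes>\<^bsub>amalgam A K\<^esub> X = \<one>\<^bsub>amalgam A K\<^esub>"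
    using v(1) amalgam_class_closed by blast
qed

text \<open>\<open>amalgam A K\<close>, with the two maps \<open>amalgam_incl A K\<close>, is the pushout in the category of groups:
  the next three lemmas give the commuting square and its universal property.\<close>

lemma amalgam_incl_hom:
  assumes "group A"
  shows "amalgam_incl A K i \<in> hom A (amalgam A K)"
proof -
  interpret group A by fact
  show ?thesis
  proof (rule homI)
    fix a assume "a \<in> carrier A"
    then show "amalgam_incl A K i a \<in> carrier (amalgam A K)"
      by (simp add: amalgam_incl_def amalgam_class_closed)
  next
    fix a b assume "a \<in> carrier A" "b \<in> carrier A"
    then show "amalgam_incl A K i (a \<otimes>\<^bsub>A\<^esub> b)
               = amalgam_incl A K i a \<otimes>\<^bsub>amalgam A K\<^esub> amalgam_incl A K i b"
      using amalgam_eq.mult[of "[]" A "[]" a b K i]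
      by (simp add: amalgam_incl_def amalgam_mult[OF assms] amalgam_class_eq_iff[OF assms]
            amalgam_eq.sym)
  qed
qed

lemma amalgam_incl_glue:
  assumes "group A" "k \<in> K" "k \<in> carrier A"
  shows "amalgam_incl A K i k = amalgam_incl A K j k"
  using amalgam_eq.glue[of "[]" A "[]" k K i j] assms
  by (simp add: amalgam_incl_def amalgam_class_eq_iff[OF assms(1)])

lemma amalgam_universal:
  assumes "group A" "group H" and f: "\<And>i. f i \<in> hom A H"
    and glue: "\<And>k i j. k \<in> K \<Longrightarrow> f i k = f j k"
  shows "\<exists>h\<in>hom (amalgam A K) H.
           (\<forall>i. \<forall>a\<in>carrier A. h (amalgam_incl A K i a) = f i a) \<and>
           (\<forall>h'\<in>hom (amalgam A K) H.
              (\<forall>i. \<forall>a\<in>carrier A. h' (amalgam_incl A K i a) = f i a) \<longrightarrow>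
              (\<forall>x\<in>carrier (amalgam A K). h' x = h x))"
proof -
  interpret A: group A by fact
  interpret H: group H by fact
  interpret G: group "amalgam A K" by (rule group_amalgam) fact
  define ev where "ev w = foldr (\<lambda>x y. f (fst x) (snd x) \<otimes>\<^bsub>H\<^esub> y) w \<one>\<^bsub>H\<^esub>" for w
  have fc: "f i a \<in> carrier H" if "a \<in> carrier A" for i a
    using f[of i] that by (auto simp: hom_def)
  have fm: "f i (a \<otimes>\<^bsub>A\<^esub> b) = f i a \<otimes>\<^bsub>H\<^esub> f i b" if "a \<in> carrier A" "b \<in> carrier A" for i a b
    using f[of i] that by (auto simp: hom_def)
  have f1: "f i \<one>\<^bsub>A\<^esub> = \<one>\<^bsub>H\<^esub>" for i
    using hom_one[OF f \<open>group A\<close> \<open>group H\<close>] .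
  have ev_simps [simp]: "ev [] = \<one>\<^bsub>H\<^esub>" "ev (x # w) = f (fst x) (snd x) \<otimes>\<^bsub>H\<^esub> ev w" for x w
    by (simp_all add: ev_def)
  have evc: "ev w \<in> carrier H" if "w \<in> amalgam_words A" for w
    using that by (induction w) (auto simp: fc)
  have evapp: "ev (v @ w) = ev v \<otimes>\<^bsub>H\<^esub> ev w"
    if "v \<in> amalgam_words A" "w \<in> amalgam_words A" for v w
    using that by (induction v) (auto simp: fc evc H.m_assoc)
  have eveq: "ev v = ev w" if "amalgam_eq A K v w" for v w
    using that
  proof induction
    case (mult u v a b i)
    then show ?case by (simp add: evapp fm fc evc H.m_assoc)
  next
    case (glue u v k i j)
    then show ?case using assms(4)[of k i j] by (simp add: evapp)
  qed (auto simp: evapp f1 evc)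
  define h where "h X = ev (SOME w. w \<in> X)" for X
  have hev: "h (amalgam_rel A K `` {w}) = ev w" if "w \<in> amalgam_words A" for w
  proof -
    have "w \<in> amalgam_rel A K `` {w}"
      using that by (simp add: amalgam_rel_def amalgam_eq.refl)
    then have "(SOME w'. w' \<in> amalgam_rel A K `` {w}) \<in> amalgam_rel A K `` {w}"
      by (rule someI)
    then show ?thesis using eveq by (simp add: h_def amalgam_rel_def)
  qed
  have h: "h \<in> hom (amalgam A K) H"
    by (rule homI)
      (auto elim!: amalgam_carrierE simp: hev evc evapp amalgam_mult[OF \<open>group A\<close>])
  have hincl: "h (amalgam_incl A K i a) = f i a" if "a \<in> carrier A" for i a
    using that by (simp add: amalgam_incl_def hev fc)
  have unique: "h' x = h x"
    if h': "h' \<in> hom (amalgam A K) H"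
      and e: "\<forall>i. \<forall>a\<in>carrier A. h' (amalgam_incl A K i a) = f i a"
      and x: "x \<in> carrier (amalgam A K)" for h' x
  proof -
    have "h' (amalgam_rel A K `` {w}) = ev w" if "w \<in> amalgam_words A" for w
      using that
    proof (induction w)
      case Nil
      then show ?case using hom_one[OF h' G.group_axioms \<open>group H\<close>] by (simp add: amalgam_one)
    next
      case (Cons y w)
      then have y: "snd y \<in> carrier A" and w: "w \<in> amalgam_words A" by auto
      have "amalgam_rel A K `` {y # w}
            = amalgam_incl A K (fst y) (snd y) \<otimes>\<^bsub>amalgam A K\<^esub> (amalgam_rel A K `` {w})"
        using y w by (simp add: amalgam_incl_def amalgam_mult[OF \<open>group A\<close>])
      moreover have "amalgam_incl A K (fst y) (snd y) \<in> carrier (amalgam A K)"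
        using y by (simp add: amalgam_incl_def amalgam_class_closed)
      ultimately show ?case
        using Cons.IH[OF w] e y hom_mult[OF h'] amalgam_class_closed[OF w] by simp
    qed
    then show ?thesis using x by (auto elim!: amalgam_carrierE simp: hev)
  qed
  show ?thesis
  proof (rule bexI[OF _ h], intro conjI allI ballI impI)
    show "h (amalgam_incl A K i a) = f i a" if "a \<in> carrier A" for i a
      using hincl that .
    show "h' x = h x"
      if "h' \<in> hom (amalgam A K) H"
        "\<forall>i. \<forall>a\<in>carrier A. h' (amalgam_incl A K i a) = f i a"
        "x \<in> carrier (amalgam A K)" for h' x
      using unique that .
  qed
qed


section \<open>Cayley graphs and double rays\<close>

text \<open>
  As in \<open>Graph_Theory\<close>, an undirected simple graph is a symmetric loop-free digraph whose arcs are
  pairs of vertices (\<open>pair_bidirected_digraph\<close>); an edge is represented by its two orientations.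
  Its degree at a vertex is therefore the out-degree.
\<close>

definition Cay :: "('a, 'm) monoid_scheme \<Rightarrow> 'a set \<Rightarrow> 'a pair_pre_digraph" where
  "Cay G S =
     \<lparr>pverts = carrier G,
      parcs = {(g, g \<otimes>\<^bsub>G\<^esub> s) | g s. g \<in> carrier G \<and> s \<in> S} \<union>
              {(g \<otimes>\<^bsub>G\<^esub> s, g) | g s. g \<in> carrier G \<and> s \<in> S}\<rparr>"

definition double_ray :: "'v pair_pre_digraph \<Rightarrow> bool" where
  "double_ray R \<longleftrightarrow>
     pair_bidirected_digraph R \<and> infinite (pverts R) \<and>
     Digraph_Component.connected (with_proj R) \<and>
     (\<forall>v \<in> pverts R. out_degree (with_proj R) v = 2)"

text \<open>\<open>spanning R X\<close> says that \<open>R\<close> is a subgraph of \<open>X\<close> containing all vertices of \<open>X\<close>.\<close>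

definition hamiltonian_double_ray :: "'v pair_pre_digraph \<Rightarrow> 'v pair_pre_digraph \<Rightarrow> bool" where
  "hamiltonian_double_ray R X \<longleftrightarrow>
     double_ray R \<and> spanning (with_proj R) (with_proj X)"

lemma pair_bidirected_digraph_Cay:
  assumes "group G" "S \<subseteq> carrier G" "\<one>\<^bsub>G\<^esub> \<notin> S"
  shows "pair_bidirected_digraph (Cay G S)"
proof -
  interpret group G by fact
  have no_fix: "g \<otimes>\<^bsub>G\<^esub> s \<noteq> g" if "g \<in> carrier G" "s \<in> S" for g s
    using that assms(2,3) r_cancel_one[of g s] by auto
  have closed: "g \<otimes>\<^bsub>G\<^esub> s \<in> carrier G" if "g \<in> carrier G" "s \<in> S" for g s
    using that assms(2) by auto
  show ?thesis
  proof unfold_locales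
    show "Digraph.symmetric (with_proj (Cay G S))"
      unfolding Digraph.symmetric_def with_proj_simps by (rule symI) (auto simp: Cay_def)
    show "fst e \<noteq> snd e" if "e \<in> parcs (Cay G S)" for e
      using that no_fix by (fastforce simp: Cay_def)
  qed (auto simp: Cay_def closed)
qed

end

theory Submission
  imports Defs
begin

text \<open>
  The group \<open>G = A *\<^sub>K A\<close> maps onto the infinite dihedral group with finite kernel \<open>K\<close>; the preimage
  \<open>N\<close> of the translations is abelian and every element outside \<open>N\<close> (a reflection) inverts \<open>N\<close> by
  conjugation.  If some generator \<open>c \<in> N\<close> has infinite order, a Hamiltonian path in the finite graph
  of cosets of \<open>\<langle>c\<rangle>\<close> turns \<open>G\<close> into a strip \<open>path \<times> \<int>\<close>, which is traversed column by column.

  Otherwise the generators in \<open>N\<close> generate a finite normal subgroup \<open>H\<close>, and it suffices to find a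
  double ray through the cosets of \<open>H\<close> that uses reflections only.  Let \<open>p, q\<close> be the generating
  reflections of least and greatest translation part, and \<open>t = q p\<^sup>-\<^sup>1\<close>.  Modulo \<open>H\<close> the group splits
  into \<open>R\<close> rows, each a double ray alternating between \<open>p\<close> and \<open>q\<close>, and the products \<open>p d\<close> lead from
  row to row along a path \<open>y\<^sub>0, \<dots>, y\<^sub>R\<^sub>-\<^sub>1\<close> whose sequence of steps is a palindrome.  Its end can be joined
  to an earlier row \<open>A < R / 2\<close>; by the palindrome symmetry the row \<open>R - 1 - A\<close> can be joined to row
  \<open>0\<close> with the same excess \<open>t\<^sup>-\<^sup>x\<close>.  Working modulo \<open>t\<^sup>2\<close>, where a row is a 4-cycle, one visits the
  rows \<open>0..A-1\<close> completely, the middle rows by one edge each, the last \<open>A\<close> rows completely, and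
  the middle rows once more.  A complete visit shifts the position by \<open>t\<^sup>2\<close> or \<open>t\<^sup>-\<^sup>1\<close> and a single
  edge by \<open>t\<close> or \<open>1\<close>.  With \<open>S\<close> forward complete visits in each of the two groups of \<open>A\<close> rows and
  \<open>c\<close> forward edges in the middle, both halves of the tour shift by \<open>t\<close> to the power
  \<open>3 S + c - A - x\<close>; since \<open>0 \<le> x \<le> R - A\<close>, this can be made \<open>1\<close> or \<open>-1\<close>, and then the tour closes
  up to \<open>t\<^sup>2\<close> or \<open>t\<^sup>-\<^sup>2\<close>, i.e. its translates form a single double ray.
\<close>

section \<open>Double rays from two-way infinite sequences\<close>

text \<open>The ray keeps all vertices of \<open>X\<close> and only the arcs between consecutive
  values of \<open>v\<close>, in both orientations. Injectivity of \<open>v\<close> leaves every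
  vertex exactly the neighbours with index one lower and one higher.\<close>

lemma hamiltonian_double_ray_of_bij:
  fixes v :: "int \<Rightarrow> 'g"
  assumes X: "pair_bidirected_digraph X"
    and bij: "bij_betw v UNIV (pverts X)"
    and arc: "\<And>i. (v i, v (i + 1)) \<in> parcs X"
  shows "\<exists>R. hamiltonian_double_ray R X"
proof -
  interpret X: pair_bidirected_digraph X by fact
  define R where "R = \<lparr>pverts = pverts X,
    parcs = {(v i, v (i + 1)) | i. True} \<union> {(v (i + 1), v i) | i. True}\<rparr>"
  have inj: "v i = v j \<longleftrightarrow> i = j" for i j
    using bij by (auto simp: bij_betw_def inj_on_def)
  have vin: "v i \<in> pverts X" for i
    using bij by (auto simp: bij_betw_def)
  have surj: "\<exists>i. x = v i" if "x \<in> pverts X" for x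
    using bij that by (auto simp: bij_betw_def)
  have sub: "parcs R \<subseteq> parcs X"
    using arc X.arcs_symmetric by (auto simp: R_def)
  have R: "pair_bidirected_digraph R"
  proof unfold_locales
    show "Digraph.symmetric (with_proj R)"
      unfolding Digraph.symmetric_def with_proj_simps by (rule symI) (auto simp: R_def)
  qed (auto simp: R_def vin inj)
  interpret R: pair_bidirected_digraph R by fact
  have "infinite (range v)"
    using inj finite_imageD[of v UNIV] by (auto simp: inj_on_def infinite_UNIV_int)
  then have inf: "infinite (pverts R)"
    using bij by (simp add: R_def bij_betw_def)
  have pvR: "pverts R = pverts X" by (simp add: R_def)
  have up: "v i \<rightarrow>\<^sup>*\<^bsub>with_proj R\<^esub> v (i + int n)" for i n
  proof (induction n)
    case 0
    then show ?case using vin pvR by auto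
  next
    case (Suc n)
    have "(v (i + int n), v (i + int n + 1)) \<in> parcs R" by (auto simp: R_def)
    then have "v (i + int n) \<rightarrow>\<^sup>*\<^bsub>with_proj R\<^esub> v (i + int n + 1)"
      by (intro R.reachable_adjI) auto
    with Suc have "v i \<rightarrow>\<^sup>*\<^bsub>with_proj R\<^esub> v (i + int n + 1)" by (rule R.reachable_trans)
    moreover have "i + int n + 1 = i + int (Suc n)" by simp
    ultimately show ?case by simp
  qed
  have up': "v i \<rightarrow>\<^sup>*\<^bsub>with_proj R\<^esub> v j" if "i \<le> j" for i j
    using up[of i "nat (j - i)"] that by simp
  have reach: "v i \<rightarrow>\<^sup>*\<^bsub>with_proj R\<^esub> v j" for i j
    using up'[of i j] up'[of j i] symmetric_reachable[OF R.sym_arcs, of "v j" "v i"] by linarith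
  have "strongly_connected (with_proj R)"
    unfolding strongly_connected_def
  proof (intro conjI ballI)
    show "verts (with_proj R) \<noteq> {}" using vin pvR by auto
    fix x y assume "x \<in> verts (with_proj R)" "y \<in> verts (with_proj R)"
    then obtain i j where "x = v i" "y = v j" using surj pvR by (metis with_proj_simps(1))
    then show "x \<rightarrow>\<^sup>*\<^bsub>with_proj R\<^esub> y" using reach by simp
  qed
  then have con: "Digraph_Component.connected (with_proj R)"
    using R.reachable_mk_symmetricI unfolding connected_def strongly_connected_def by auto
  have "out_degree (with_proj R) x = 2" if "x \<in> pverts R" for x
  proof -
    obtain i where i: "x = v i" using surj \<open>x \<in> pverts R\<close> pvR by auto
    have "out_arcs (with_proj R) x = {(v i, v (i + 1)), (v i, v (i - 1))}"
      unfolding out_arcs_def i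
      by (auto simp: R_def inj intro: exI[of _ "i - 1"])
    then show ?thesis by (simp add: out_degree_def inj)
  qed
  then have "double_ray R" using R inf con by (simp add: double_ray_def)
  moreover have "spanning (with_proj R) (with_proj X)"
    unfolding spanning_def subgraph_def compatible_def
    using sub pvR R.wf_digraph_axioms X.wf_digraph_axioms by auto
  ultimately show ?thesis unfolding hamiltonian_double_ray_def by blast
qed

section \<open>Groups with a finite kernel over the infinite dihedral group\<close>

text \<open>\<open>sg\<close> and \<open>ht\<close> are the linear and the translation part of an action on \<open>\<int>\<close>.\<close>

locale quasi_dihedral_group = group G for G (structure) +
  fixes sg :: "'a \<Rightarrow> int" and ht :: "'a \<Rightarrow> int"
  assumes sg_cases: "x \<in> carrier G \<Longrightarrow> sg x = 1 \<or> sg x = -1"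
    and sg_mult: "x \<in> carrier G \<Longrightarrow> y \<in> carrier G \<Longrightarrow> sg (x \<otimes> y) = sg x * sg y"
    and ht_mult: "x \<in> carrier G \<Longrightarrow> y \<in> carrier G \<Longrightarrow> ht (x \<otimes> y) = ht x + sg x * ht y"
    and refl_conj: "b \<in> carrier G \<Longrightarrow> x \<in> carrier G \<Longrightarrow> sg b = -1 \<Longrightarrow> sg x = 1 \<Longrightarrow> b \<otimes> x = inv x \<otimes> b"
    and refl_ex: "\<exists>b\<in>carrier G. sg b = -1"
    and finite_kernel: "finite {x \<in> carrier G. sg x = 1 \<and> ht x = 0}"
begin

section \<open>Translations \<open>N\<close>, reflections \<open>B\<close> and their commutation
  rules\<close>

definition N where "N = {x \<in> carrier G. sg x = 1}"
definition B where "B = {x \<in> carrier G. sg x = -1}"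

lemma N_carrier: "x \<in> N \<Longrightarrow> x \<in> carrier G"
  and B_carrier: "x \<in> B \<Longrightarrow> x \<in> carrier G"
  by (auto simp: N_def B_def)

lemma carrier_cases: "x \<in> carrier G \<longleftrightarrow> x \<in> N \<or> x \<in> B"
  using sg_cases[of x] unfolding N_def B_def by blast

lemma N_B_disjoint: "x \<in> N \<Longrightarrow> x \<notin> B"
  by (auto simp: N_def B_def)

lemma sg_one [simp]: "sg \<one> = 1"
  using sg_mult[of \<one> \<one>] sg_cases[of \<one>] by force

lemma ht_one [simp]: "ht \<one> = 0"
  using ht_mult[of \<one> \<one>] by simp

lemma sg_inv [simp]: assumes "x \<in> carrier G" shows "sg (inv x) = sg x"
proof -
  have "sg x * sg (inv x) = 1" using sg_mult[of x "inv x"] assms by simp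
  then show ?thesis using sg_cases[of x] assms by auto
qed

lemma N_subgroup: "subgroup N G"
  by (rule subgroupI) (auto simp: N_def sg_mult)

declare N_carrier [simp] B_carrier [simp]

lemma N_closed [simp]:
  "\<one> \<in> N" "x \<in> N \<Longrightarrow> inv x \<in> N" "x \<in> N \<Longrightarrow> y \<in> N \<Longrightarrow> x \<otimes> y \<in> N"
  using N_subgroup by (simp_all add: subgroup.one_closed subgroup.m_inv_closed subgroup.m_closed)

lemma N_pow [simp]: "x \<in> N \<Longrightarrow> x [^] (n::nat) \<in> N"
  by (induction n) simp_all

lemma N_int_pow [simp]: "x \<in> N \<Longrightarrow> x [^] (k::int) \<in> N"
  by (rule subgroup_int_pow_closed[OF N_subgroup])

lemma B_mult [simp]:
  "x \<in> N \<Longrightarrow> b \<in> B \<Longrightarrow> x \<otimes> b \<in> B" "b \<in> B \<Longrightarrow> x \<in> N \<Longrightarrow> b \<otimes> x \<in> B"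
  "b \<in> B \<Longrightarrow> d \<in> B \<Longrightarrow> b \<otimes> d \<in> N" "b \<in> B \<Longrightarrow> inv b \<in> B"
  by (simp_all add: N_def B_def sg_mult del: N_carrier B_carrier)

lemma refl_commute: assumes "b \<in> B" "x \<in> N" shows "b \<otimes> x = inv x \<otimes> b"
  using refl_conj[of b x] assms unfolding N_def B_def by blast

text \<open>Conjugation by a reflection is a homomorphism and acts on \<open>N\<close> as inversion;
  a group on which inversion is a homomorphism is abelian.\<close>

lemma N_comm: assumes "x \<in> N" "y \<in> N" shows "x \<otimes> y = y \<otimes> x"
proof -
  obtain b where b: "b \<in> B" using refl_ex by (auto simp: B_def simp del: B_carrier)
  note * = refl_commute[OF b]
  have "inv (x \<otimes> y) \<otimes> b = b \<otimes> (x \<otimes> y)" using *[of "x \<otimes> y"] assms by simp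
  also have "\<dots> = (inv x \<otimes> b) \<otimes> y" using b assms *[of x] by (simp flip: m_assoc)
  also have "\<dots> = inv x \<otimes> (inv y \<otimes> b)" using b assms *[of y] by (simp add: m_assoc)
  also have "\<dots> = (inv x \<otimes> inv y) \<otimes> b" using b assms by (simp add: m_assoc)
  finally have "inv (x \<otimes> y) = inv x \<otimes> inv y"
    using b assms right_cancel[of b "inv (x \<otimes> y)" "inv x \<otimes> inv y"] by simp
  then show ?thesis using assms by (metis N_carrier inv_inv inv_mult_group m_closed)
qed

lemma N_lcomm: "x \<in> N \<Longrightarrow> y \<in> N \<Longrightarrow> z \<in> carrier G \<Longrightarrow> x \<otimes> (y \<otimes> z) = y \<otimes> (x \<otimes> z)"
  by (metis N_carrier N_comm m_assoc)

lemma cancel_inv [simp]: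
  "x \<in> carrier G \<Longrightarrow> y \<in> carrier G \<Longrightarrow> inv x \<otimes> (x \<otimes> y) = y"
  "x \<in> carrier G \<Longrightarrow> y \<in> carrier G \<Longrightarrow> x \<otimes> (inv x \<otimes> y) = y"
  by (simp_all flip: m_assoc)

lemma N_pow_distrib: "x \<in> N \<Longrightarrow> y \<in> N \<Longrightarrow> (x \<otimes> y) [^] (n::nat) = x [^] n \<otimes> y [^] n"
  by (simp add: N_comm pow_mult_distrib)

lemmas N_ac = m_assoc N_comm N_lcomm

section \<open>Paths through the cosets of a subgroup of \<open>N\<close>\<close>

text \<open>The cosets are left cosets of \<open>L\<close>. Representatives are a family and not a
  set so that the order of the indices can serve as a path; for \<open>L = {\<one>}\<close> this is
  an enumeration without repetition.\<close>

definition transversal :: "('i \<Rightarrow> 'a) \<Rightarrow> 'i set \<Rightarrow> 'a set \<Rightarrow> 'a set \<Rightarrow> bool" where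
  "transversal v I L U \<longleftrightarrow> v ` I \<subseteq> U \<and> (\<forall>g\<in>U. \<exists>i\<in>I. inv (v i) \<otimes> g \<in> L) \<and>
     (\<forall>i\<in>I. \<forall>j\<in>I. inv (v i) \<otimes> v j \<in> L \<longrightarrow> i = j)"


text \<open>Since \<open>N\<close> is abelian, the products of powers of \<open>w\<close> with
  elements of \<open>U\<close> are already closed under multiplication and inversion.\<close>

lemma cyclic_extension:
  assumes U: "subgroup U G" "U \<subseteq> N" and w: "w \<in> N"
  defines "V \<equiv> {w [^] k \<otimes> u | (k::int) u. u \<in> U}"
  shows "subgroup V G" "U \<subseteq> V" "w \<in> V" "V \<subseteq> N"
proof -
  note mem = subgroup.one_closed[OF U(1)] subgroup.m_closed[OF U(1)] subgroup.m_inv_closed[OF U(1)]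
  have UN: "u \<in> N" if "u \<in> U" for u using that U by auto
  show VN: "V \<subseteq> N" using UN w by (auto simp: V_def)
  have "u \<in> V" if "u \<in> U" for u
    unfolding V_def using that UN by (auto intro!: exI[of _ "0::int"] exI[of _ u])
  then show "U \<subseteq> V" by auto
  show "w \<in> V" unfolding V_def using mem w by (auto intro!: exI[of _ "1::int"] exI[of _ \<one>])
  show "subgroup V G"
  proof (rule subgroupI)
    show "V \<subseteq> carrier G" using VN by auto
    show "V \<noteq> {}" using \<open>w \<in> V\<close> by auto
    fix a assume "a \<in> V"
    then obtain k u where a: "a = w [^] (k::int) \<otimes> u" "u \<in> U" by (auto simp: V_def)
    then have "inv a = w [^] (-k) \<otimes> inv u"
      using w UN by (simp add: inv_mult_group int_pow_neg N_comm)
    then show "inv a \<in> V" using a mem unfolding V_def by blast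
    fix b assume "b \<in> V"
    then obtain l v where b: "b = w [^] (l::int) \<otimes> v" "v \<in> U" by (auto simp: V_def)
    have "a \<otimes> b = w [^] (k + l) \<otimes> (u \<otimes> v)"
      using a b w UN by (simp add: int_pow_mult N_ac)
    then show "a \<otimes> b \<in> V" using a b mem unfolding V_def by blast
  qed
qed

text \<open>One generator \<open>x\<close> is added to a coset path \<open>y\<close> of
  \<open>U\<close>. From its last point the step \<open>x\<close> leads to
  \<open>w = y (R - 1) \<otimes> x\<close>, where a translate of \<open>y\<close> is followed, and
  so on until the cosets of \<open>U\<close> are exhausted. The product identity for
  \<open>z\<close> says that the sequence of steps is a palindrome. The last conclusion prepares a
  closing step: \<open>x\<close> would lead from the end back into \<open>U\<close>.\<close>

lemma nested_path_step:
  assumes L: "subgroup L G"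
    and U: "subgroup U G" "U \<subseteq> N" "L \<subseteq> U"
    and R: "R > 0" "y 0 = \<one>"
    and comp: "\<And>i. i < R \<Longrightarrow> y i \<otimes> y (R - 1 - i) = y (R - 1)"
    and tv: "transversal y {..<R} L U"
    and x: "x \<in> N" "x \<notin> U" "(n::nat) > 0" "x [^] n \<in> U"
  obtains r z V where "r \<ge> 2" "\<And>t. t < R \<Longrightarrow> z t = y t"
    "\<And>i j. j < R \<Longrightarrow> Suc j < R \<Longrightarrow> i < r \<Longrightarrow> inv (z (i * R + j)) \<otimes> z (i * R + Suc j) = inv (y j) \<otimes> y (Suc j)"
    "\<And>i. Suc i < r \<Longrightarrow> z (i * R + R) = z (i * R + (R - 1)) \<otimes> x"
    "\<And>t. t < r * R \<Longrightarrow> z t \<otimes> z (r * R - 1 - t) = z (r * R - 1)"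
    "subgroup V G" "V \<subseteq> N" "U \<subseteq> V" "x \<in> V" "transversal z {..<r * R} L V"
    "z (r * R - 1) \<otimes> x \<in> U"
proof -
  note mem = subgroup.one_closed[OF U(1)] subgroup.m_closed[OF U(1)] subgroup.m_inv_closed[OF U(1)]
  have UN: "u \<in> N" if "u \<in> U" for u using that U by auto
  have yU: "y i \<in> U" if "i < R" for i using tv that by (auto simp: transversal_def)
  have yN: "y i \<in> N" if "i < R" for i using UN yU that by auto
  define e where "e = y (R - 1)"
  have e: "e \<in> U" "e \<in> N" using yU[of "R - 1"] R UN by (auto simp: e_def)
  define w where "w = e \<otimes> x"
  have w: "w \<in> N" using e x by (simp add: w_def)
  \<comment> \<open>\<open>e\<close> lies in \<open>U\<close> and so does a power of
    \<open>x\<close>, hence \<open>w\<close> has finite order modulo \<open>U\<close>.\<close>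
  have wn: "w [^] n \<in> U"
    using mem(2)[OF _ x(4), of "e [^] n"] e x subgroup_int_pow_closed[OF U(1) e(1), of "int n"]
    by (simp add: w_def N_pow_distrib int_pow_int)
  \<comment> \<open>The order of \<open>w\<close> modulo \<open>U\<close> is the number of
    translates of \<open>y\<close>.\<close>
  define r where "r = (LEAST r. r > 0 \<and> w [^] (r::nat) \<in> U)"
  have r: "r > 0" "w [^] r \<in> U" and rmin: "\<And>m. m > 0 \<Longrightarrow> w [^] (m::nat) \<in> U \<Longrightarrow> r \<le> m"
    using LeastI[of "\<lambda>r. r > 0 \<and> w [^] (r::nat) \<in> U" n] wn x(3)
      Least_le[of "\<lambda>r. r > 0 \<and> w [^] (r::nat) \<in> U"] by (auto simp: r_def)
  have "w \<notin> U"
  proof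
    assume "w \<in> U"
    then have "inv e \<otimes> w \<in> U" using mem e by auto
    then show False using x e by (simp add: w_def)
  qed
  then have r2: "r \<ge> 2" using r w by (cases "r = 1") auto
  have wi: "(i::int) = 0" if "\<bar>i\<bar> < int r" "w [^] i \<in> U" for i
  proof (rule ccontr)
    assume "i \<noteq> 0"
    have "w [^] (nat \<bar>i\<bar>) \<in> U"
    proof (cases "i > 0")
      case True
      then show ?thesis using that(2) int_pow_int[of G w "nat i"] by simp
    next
      case False
      then have "w [^] (nat \<bar>i\<bar>) = inv (w [^] i)"
        using int_pow_int[of G w "nat \<bar>i\<bar>"] int_pow_neg[of w i] w by simp
      then show ?thesis using mem that(2) by simp
    qed
    then show False using rmin[of "nat \<bar>i\<bar>"] that(1) \<open>i \<noteq> 0\<close> by simp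
  qed
  \<comment> \<open>Quotient and remainder modulo \<open>R\<close> are the number of the translate
    and the position in it.\<close>
  define z where "z t = w [^] int (t div R) \<otimes> y (t mod R)" for t
  have z: "z (i * R + j) = w [^] int i \<otimes> y j" if "j < R" for i j
    using that by (simp add: z_def)
  have ze: "z (i * R + (R - 1)) = w [^] int i \<otimes> e" for i
    using z[of "R - 1" i] R by (simp add: e_def)
  have zN: "z t \<in> N" for t using w yN[of "t mod R"] R by (simp add: z_def)
  define V where "V = {w [^] k \<otimes> u | (k::int) u. u \<in> U}"
  note V = cyclic_extension[OF U(1,2) w, folded V_def]
  have xV: "x \<in> V"
  proof -
    have "x = inv e \<otimes> w" using x e by (simp add: w_def)
    then show ?thesis
      using V e by (metis subgroup.m_closed subgroup.m_inv_closed subset_iff)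
  qed
  have tr: "transversal z {..<r * R} L V"
    unfolding transversal_def
  proof (intro conjI ballI impI)
    show "z ` {..<r * R} \<subseteq> V"
      using yU mod_less_divisor[OF R(1)] unfolding z_def V_def by blast
    fix g assume "g \<in> V"
    then obtain k u where g: "g = w [^] (k::int) \<otimes> u" "u \<in> U" by (auto simp: V_def)
    \<comment> \<open>The exponent is reduced modulo \<open>r\<close>; the remaining power of
      \<open>w [^] r\<close> is absorbed into \<open>U\<close>, where \<open>y\<close> finds the
      coset of \<open>L\<close>.\<close>
    define i where "i = nat (k mod int r)"
    define u' where "u' = (w [^] int r) [^] (k div int r) \<otimes> u"
    have i: "i < r" "int i = k mod int r" using r by (auto simp: i_def nat_less_iff)
    have u': "u' \<in> U"
      unfolding u'_def using g mem subgroup_int_pow_closed[OF U(1)] r by (simp add: int_pow_int)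
    have "w [^] k = w [^] (int i + int r * (k div int r))" using i by simp
    then have g': "g = w [^] int i \<otimes> u'"
      using w g UN by (simp only: int_pow_mult int_pow_pow[symmetric] N_carrier u'_def) (simp add: m_assoc)
    obtain j where j: "j < R" "inv (y j) \<otimes> u' \<in> L"
      using tv u' by (auto simp: transversal_def)
    have "i * R + j < r * R"
    proof -
      have "i * R + j < i * R + R" using j by simp
      also have "\<dots> = Suc i * R" by simp
      also have "\<dots> \<le> r * R" using i by (intro mult_le_mono1) simp
      finally show ?thesis .
    qed
    moreover have "inv (z (i * R + j)) \<otimes> g = inv (y j) \<otimes> u'"
      using z[OF j(1)] w yN[OF j(1)] UN[OF u'] by (simp add: g' inv_mult_group m_assoc)
    ultimately show "\<exists>i\<in>{..<r * R}. inv (z i) \<otimes> g \<in> L" using j by force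
  next
    fix s t assume st: "s \<in> {..<r * R}" "t \<in> {..<r * R}" "inv (z s) \<otimes> z t \<in> L"
    define i j i' j' where "i = s div R" "j = s mod R" "i' = t div R" "j' = t mod R"
    have ij: "i < r" "i' < r" "j < R" "j' < R" "s = i * R + j" "t = i' * R + j'"
      using st R by (auto simp: i_j_i'_j'_def less_mult_imp_div_less)
    have eq: "inv (z s) \<otimes> z t = w [^] (int i' - int i) \<otimes> (inv (y j) \<otimes> y j')"
      using w yN ij by (simp add: z inv_mult_group int_pow_diff N_ac)
    have "w [^] (int i' - int i) = (inv (z s) \<otimes> z t) \<otimes> inv (inv (y j) \<otimes> y j')"
      unfolding eq using w yN ij by (simp add: m_assoc)
    also have "\<dots> \<in> U" using st(3) U(3) mem yU ij by auto
    finally have "int i' - int i = 0" using ij by (intro wi) auto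
    then have ii: "i = i'" by simp
    then have "inv (y j) \<otimes> y j' \<in> L" using eq st(3) w yN ij by simp
    then have "j = j'" using tv ij by (auto simp: transversal_def)
    then show "s = t" using ii ij by simp
  qed
  have last: "r * R - 1 = (r - 1) * R + (R - 1)"
    using r R by (cases r) auto
  have comp': "z t \<otimes> z (r * R - 1 - t) = z (r * R - 1)" if "t < r * R" for t
  proof -
    define i j where "i = t div R" "j = t mod R"
    have ij: "i < r" "j < R" "t = i * R + j"
      using that R by (auto simp: i_j_def less_mult_imp_div_less)
    \<comment> \<open>In base \<open>R\<close>, passing from \<open>t\<close> to
      \<open>r * R - 1 - t\<close> complements both digits. So the exponents of \<open>w\<close> add
      up to \<open>r - 1\<close>, and the identity for \<open>y\<close> handles the rest.\<close>
    have "(r - 1 - i) * R + i * R = (r - 1) * R"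
      using ij by (simp flip: add_mult_distrib)
    then have t: "r * R - 1 - t = (r - 1 - i) * R + (R - 1 - j)"
      unfolding last ij(3) using ij(2)
      by (subst \<open>(r - 1 - i) * R + i * R = (r - 1) * R\<close>[symmetric]) simp
    have j: "R - 1 - j < R" "R - 1 < R" using R by auto
    have "z t \<otimes> z (r * R - 1 - t) = (w [^] int i \<otimes> w [^] int (r - 1 - i)) \<otimes> (y j \<otimes> y (R - 1 - j))"
      unfolding t unfolding ij(3) z[OF ij(2)] z[OF j(1)] using w yN ij j by (simp add: N_ac)
    also have "w [^] int i \<otimes> w [^] int (r - 1 - i) = w [^] int (r - 1)"
      using w ij by (simp flip: int_pow_mult)
    also have "w [^] int (r - 1) \<otimes> (y j \<otimes> y (R - 1 - j)) = z (r * R - 1)"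
      unfolding last z[OF j(2)] comp[OF ij(2)] ..
    finally show ?thesis .
  qed
  \<comment> \<open>The point after the last one would begin translate number \<open>r\<close>, and
    \<open>w [^] r\<close> is in \<open>U\<close>.\<close>
  have "z (r * R - 1) \<otimes> x = w [^] int (r - 1) \<otimes> w"
    unfolding last ze using w x e by (simp add: m_assoc flip: w_def)
  also have "\<dots> = w [^] r"
    using w r by (cases r) (simp_all add: int_pow_int)
  finally have fin: "z (r * R - 1) \<otimes> x \<in> U" using r by simp
  show ?thesis
  proof (rule that[of r z V])
    show "inv (z (i * R + j)) \<otimes> z (i * R + Suc j) = inv (y j) \<otimes> y (Suc j)"
      if "j < R" "Suc j < R" "i < r" for i j
      unfolding z[OF that(1)] z[OF that(2)]
      using w yN that by (simp add: inv_mult_group m_assoc)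
    show "z (i * R + R) = z (i * R + (R - 1)) \<otimes> x" if "Suc i < r" for i
    proof -
      have "z (i * R + R) = w [^] int (Suc i)"
        using z[of 0 "Suc i"] R w by (simp add: add.commute)
      also have "\<dots> = w [^] int i \<otimes> w"
        using w by (simp only: int_pow_int nat_pow_Suc)
      finally show ?thesis unfolding ze using w x e by (simp add: m_assoc flip: w_def)
    qed
  qed (use r2 comp' V xV tr fin R w yN in \<open>auto simp: z_def\<close>)
qed


text \<open>Induction over the generators: one that lies in the current \<open>U\<close> is skipped,
  any other extends the path by \<open>nested_path_step\<close>. In the last clause \<open>s\<close>
  is the generator added last. It leads from the end into the previous group, whose cosets are
  represented by the first translate; as there are at least two translates, the point
  \<open>A\<close> reached lies in the first half of the path.\<close>

lemma nested_path:
  assumes "finite X" "X \<subseteq> N" and L: "subgroup L G" "L \<subseteq> N"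
    and "\<forall>x\<in>X. \<exists>n>0. x [^] (n::nat) \<in> L"
  shows "\<exists>R y U. R > 0 \<and> y 0 = \<one> \<and> (\<forall>i. Suc i < R \<longrightarrow> inv (y i) \<otimes> y (Suc i) \<in> X) \<and>
    (\<forall>i<R. y i \<otimes> y (R - 1 - i) = y (R - 1)) \<and>
    subgroup U G \<and> U \<subseteq> N \<and> L \<subseteq> U \<and> X \<subseteq> U \<and> transversal y {..<R} L U \<and>
    (R = 1 \<or> (\<exists>s\<in>X. \<exists>A. 2 * A < R \<and> inv (y A) \<otimes> (y (R - 1) \<otimes> s) \<in> L))"
  using assms(1,2,5)
proof (induction X rule: finite_induct)
  case empty
  show ?case
    by (intro exI[of _ "Suc 0"] exI[of _ "\<lambda>_. \<one>"] exI[of _ L])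
      (use L subgroup.one_closed[OF L(1)] in \<open>auto simp: transversal_def\<close>)
next
  case (insert x F)
  have F: "F \<subseteq> N" "\<forall>x\<in>F. \<exists>n>0. x [^] (n::nat) \<in> L"
    using insert.prems by auto
  obtain R y U where R: "R > 0" "y 0 = \<one>"
    and st: "\<And>i. Suc i < R \<Longrightarrow> inv (y i) \<otimes> y (Suc i) \<in> F"
    and comp: "\<And>i. i < R \<Longrightarrow> y i \<otimes> y (R - 1 - i) = y (R - 1)"
    and U: "subgroup U G" "U \<subseteq> N" "L \<subseteq> U" and FU: "F \<subseteq> U" and tv: "transversal y {..<R} L U"
    and fin: "R = 1 \<or> (\<exists>s\<in>F. \<exists>A. 2 * A < R \<and> inv (y A) \<otimes> (y (R - 1) \<otimes> s) \<in> L)"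
    using insert.IH[OF F] by (elim exE conjE) (rule that; (assumption | blast))
  show ?case
  proof (cases "x \<in> U")
    case True
    show ?thesis
      by (intro exI[of _ R] exI[of _ y] exI[of _ U])
        (use R st comp U FU tv fin True in auto)
  next
    case False
    obtain n where n: "(n::nat) > 0" "x [^] n \<in> U" using insert.prems(2) U by auto
    have x: "x \<in> N" using insert.prems by simp
    obtain r z V where r: "r \<ge> 2" and zy: "\<And>t. t < R \<Longrightarrow> z t = y t"
      and zs: "\<And>i j. j < R \<Longrightarrow> Suc j < R \<Longrightarrow> i < r \<Longrightarrow>
        inv (z (i * R + j)) \<otimes> z (i * R + Suc j) = inv (y j) \<otimes> y (Suc j)"
      and zb: "\<And>i. Suc i < r \<Longrightarrow> z (i * R + R) = z (i * R + (R - 1)) \<otimes> x"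
      and zc: "\<And>t. t < r * R \<Longrightarrow> z t \<otimes> z (r * R - 1 - t) = z (r * R - 1)"
      and V: "subgroup V G" "V \<subseteq> N" "U \<subseteq> V" "x \<in> V" and tz: "transversal z {..<r * R} L V"
      and zl: "z (r * R - 1) \<otimes> x \<in> U"
      using nested_path_step[OF L(1) U R comp tv x False n] by blast
    have zN: "z t \<in> N" if "t < r * R" for t using tz V that by (auto simp: transversal_def)
    have letter: "inv (z t) \<otimes> z (Suc t) \<in> insert x F" if "Suc t < r * R" for t
    proof -
      define i j where "i = t div R" "j = t mod R"
      have ij: "i < r" "j < R" "t = i * R + j"
        using that R by (auto simp: i_j_def less_mult_imp_div_less)
      show ?thesis
      proof (cases "Suc j < R")
        case True
        then show ?thesis using zs[of j i] st[of j] ij by simp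
      next
        case False
        then have j: "j = R - 1" using ij by simp
        then have t': "Suc t = i * R + R" using ij by simp
        have "Suc i < r"
        proof (rule ccontr)
          assume "\<not> Suc i < r"
          then have "r * R \<le> Suc i * R" by (intro mult_le_mono1) simp
          then show False using that t' by simp
        qed
        then have "z (Suc t) = z t \<otimes> x" using zb[of i] j ij t' by simp
        then show ?thesis using zN[of t] that x by simp
      qed
    qed
    obtain A where A: "A < R" "inv (y A) \<otimes> (z (r * R - 1) \<otimes> x) \<in> L"
      using tv zl by (auto simp: transversal_def)
    have "2 * A < 2 * R" using A by simp
    also have "\<dots> \<le> r * R" using r by simp
    finally have "2 * A < r * R \<and> inv (z A) \<otimes> (z (r * R - 1) \<otimes> x) \<in> L"
      using A zy[of A] by simp
    then show ?thesis
      by (intro exI[of _ "r * R"] exI[of _ z] exI[of _ V])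
        (use R r zy[of 0] letter zc V U(3) FU tz in auto)
  qed
qed

text \<open>Every point of a path through the cosets of \<open>H\<close> is replaced by a copy of
  the path \<open>h\<close> through the cosets of \<open>M\<close> in \<open>H\<close>. The steps
  between copies are reflections, which invert \<open>H\<close>, and the copies are shifted
  accordingly.\<close>

lemma thicken_path:
  fixes v :: "int \<Rightarrow> 'a" and h :: "nat \<Rightarrow> 'a"
  assumes M: "subgroup M G" and H: "subgroup H G" "M \<subseteq> H" "H \<subseteq> N"
    and n: "n > 0" "h 0 = \<one>" and h: "transversal h {..<n} M H" and v: "transversal v I H (carrier G)"
    and hE: "\<And>i. Suc i < n \<Longrightarrow> inv (h i) \<otimes> h (Suc i) \<in> E"
    and vE: "\<And>i. i \<in> I \<Longrightarrow> i + 1 \<in> I \<Longrightarrow> inv (v i) \<otimes> v (i + 1) \<in> E \<inter> B"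
  obtains g where "transversal g {j. j div int n \<in> I} M (carrier G)"
    "\<And>j. j div int n \<in> I \<Longrightarrow> (j + 1) div int n \<in> I \<Longrightarrow> inv (g j) \<otimes> g (j + 1) \<in> E"
proof -
  note memH = subgroup.one_closed[OF H(1)] subgroup.m_closed[OF H(1)] subgroup.m_inv_closed[OF H(1)]
  have HN: "u \<in> N" if "u \<in> H" for u using that H by auto
  have hH: "h r \<in> H" if "r < n" for r using h that by (auto simp: transversal_def)
  have vc: "v i \<in> carrier G" if "i \<in> I" for i using v that by (auto simp: transversal_def)
  define e where "e = h (n - 1)"
  have e: "e \<in> H" "e \<in> N" using hH[of "n - 1"] n HN by (auto simp: e_def)
  \<comment> \<open>A copy at an even index runs from \<open>\<one>\<close> to \<open>e\<close>, a
    copy at an odd index from \<open>inv e\<close> to \<open>\<one>\<close>. A reflection takes the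
    exit \<open>e\<close> to the entry \<open>inv e\<close>, and the exit \<open>\<one>\<close> to
    the entry \<open>\<one>\<close>, so the step between two copies keeps its label.\<close>
  define k where "k i = (if even i then \<one> else inv e)" for i :: int
  have k: "k i \<in> H" "k i \<in> N" for i using e memH HN by (auto simp: k_def)
  define g where "g j = v (j div int n) \<otimes> (k (j div int n) \<otimes> h (nat (j mod int n)))" for j
  have mn: "nat (j mod int n) < n" for j using n by (simp add: nat_less_iff)
  have dm: "(i * int n + int r) div int n = i" "(i * int n + int r) mod int n = int r"
    if "r < n" for i r using that by simp_all
  have gt: "transversal g {j. j div int n \<in> I} M (carrier G)"
    unfolding transversal_def
  proof (intro conjI ballI impI)
    show "g ` {j. j div int n \<in> I} \<subseteq> carrier G"
      using vc k hH HN mn by (auto simp: g_def)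
    fix x assume x: "x \<in> carrier G"
    then obtain i where i: "i \<in> I" "inv (v i) \<otimes> x \<in> H" using v by (auto simp: transversal_def)
    then have "inv (k i) \<otimes> (inv (v i) \<otimes> x) \<in> H" using memH k by auto
    then obtain r where r: "r < n" "inv (h r) \<otimes> (inv (k i) \<otimes> (inv (v i) \<otimes> x)) \<in> M"
      using h by (auto simp: transversal_def)
    have "(int n * i + int r) div int n = i" "(int n * i + int r) mod int n = int r"
      using r by simp_all
    moreover have "inv (v i \<otimes> (k i \<otimes> h r)) \<otimes> x = inv (h r) \<otimes> (inv (k i) \<otimes> (inv (v i) \<otimes> x))"
      using vc[OF i(1)] k hH[OF r(1)] HN x by (simp add: inv_mult_group m_assoc)
    ultimately show "\<exists>j\<in>{j. j div int n \<in> I}. inv (g j) \<otimes> x \<in> M"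
      using i r by (intro bexI[of _ "int n * i + int r"]) (simp_all add: g_def)
  next
    fix j j' assume j: "j \<in> {j. j div int n \<in> I}" "j' \<in> {j. j div int n \<in> I}"
      and m: "inv (g j) \<otimes> g j' \<in> M"
    define i r i' r' where d: "i = j div int n" "r = nat (j mod int n)" "i' = j' div int n" "r' = nat (j' mod int n)"
    have I: "i \<in> I" "i' \<in> I" "r < n" "r' < n" using j mn by (auto simp: d)
    have g: "g j = v i \<otimes> (k i \<otimes> h r)" "g j' = v i' \<otimes> (k i' \<otimes> h r')" by (simp_all add: g_def d)
    have kh: "k i \<otimes> h r \<in> H" "k i' \<otimes> h r' \<in> H" using k hH I memH by auto
    have "inv (v i) \<otimes> v i' = (k i \<otimes> h r) \<otimes> (inv (g j) \<otimes> g j') \<otimes> inv (k i' \<otimes> h r')"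
      unfolding g using vc I HN[OF kh(1)] HN[OF kh(2)]
      by (simp add: inv_mult_group[of "v i"] m_assoc)
    also have "\<dots> \<in> H" using m H(2) kh memH by auto
    finally have ii: "i = i'" using v I by (auto simp: transversal_def)
    then have "inv (g j) \<otimes> g j' = inv (h r) \<otimes> h r'"
      unfolding g using vc I k hH HN by (simp add: inv_mult_group m_assoc)
    then have "r = r'" using m h I by (auto simp: transversal_def)
    then have "j mod int n = j' mod int n" using n by (simp add: d eq_nat_nat_iff)
    then show "j = j'" using ii unfolding d(1,3) by (metis div_mult_mod_eq)
  qed
  have "inv (g j) \<otimes> g (j + 1) \<in> E" if j: "j div int n \<in> I" "(j + 1) div int n \<in> I" for j
  proof -
    define i r where d: "i = j div int n" "r = nat (j mod int n)"
    have r: "r < n" "j = i * int n + int r" using mn n by (auto simp: d)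
    have gj: "g j = v i \<otimes> (k i \<otimes> h r)" by (simp add: g_def d)
    have vi: "v i \<in> carrier G" using j vc by (simp add: d)
    show ?thesis
    proof (cases "Suc r < n")
      case True
      have "j + 1 = i * int n + int (Suc r)" using r by simp
      then have "(j + 1) div int n = i" "(j + 1) mod int n = int (Suc r)"
        by (simp_all only: dm[OF True])
      then have "g (j + 1) = v i \<otimes> (k i \<otimes> h (Suc r))" by (simp only: g_def nat_int)
      then have "inv (g j) \<otimes> g (j + 1) = inv (h r) \<otimes> h (Suc r)"
        unfolding gj using vi k HN[OF hH[OF r(1)]] HN[OF hH[OF True]]
        by (simp add: inv_mult_group m_assoc)
      then show ?thesis using hE True by simp
    next
      case False
      then have rn: "r = n - 1" using r by simp
      have "j + 1 = i * int n + (int r + 1)" using r by simp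
      also have "int r + 1 = int n" using rn n by linarith
      also have "i * int n + int n = (i + 1) * int n + int 0" by (simp add: distrib_right)
      finally have "j + 1 = (i + 1) * int n + int 0" .
      then have *: "(j + 1) div int n = i + 1" "(j + 1) mod int n = 0" "h r = e"
        using dm[OF n(1), of "i + 1"] by (simp_all only: rn e_def of_nat_0)
      then have gj1: "g (j + 1) = v (i + 1) \<otimes> k (i + 1)"
        using n k vc[of "i + 1"] j by (simp add: g_def)
      have iI: "i \<in> I" "i + 1 \<in> I" using j * by (simp_all add: d)
      define b where "b = inv (v i) \<otimes> v (i + 1)"
      have b: "b \<in> E" "b \<in> B" using vE iI by (auto simp: b_def)
      have "inv (g j) \<otimes> g (j + 1) = inv (k i \<otimes> e) \<otimes> (b \<otimes> k (i + 1))"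
        unfolding gj gj1 b_def *(3) using vc iI k e by (simp add: inv_mult_group m_assoc)
      also have "\<dots> = inv (k i \<otimes> e) \<otimes> (inv (k (i + 1)) \<otimes> b)"
        using refl_commute[OF b(2)] k by simp
      also have "\<dots> = b"
        using b e by (cases "even i") (simp_all add: k_def)
      finally show ?thesis using b by simp
    qed
  qed
  with gt show ?thesis by (rule that)
qed


section \<open>Heights and torsion\<close>

lemma ht_N_mult: "x \<in> N \<Longrightarrow> y \<in> carrier G \<Longrightarrow> ht (x \<otimes> y) = ht x + ht y"
  using ht_mult[of x y] unfolding N_def by simp

lemma ht_N_inv: "x \<in> N \<Longrightarrow> ht (inv x) = - ht x"
  using ht_N_mult[of x "inv x"] by simp

lemma ht_N_pow: "x \<in> N \<Longrightarrow> ht (x [^] (n::nat)) = int n * ht x"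
  by (induction n) (simp_all add: ht_N_mult algebra_simps)

lemma ht_N_int_pow: assumes "x \<in> N" shows "ht (x [^] (k::int)) = k * ht x"
proof (cases "k \<ge> 0")
  case True
  then show ?thesis using ht_N_pow[OF assms, of "nat k"] int_pow_int[of G x "nat k"] by simp
next
  case False
  then have "x [^] k = inv (x [^] nat (-k))"
    using int_pow_neg[of x "-k"] int_pow_int[of G x "nat (-k)"] assms by simp
  then have "ht (x [^] k) = - ht (x [^] nat (-k))" using assms by (simp only: ht_N_inv N_pow)
  then show ?thesis using False ht_N_pow[OF assms, of "nat (-k)"] by simp
qed

lemma ht_B_mult: "b \<in> B \<Longrightarrow> y \<in> carrier G \<Longrightarrow> ht (b \<otimes> y) = ht b - ht y"
  using ht_mult[of b y] unfolding B_def by simp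

text \<open>Pigeonhole: all powers of \<open>g\<close> stay in the finite kernel.\<close>

lemma kernel_torsion:
  assumes g: "g \<in> N" "ht g = 0"
  shows "\<exists>n>0. g [^] (n::nat) = \<one>"
proof -
  have "range (\<lambda>n::nat. g [^] n) \<subseteq> {x \<in> carrier G. sg x = 1 \<and> ht x = 0}"
    using g N_pow[OF g(1)] unfolding N_def by (auto simp: ht_N_pow[OF g(1)])
  then have "finite (range (\<lambda>n::nat. g [^] n))"
    using finite_kernel by (rule finite_subset)
  then have "\<not> inj (\<lambda>n::nat. g [^] n)"
    using finite_imageD by fastforce
  then obtain i j where "i < j" "g [^] (i::nat) = g [^] j"
    by (metis injI linorder_neqE_nat)
  then have "g [^] i \<otimes> g [^] (j - i) = g [^] i"
    using g nat_pow_mult[of g i "j - i"] by simp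
  then have "g [^] (j - i) = \<one>" using g by (simp add: r_cancel_one)
  then show ?thesis using \<open>i < j\<close> by (intro exI[of _ "j - i"]) simp
qed

text \<open>The powers \<open>x [^] ht c\<close> and \<open>c [^] ht x\<close> have equal height, so
  their quotient has finite order. Hence \<open>N\<close> is torsion modulo the powers of
  \<open>c\<close>, as coset paths demand.\<close>

lemma commensurable:
  assumes x: "x \<in> N" and c: "c \<in> N" "ht c \<noteq> 0"
  shows "\<exists>n>0. \<exists>k::int. x [^] (n::nat) = c [^] k"
proof -
  define g where "g = x [^] ht c \<otimes> inv (c [^] ht x)"
  have gN: "g \<in> N" using x c by (simp add: g_def)
  have "ht g = 0" using x c by (simp add: g_def ht_N_mult ht_N_inv ht_N_int_pow)
  then obtain n :: nat where n: "n > 0" "g [^] n = \<one>" using kernel_torsion[OF gN] by blast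
  have "x [^] ht c = g \<otimes> c [^] ht x" using x c by (simp add: g_def m_assoc)
  then have "(x [^] ht c) [^] n = g [^] n \<otimes> (c [^] ht x) [^] n"
    using gN c N_pow_distrib[OF gN, of "c [^] ht x" n] by simp
  then have *: "x [^] (ht c * int n) = c [^] (ht x * int n)"
    using n x c by (simp add: int_pow_pow flip: int_pow_int)
  define m where "m = nat \<bar>ht c * int n\<bar>"
  have m: "m > 0" using n c by (simp add: m_def)
  show ?thesis
  proof (cases "ht c > 0")
    case True
    then have "int m = ht c * int n" by (simp add: m_def)
    then have "x [^] m = c [^] (ht x * int n)" using * by (simp flip: int_pow_int)
    then show ?thesis using m by blast
  next
    case False
    then have "int m = - (ht c * int n)" using c n by (simp add: m_def mult_le_0_iff)
    then have "x [^] m = inv (c [^] (ht x * int n))"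
      using * x by (simp add: int_pow_neg flip: int_pow_int)
    then have "x [^] m = c [^] (- (ht x * int n))" using c by (simp add: int_pow_neg)
    then show ?thesis using m by blast
  qed
qed

section \<open>Rows: coset paths made of products of two reflections\<close>

text \<open>Because \<open>b\<close> inverts \<open>U\<close> and \<open>b \<otimes> b\<close> is in
  \<open>U\<close>, the union of \<open>U\<close> and its translate by \<open>b\<close> is a
  subgroup. It contains \<open>E\<close>, hence is everything, and its part in \<open>N\<close> is
  \<open>U\<close>.\<close>

lemma N_generated:
  assumes E: "E \<subseteq> carrier G" "\<And>x. x \<in> E \<Longrightarrow> inv x \<in> E" "generate G E = carrier G"
    and b: "b \<in> E" "b \<in> B"
    and U: "subgroup U G" "U \<subseteq> N" "E \<inter> N \<subseteq> U" "\<And>d. d \<in> E \<Longrightarrow> d \<in> B \<Longrightarrow> b \<otimes> d \<in> U"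
  shows "U = N"
proof -
  note mem = subgroup.one_closed[OF U(1)] subgroup.m_closed[OF U(1)] subgroup.m_inv_closed[OF U(1)]
  have UN: "u \<in> N" if "u \<in> U" for u using that U by auto
  define W where "W = U \<union> {u \<otimes> b | u. u \<in> U}"
  have Wb: "u \<otimes> b \<in> W" if "u \<in> U" for u using that by (auto simp: W_def)
  have bb: "b \<otimes> b \<in> U" using U(4) b by simp
  have WE: "d \<in> W" if d: "d \<in> E" for d
  proof (cases "d \<in> N")
    case True
    then show ?thesis using d U(3) by (auto simp: W_def)
  next
    case False
    then have dB: "d \<in> B" using d E carrier_cases[of d] by auto
    \<comment> \<open>The closure of \<open>E\<close> under inverses enters here: \<open>d\<close>
      is recovered from the product of \<open>b\<close> with \<open>inv d\<close>.\<close>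
    then have "inv (b \<otimes> inv d) \<in> U" using U(4)[of "inv d"] E(2)[OF d] mem by simp
    moreover have "inv (b \<otimes> inv d) \<otimes> b = d" using dB b by (simp add: inv_mult_group m_assoc)
    ultimately show ?thesis using Wb by metis
  qed
  have "subgroup W G"
  proof (rule subgroupI)
    show "W \<subseteq> carrier G" using UN b by (auto simp: W_def)
    show "W \<noteq> {}" using mem by (auto simp: W_def)
    have Wc: "a \<in> U \<or> (\<exists>u\<in>U. a = u \<otimes> b)" if "a \<in> W" for a using that by (auto simp: W_def)
    show "inv a \<in> W" if "a \<in> W" for a
      using Wc[OF that]
    proof (elim disjE bexE)
      assume "a \<in> U" then show ?thesis using mem by (simp add: W_def)
    next
      fix u assume u: "u \<in> U" "a = u \<otimes> b"
      have "(u \<otimes> inv (b \<otimes> b)) \<otimes> b = u \<otimes> inv b"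
        using UN u b by (simp add: inv_mult_group m_assoc)
      also have "\<dots> = inv a"
        using u b UN refl_commute[of "inv b" "inv u"] by (simp add: inv_mult_group)
      finally show ?thesis using Wb[of "u \<otimes> inv (b \<otimes> b)"] mem u bb by simp
    qed
    show "a \<otimes> c \<in> W" if "a \<in> W" "c \<in> W" for a c
      using Wc[OF that(1)] Wc[OF that(2)]
    proof (elim disjE bexE)
      assume "a \<in> U" "c \<in> U" then show ?thesis using mem by (simp add: W_def)
    next
      fix v assume v: "a \<in> U" "v \<in> U" "c = v \<otimes> b"
      then have "a \<otimes> c = (a \<otimes> v) \<otimes> b" using UN b by (simp add: m_assoc)
      then show ?thesis using Wb mem v by simp
    next
      fix u assume u: "c \<in> U" "u \<in> U" "a = u \<otimes> b"
      then have "a \<otimes> c = (u \<otimes> inv c) \<otimes> b"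
        using UN b refl_commute[of b c] by (simp add: m_assoc)
      then show ?thesis using Wb mem u by simp
    next
      fix u v assume u: "u \<in> U" "a = u \<otimes> b" and v: "v \<in> U" "c = v \<otimes> b"
      have "b \<otimes> (v \<otimes> b) = inv v \<otimes> (b \<otimes> b)"
        using UN v b refl_commute[of b v] by (simp flip: m_assoc)
      then have "a \<otimes> c = u \<otimes> (inv v \<otimes> (b \<otimes> b))"
        using UN u v b by (simp add: m_assoc)
      then show ?thesis using mem u v bb by (simp add: W_def)
    qed
  qed
  then have "carrier G \<subseteq> W" using generate_subgroup_incl[of E W] WE E(3) by auto
  then have "x \<in> U" if x: "x \<in> N" for x
  proof -
    have "x \<in> W" using x \<open>carrier G \<subseteq> W\<close> N_carrier by blast
    moreover have "u \<otimes> b \<in> B" if "u \<in> U" for u using UN[OF that] b by simp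
    ultimately show ?thesis using N_B_disjoint[OF x] by (auto simp: W_def)
  qed
  then show ?thesis using U(2) by auto
qed

text \<open>By \<open>N_generated\<close>, the products of \<open>b\<close> with the reflections of
  \<open>E\<close> generate \<open>N\<close> together with \<open>L\<close>, so
  \<open>nested_path\<close> through these products exhausts \<open>N\<close>. One step of
  \<open>y\<close> stands for the two edges \<open>b\<close> and \<open>d\<close>.\<close>

lemma row_transversal:
  assumes E: "finite E" "E \<subseteq> carrier G" "\<And>x. x \<in> E \<Longrightarrow> inv x \<in> E" "generate G E = carrier G"
    and b: "b \<in> E" "b \<in> B"
    and L: "subgroup L G" "L \<subseteq> N" "E \<inter> N \<subseteq> L" "\<And>x. x \<in> N \<Longrightarrow> \<exists>n>0. x [^] (n::nat) \<in> L"
  obtains R y s A where "R > 0" "y 0 = \<one>" "transversal y {..<R} L N"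
    "\<And>i. Suc i < R \<Longrightarrow> \<exists>d\<in>E \<inter> B. y (Suc i) = y i \<otimes> (b \<otimes> d)"
    "\<And>i. i < R \<Longrightarrow> y i \<otimes> y (R - 1 - i) = y (R - 1)"
    "s \<in> E \<inter> B" "2 * A < R" "inv (y A) \<otimes> (y (R - 1) \<otimes> (b \<otimes> s)) \<in> L"
proof -
  define X where "X = (\<lambda>d. b \<otimes> d) ` (E \<inter> B)"
  have X: "finite X" "X \<subseteq> N" using E b by (auto simp: X_def)
  have tor: "\<forall>x\<in>X. \<exists>n>0. x [^] (n::nat) \<in> L" using L(4) X by blast
  obtain R y U where R: "R > 0" "y 0 = \<one>"
    and st: "\<And>i. Suc i < R \<Longrightarrow> inv (y i) \<otimes> y (Suc i) \<in> X"
    and comp: "\<And>i. i < R \<Longrightarrow> y i \<otimes> y (R - 1 - i) = y (R - 1)"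
    and U: "subgroup U G" "U \<subseteq> N" "L \<subseteq> U" "X \<subseteq> U" and tv: "transversal y {..<R} L U"
    and fin: "R = 1 \<or> (\<exists>s\<in>X. \<exists>A. 2 * A < R \<and> inv (y A) \<otimes> (y (R - 1) \<otimes> s) \<in> L)"
    using nested_path[OF X L(1,2) tor]
    by (elim exE conjE) (rule that; (assumption | blast))
  have UN: "U = N"
    using N_generated[OF E(2-4) b U(1,2)] U(3,4) L(3) by (auto simp: X_def)
  have yN: "y i \<in> N" if "i < R" for i using tv that UN by (auto simp: transversal_def)
  have st': "\<exists>d\<in>E \<inter> B. y (Suc i) = y i \<otimes> (b \<otimes> d)" if "Suc i < R" for i
  proof -
    obtain d where d: "d \<in> E \<inter> B" "inv (y i) \<otimes> y (Suc i) = b \<otimes> d" using st[of i] \<open>Suc i < R\<close> unfolding X_def by blast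
    then have "y i \<otimes> (inv (y i) \<otimes> y (Suc i)) = y i \<otimes> (b \<otimes> d)" by simp
    then have "y (Suc i) = y i \<otimes> (b \<otimes> d)" using yN[of i] yN[of "Suc i"] \<open>Suc i < R\<close> by simp
    then show ?thesis using d by blast
  qed
  have "\<exists>s\<in>E \<inter> B. \<exists>A. 2 * A < R \<and> inv (y A) \<otimes> (y (R - 1) \<otimes> (b \<otimes> s)) \<in> L"
  proof (cases "R = 1")
    \<comment> \<open>With a single row no closing step comes from \<open>nested_path\<close>; any
      element of \<open>N\<close> closes up then, in particular
      \<open>b \<otimes> b\<close>.\<close>
    case True
    have "b \<otimes> b \<in> N" using b by simp
    then have "inv (y 0) \<otimes> (b \<otimes> b) \<in> L" using tv True UN by (auto simp: transversal_def)
    then show ?thesis using True R b by (intro bexI[of _ b] exI[of _ 0]) auto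
  next
    case False
    then show ?thesis using fin by (auto simp: X_def)
  qed
  then show ?thesis using that R st' comp tv UN by blast
qed


text \<open>\<open>G\<close> consists of \<open>N\<close> and its translate by \<open>b\<close>, and
  right multiplication by \<open>b\<close> maps left cosets of \<open>H\<close> to left cosets
  because \<open>b\<close> inverts \<open>H\<close>. The two sheets are interleaved so that a path
  of reflections can alternate between them.\<close>

lemma transversal_two_sheets:
  fixes l m :: "int \<Rightarrow> 'a"
  assumes H: "subgroup H G" "H \<subseteq> N" and b: "b \<in> B"
    and l: "transversal l I H N" and m: "transversal m I H N"
  shows "transversal (\<lambda>i. if even i then l (i div 2) else m (i div 2) \<otimes> b) {i. i div 2 \<in> I} H (carrier G)"
    (is "transversal ?v ?J H (carrier G)")
proof -
  note memH = subgroup.one_closed[OF H(1)] subgroup.m_closed[OF H(1)] subgroup.m_inv_closed[OF H(1)]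
  have lN: "l i \<in> N" and mN: "m i \<in> N" if "i \<in> I" for i
    using l m that by (auto simp: transversal_def)
  have conj: "inv b \<otimes> (z \<otimes> b) = inv z" if "z \<in> N" for z
  proof -
    have "z \<otimes> b = b \<otimes> inv z" using that b refl_commute[of b "inv z"] by simp
    then show ?thesis using that b by simp
  qed
  have conj2: "inv (m i \<otimes> b) \<otimes> (m j \<otimes> b) = inv (inv (m i) \<otimes> m j)" if "i \<in> I" "j \<in> I" for i j
    using conj[of "inv (m i) \<otimes> m j"] mN that b by (simp add: inv_mult_group m_assoc)
  show ?thesis
    unfolding transversal_def
  proof (intro conjI ballI impI)
    show "?v ` ?J \<subseteq> carrier G" using lN mN b by auto
    fix x assume "x \<in> carrier G"
    then consider "x \<in> N" | "x \<in> B" using carrier_cases by auto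
    then show "\<exists>i\<in>?J. inv (?v i) \<otimes> x \<in> H"
    proof cases
      case 1
      then obtain i where "i \<in> I" "inv (l i) \<otimes> x \<in> H" using l by (auto simp: transversal_def)
      then show ?thesis by (intro bexI[of _ "2 * i"]) auto
    next
      case 2
      then have "x \<otimes> inv b \<in> N" using b by simp
      then obtain i where i: "i \<in> I" "inv (m i) \<otimes> (x \<otimes> inv b) \<in> H"
        using m by (auto simp: transversal_def)
      have "inv (m i \<otimes> b) \<otimes> x = inv b \<otimes> ((inv (m i) \<otimes> (x \<otimes> inv b)) \<otimes> b)"
        using 2 b mN i by (simp add: inv_mult_group m_assoc)
      also have "\<dots> = inv (inv (m i) \<otimes> (x \<otimes> inv b))"
        using conj[of "inv (m i) \<otimes> (x \<otimes> inv b)"] i H by auto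
      finally have "inv (m i \<otimes> b) \<otimes> x \<in> H" using memH i by simp
      then show ?thesis using i by (intro bexI[of _ "2 * i + 1"]) auto
    qed
  next
    fix i j assume ij: "i \<in> ?J" "j \<in> ?J" "inv (?v i) \<otimes> ?v j \<in> H"
    have I: "i div 2 \<in> I" "j div 2 \<in> I" using ij by auto
    have HB: "x \<notin> B" if "x \<in> H" for x using that H N_B_disjoint by auto
    have "even i = even j \<and> i div 2 = j div 2"
    proof (cases "even i"; cases "even j")
      assume "even i" "even j"
      then show ?thesis using ij l I by (auto simp: transversal_def)
    next
      assume "even i" "odd j"
      then have "inv (?v i) \<otimes> ?v j \<in> B" using lN mN b I by simp
      then show ?thesis using HB ij by auto
    next
      assume "odd i" "even j"
      then have "inv (?v i) \<otimes> ?v j \<in> B" using lN mN b I by simp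
      then show ?thesis using HB ij by auto
    next
      assume o: "odd i" "odd j"
      then have "inv (inv (m (i div 2)) \<otimes> m (j div 2)) \<in> H" using ij conj2 I by simp
      then have "inv (m (i div 2)) \<otimes> m (j div 2) \<in> H"
        using memH(3)[of "inv (inv (m (i div 2)) \<otimes> m (j div 2))"] mN I by simp
      then show ?thesis using o m I by (auto simp: transversal_def)
    qed
    then show "i = j" by (metis even_two_times_div_two odd_two_times_div_two_succ)
  qed
qed

lemma reflection_generator:
  assumes "E \<subseteq> carrier G" "generate G E = carrier G"
  obtains b where "b \<in> E" "b \<in> B"
proof -
  have "\<not> E \<subseteq> N"
  proof
    assume "E \<subseteq> N"
    then have "carrier G \<subseteq> N" using generate_subgroup_incl[OF _ N_subgroup] assms by metis
    moreover obtain b where "b \<in> B" using refl_ex unfolding B_def by auto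
    ultimately show False using N_B_disjoint B_carrier by blast
  qed
  then show ?thesis using that carrier_cases assms by blast
qed

lemma powers_subgroup:
  assumes "c \<in> N"
  shows "subgroup (range (\<lambda>k::int. c [^] k)) G" "range (\<lambda>k::int. c [^] k) \<subseteq> N"
proof -
  show N: "range (\<lambda>k::int. c [^] k) \<subseteq> N" using assms by auto
  show "subgroup (range (\<lambda>k::int. c [^] k)) G"
  proof (rule subgroupI)
    show "range (\<lambda>k::int. c [^] k) \<subseteq> carrier G" using assms by auto
    fix x assume "x \<in> range (\<lambda>k::int. c [^] k)"
    then obtain k where k: "x = c [^] (k::int)" by auto
    then have "inv x = c [^] (-k)" using assms by (simp add: int_pow_neg)
    then show "inv x \<in> range (\<lambda>k::int. c [^] k)" by blast
    fix y assume "y \<in> range (\<lambda>k::int. c [^] k)"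
    then obtain l where "y = c [^] (l::int)" by auto
    then have "x \<otimes> y = c [^] (k + l)" using k assms by (simp add: int_pow_mult)
    then show "x \<otimes> y \<in> range (\<lambda>k::int. c [^] k)" by blast
  qed auto
qed

text \<open>Left multiplication by powers of \<open>c\<close> turns the path \<open>g\<close> into a
  strip. It is an edge at every vertex: \<open>c\<close> conjugated by a group element is
  \<open>c\<close> or \<open>inv c\<close>.\<close>

lemma double_ray_of_grid:
  fixes g :: "int \<Rightarrow> 'a"
  assumes c: "c \<in> N" "ht c \<noteq> 0" "c \<in> E" and E: "\<And>x. x \<in> E \<Longrightarrow> inv x \<in> E"
    and n: "n > 0" and g: "transversal g {0..<n} (range (\<lambda>k::int. c [^] k)) (carrier G)"
    and gE: "\<And>i. 0 \<le> i \<Longrightarrow> i + 1 < n \<Longrightarrow> inv (g i) \<otimes> g (i + 1) \<in> E"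
  shows "\<exists>v. bij_betw v (UNIV::int set) (carrier G) \<and> (\<forall>i. inv (v i) \<otimes> v (i + 1) \<in> E)"
proof -
  \<comment> \<open>Odd columns are traversed backwards, so the position is kept when the column
    changes.\<close>
  define z where "z i = (if even (i div n) then i mod n else n - 1 - i mod n)" for i
  define v where "v i = c [^] (i div n) \<otimes> g (z i)" for i
  have mn: "0 \<le> i mod n" "i mod n < n" for i using n by simp_all
  have z: "0 \<le> z i" "z i < n" for i using mn[of i] by (auto simp: z_def)
  have dm: "(q * n + r) div n = q" "(q * n + r) mod n = r" if "0 \<le> r" "r < n" for q r
    using that by simp_all
  have gc: "g i \<in> carrier G" if "0 \<le> i" "i < n" for i using g that by (auto simp: transversal_def)
  \<comment> \<open>Each \<open>x\<close> either commutes with all of \<open>N\<close> or inverts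
    it, so powers of \<open>c\<close> can change sides up to sign; the left cosets of the powers of
    \<open>c\<close> are also their right cosets.\<close>
  have comm: "\<exists>l::int. c [^] k \<otimes> x = x \<otimes> c [^] l" "\<exists>l::int. x \<otimes> c [^] k = c [^] l \<otimes> x"
    "x \<otimes> c = c \<otimes> x \<or> x \<otimes> inv c = c \<otimes> x" if x: "x \<in> carrier G" for x and k :: int
  proof -
    have "(\<forall>u\<in>N. x \<otimes> u = u \<otimes> x) \<or> (\<forall>u\<in>N. x \<otimes> u = inv u \<otimes> x)"
      using x carrier_cases[of x] N_comm refl_commute by blast
    then have "c [^] k \<otimes> x = x \<otimes> c [^] k \<and> x \<otimes> c = c \<otimes> x \<or>
        c [^] k \<otimes> x = x \<otimes> c [^] (-k) \<and> x \<otimes> inv c = c \<otimes> x"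
      using c by (force simp: int_pow_neg)
    then show "\<exists>l::int. c [^] k \<otimes> x = x \<otimes> c [^] l" "x \<otimes> c = c \<otimes> x \<or> x \<otimes> inv c = c \<otimes> x" by auto
    have "(\<forall>u\<in>N. x \<otimes> u = u \<otimes> x) \<or> (\<forall>u\<in>N. x \<otimes> u = inv u \<otimes> x)"
      using x carrier_cases[of x] N_comm refl_commute by blast
    then have "x \<otimes> c [^] k = c [^] k \<otimes> x \<or> x \<otimes> c [^] k = c [^] (-k) \<otimes> x"
      using c by (force simp: int_pow_neg)
    then show "\<exists>l::int. x \<otimes> c [^] k = c [^] l \<otimes> x" by auto
  qed
  have inj: "i = j" if vij: "v i = v j" for i j
  proof -
    have gi: "g (z i) \<in> carrier G" "g (z j) \<in> carrier G" using gc z by auto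
    have "c [^] (i div n) \<otimes> g (z i) = c [^] (j div n) \<otimes> g (z j)" using vij by (simp add: v_def)
    then have "c [^] (- (j div n)) \<otimes> (c [^] (i div n) \<otimes> g (z i)) = g (z j)"
      using c gi by (simp add: int_pow_neg)
    then have "g (z j) = c [^] (- (j div n) + i div n) \<otimes> g (z i)"
      using c gi by (simp only: int_pow_mult m_assoc N_carrier int_pow_closed)
    moreover obtain l where "c [^] (- (j div n) + i div n) \<otimes> g (z i) = g (z i) \<otimes> c [^] (l::int)"
      using comm(1)[OF gi(1)] by blast
    ultimately have "inv (g (z i)) \<otimes> g (z j) = c [^] l" using c gi by simp
    then have zz: "z i = z j" using g z by (force simp: transversal_def)
    then have "c [^] (i div n) = c [^] (j div n)"
      using vij gi c by (simp add: v_def)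
    \<comment> \<open>The nonzero height of \<open>c\<close> keeps different columns apart.\<close>
    then have "ht (c [^] (i div n)) = ht (c [^] (j div n))" by simp
    then have dd: "i div n = j div n" using c by (simp add: ht_N_int_pow)
    then have "i mod n = j mod n" using zz by (auto simp: z_def split: if_splits)
    then show ?thesis using dd by (metis div_mult_mod_eq)
  qed
  have surj: "\<exists>i. x = v i" if x: "x \<in> carrier G" for x
  proof -
    obtain j k where j: "0 \<le> j" "j < n" and "inv (g j) \<otimes> x = c [^] (k::int)"
      using g x unfolding transversal_def by (auto dest!: bspec[of _ _ x])
    then have "x = g j \<otimes> c [^] k" using gc[OF j] x c by (metis N_carrier cancel_inv(2) inv_closed)
    also obtain l where l: "g j \<otimes> c [^] k = c [^] (l::int) \<otimes> g j"
      using comm(2)[OF gc[OF j]] by blast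
    finally have xl: "x = c [^] l \<otimes> g j" .
    define i where "i = l * n + (if even l then j else n - 1 - j)"
    have "i div n = l" "i mod n = (if even l then j else n - 1 - j)"
      unfolding i_def using dm[of "if even l then j else n - 1 - j" l] j by auto
    then have "v i = x" using xl by (simp add: v_def z_def)
    then show ?thesis by auto
  qed
  have "bij_betw v UNIV (carrier G)"
    unfolding bij_betw_def
  proof
    show "inj v" using inj by (auto simp: inj_on_def)
    have "v i \<in> carrier G" for i using c gc z by (simp add: v_def)
    then show "range v = carrier G" using surj by blast
  qed
  moreover have "inv (v i) \<otimes> v (i + 1) \<in> E" for i
  proof (cases "i mod n + 1 < n")
    case True
    have "i + 1 = (i div n) * n + (i mod n + 1)" by simp
    then have d: "(i + 1) div n = i div n" "(i + 1) mod n = i mod n + 1"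
      using dm[of "i mod n + 1" "i div n"] mn[of i] True by simp_all
    have gi: "g (z i) \<in> carrier G" "g (z (i + 1)) \<in> carrier G" using gc z by auto
    have eq: "inv (v i) \<otimes> v (i + 1) = inv (g (z i)) \<otimes> g (z (i + 1))"
      unfolding v_def d using c gi by (simp add: inv_mult_group m_assoc)
    have z1: "z (i + 1) = (if even (i div n) then z i + 1 else z i - 1)"
      by (simp add: z_def d)
    show ?thesis
    proof (cases "even (i div n)")
      case True
      then show ?thesis using eq z1 gE[of "z i"] z[of i] z[of "i + 1"] by simp
    next
      case False
      have "inv (g (z i)) \<otimes> g (z i - 1) = inv (inv (g (z i - 1)) \<otimes> g (z i - 1 + 1))"
        using gc z[of i] z[of "i + 1"] z1 False by (simp add: inv_mult_group)
      then show ?thesis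
        using eq z1 gE[of "z i - 1"] z[of i] z[of "i + 1"] False E by simp
    qed
  next
    case False
    then have m: "i mod n = n - 1" using mn[of i] by simp
    have "i + 1 = (i div n) * n + i mod n + 1" by simp
    also have "\<dots> = (i div n + 1) * n" unfolding m by (simp add: algebra_simps)
    finally have i1: "i + 1 = (i div n + 1) * n" .
    have d: "(i + 1) div n = i div n + 1" "(i + 1) mod n = 0"
      unfolding i1 using n by simp_all
    have zz: "z (i + 1) = z i" using d m by (simp add: z_def)
    have gi: "g (z i) \<in> carrier G" using gc z by auto
    have "v (i + 1) = c [^] (i div n) \<otimes> (c \<otimes> g (z i))"
      using c gi by (simp add: v_def d zz int_pow_mult m_assoc)
    then have "inv (v i) \<otimes> v (i + 1) = inv (g (z i)) \<otimes> (c \<otimes> g (z i))"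
      using c gi by (simp add: v_def inv_mult_group m_assoc)
    also have "\<dots> = c \<or> \<dots> = inv c" using comm(3)[OF gi] c gi by (metis N_carrier cancel_inv(1) inv_closed)
    finally show ?thesis using c E by auto
  qed
  ultimately show ?thesis by blast
qed

end

section \<open>Tours of the cosets\<close>

lemma int_div_less: "(m::int) > 0 \<Longrightarrow> j div m < r \<longleftrightarrow> j < r * m"
proof -
  assume m: "m > 0"
  have "r \<le> j div m \<longleftrightarrow> r * m \<le> j"
  proof
    assume "r \<le> j div m"
    then have "r * m \<le> (j div m) * m" using m by (simp add: mult_right_mono)
    also have "\<dots> \<le> j" using m pos_mod_sign[of m j] div_mult_mod_eq[of j m] by linarith
    finally show "r * m \<le> j" .
  next
    assume "r * m \<le> j"
    then show "r \<le> j div m" using zdiv_mono1[of "r * m" j m] m by simp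
  qed
  then show ?thesis by linarith
qed

section \<open>Walks as lists, and the arithmetic of the tour\<close>

text \<open>A half-open walk: the list begins with \<open>a\<close>, and \<open>b\<close> is the
  vertex after its last entry. Walks can therefore be appended without repeating the vertex where
  they meet.\<close>

fun chain :: "('a \<Rightarrow> 'a \<Rightarrow> bool) \<Rightarrow> 'a \<Rightarrow> 'a list \<Rightarrow> 'a \<Rightarrow> bool" where
  "chain r a [] b \<longleftrightarrow> a = b"
| "chain r a (x # xs) b \<longleftrightarrow> x = a \<and> (\<exists>c. r a c \<and> chain r c xs b)"

lemma chain_append: "chain r a (xs @ ys) b \<longleftrightarrow> (\<exists>c. chain r a xs c \<and> chain r c ys b)"
  by (induction xs arbitrary: a) auto

lemma chain_hd: "chain r a xs b \<Longrightarrow> xs \<noteq> [] \<Longrightarrow> xs ! 0 = a"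
  by (cases xs) auto

lemma chain_nth:
  "chain r a xs b \<Longrightarrow> i < length xs \<Longrightarrow> r (xs ! i) (if Suc i < length xs then xs ! Suc i else b)"
proof (induction xs arbitrary: a i)
  case (Cons x xs)
  then obtain c where c: "x = a" "r a c" "chain r c xs b" by auto
  show ?case
  proof (cases i)
    case 0
    then show ?thesis using c chain_hd[OF c(3)] by (cases xs) auto
  next
    case (Suc j)
    then show ?thesis
      using Cons.IH[OF c(3), of j] Cons.prems(2) by (cases "Suc j < length xs") simp_all
  qed
qed simp

text \<open>This balances the shifts of half a tour. Among \<open>A\<close> complete visits,
  \<open>s\<close> forward ones shift by \<open>3 * s - A\<close> in total, the \<open>c\<close>
  forward edges of the middle rows shift by \<open>c\<close>, and the excess shifts by
  \<open>- x\<close>.\<close>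

lemma split_in_three:
  fixes A x m :: nat
  assumes "m \<ge> 1" "x \<le> A + m"
  shows "\<exists>s c. \<exists>w::int. s \<le> A \<and> c \<le> m \<and> (w = 1 \<or> w = -1) \<and> 3 * int s + int c = int A + int x + w"
proof -
  \<comment> \<open>The sums \<open>3 * s + c\<close> attain every value up to
    \<open>3 * A + m\<close> if \<open>m \<ge> 2\<close>, but only the residues 0 and 1 modulo 3 if
    \<open>m = 1\<close>. The target is \<open>A + x - 1\<close>; if that is negative or has the
    missing residue, \<open>A + x + 1\<close> has residue 1 and replaces it.\<close>
  define T where "T = (if A + x = 0 then 1 else if m = 1 \<and> (A + x - 1) mod 3 = 2 then A + x + 1 else A + x - 1)"
  define s where "s = min A (T div 3)"
  define c where "c = T - 3 * s"
  have sT: "3 * s \<le> T" unfolding s_def by linarith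
  have "c \<le> m"
  proof (cases "T div 3 \<le> A")
    case True
    then have "c = T mod 3" by (simp add: c_def s_def min_def minus_mult_div_eq_mod)
    moreover have "T mod 3 \<noteq> 2" if "m = 1"
    proof (cases "A + x = 0 \<or> (A + x - 1) mod 3 \<noteq> 2")
      case True
      then show ?thesis using that by (auto simp: T_def)
    next
      case False
      then have "T = (A + x - 1) + 2" "(A + x - 1) mod 3 = 2" using that by (simp_all add: T_def)
      moreover have "(w + 2) mod 3 \<noteq> 2" if "w mod 3 = 2" for w :: nat
        by (simp only: mod_add_left_eq[of w 3 2, symmetric] that) simp
      ultimately show ?thesis by metis
    qed
    ultimately show ?thesis using assms(1) pos_mod_bound[of 3 T] by (cases "m = 1") linarith+
  next
    case False
    then have "s = A" "T \<ge> 3 * A + 3" by (simp_all add: s_def)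
    then show ?thesis using assms unfolding c_def T_def by (auto split: if_splits)
  qed
  moreover have "s \<le> A" by (simp add: s_def)
  moreover have "3 * int s + int c = int T" using sT by (simp add: c_def of_nat_diff)
  moreover have "int T = int A + int x + 1 \<or> int T = int A + int x + (-1)"
    unfolding T_def by auto
  ultimately show ?thesis by metis
qed

context quasi_dihedral_group begin

text \<open>\<open>single_pass\<close> uses one edge in each row, \<open>double_pass\<close> all vertices of a row modulo \<open>t\<^sup>2\<close>; the
  Boolean of a row tells whether it is visited in the direction of \<open>t = q p\<^sup>-\<^sup>1\<close>.\<close>

fun single_pass :: "'a \<Rightarrow> 'a \<Rightarrow> (nat \<Rightarrow> 'a) \<Rightarrow> 'a \<Rightarrow> nat \<Rightarrow> bool list \<Rightarrow> 'a list" where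
  "single_pass p q Y g i [] = []"
| "single_pass p q Y g i (t # ts) = Y i \<otimes> g # Y i \<otimes> g \<otimes> (if t then q else p) #
     single_pass p q Y (if t then g \<otimes> (q \<otimes> inv p) else g) (Suc i) ts"

fun double_pass :: "'a \<Rightarrow> 'a \<Rightarrow> (nat \<Rightarrow> 'a) \<Rightarrow> 'a \<Rightarrow> nat \<Rightarrow> bool list \<Rightarrow> 'a list" where
  "double_pass p q Y g i [] = []"
| "double_pass p q Y g i (t # ts) =
     (let l = Y i \<otimes> g; d = (if t then q \<otimes> inv p else inv (q \<otimes> inv p)); r = (if t then q else p) in
       l # l \<otimes> r # l \<otimes> d # l \<otimes> d \<otimes> r #
       double_pass p q Y (if t then g \<otimes> d \<otimes> d else g \<otimes> d) (Suc i) ts)"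

lemma length_single_pass: "length (single_pass p q Y g i ts) = 2 * length ts"
  by (induction ts arbitrary: g i) simp_all

lemma length_double_pass: "length (double_pass p q Y g i ts) = 4 * length ts"
  by (induction ts arbitrary: g i) (simp_all add: Let_def)

section \<open>Passes through consecutive rows\<close>

definition reflection_step where "reflection_step E a c \<longleftrightarrow> inv a \<otimes> c \<in> E \<inter> B"

context
  fixes E p q t
  assumes E: "\<forall>x\<in>E. inv x \<in> E" and p: "p \<in> E" "p \<in> B" and q: "q \<in> E" "q \<in> B"
    and t: "t = q \<otimes> inv p"
begin

lemma turn_closed: "t \<in> N" using p q by (simp add: t)

lemma turn_mult: "q = t \<otimes> p" using p q by (simp add: t m_assoc)

lemma reflection_step_right: "d \<in> E \<Longrightarrow> d \<in> B \<Longrightarrow> a \<in> carrier G \<Longrightarrow> reflection_step E a (a \<otimes> d)"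
  by (simp add: reflection_step_def)

lemma reflection_step_next:
  assumes "d \<in> E" "d \<in> B" "l \<in> N" shows "reflection_step E (l \<otimes> p) (l \<otimes> (p \<otimes> d))"
  using assms p reflection_step_right[of d "l \<otimes> p"] by (simp add: m_assoc)

text \<open>From \<open>l \<otimes> p\<close> with \<open>l\<close> in \<open>N\<close> the edge
  \<open>d\<close> leads to the next row without shift. As \<open>q = t \<otimes> p\<close>, using
  \<open>q\<close> in place of \<open>p\<close> first amounts to a shift by
  \<open>t\<close>.\<close>

lemma chain_single_pass:
  assumes "\<And>j. i \<le> j \<Longrightarrow> j < i + length ts \<Longrightarrow> \<exists>d\<in>E \<inter> B. Y (Suc j) = Y j \<otimes> (p \<otimes> d)"
    and "\<And>j. j \<le> i + length ts \<Longrightarrow> Y j \<in> N" "g \<in> N"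
  shows "chain (reflection_step E) (Y i \<otimes> g) (single_pass p q Y g i ts)
    (Y (i + length ts) \<otimes> (g \<otimes> t [^] int (length (filter (\<lambda>s. s) ts))))"
  using assms
proof (induction ts arbitrary: g i)
  case Nil
  then show ?case using turn_closed by simp
next
  case (Cons s ts)
  define g' where "g' = (if s then g \<otimes> t else g)"
  have g: "g \<in> N" "g' \<in> N" using Cons.prems turn_closed by (simp_all add: g'_def)
  obtain d where d: "d \<in> E" "d \<in> B" "Y (Suc i) = Y i \<otimes> (p \<otimes> d)" using Cons.prems(1)[of i] by auto
  have Y: "Y i \<in> N" "Y (Suc i) \<in> N" using Cons.prems(2) by simp_all
  have IH: "chain (reflection_step E) (Y (Suc i) \<otimes> g') (single_pass p q Y g' (Suc i) ts)
    (Y (Suc i + length ts) \<otimes> (g' \<otimes> t [^] int (length (filter (\<lambda>s. s) ts))))"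
    using Cons.prems by (intro Cons.IH) (simp_all add: g)
  have e: "Y i \<otimes> g \<otimes> (if s then q else p) = Y i \<otimes> g' \<otimes> p"
    using Y g turn_closed p by (simp add: g'_def turn_mult m_assoc)
  have "Y (Suc i) \<otimes> g' = Y i \<otimes> g' \<otimes> (p \<otimes> d)"
    using Y g p d by (simp add: N_ac)
  then have "reflection_step E (Y i \<otimes> g \<otimes> (if s then q else p)) (Y (Suc i) \<otimes> g')"
    unfolding e using reflection_step_next[OF d(1,2), of "Y i \<otimes> g'"] Y g by simp
  moreover have "reflection_step E (Y i \<otimes> g) (Y i \<otimes> g \<otimes> (if s then q else p))"
    using reflection_step_right p q Y g by simp
  moreover have "g' \<otimes> t [^] int (length (filter (\<lambda>s. s) ts)) = g \<otimes> t [^] int (length (filter (\<lambda>s. s) (s # ts)))"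
  proof (cases s)
    case True
    have "t \<otimes> t [^] int (length (filter (\<lambda>s. s) ts)) = t [^] (1 + int (length (filter (\<lambda>s. s) ts)))"
      using turn_closed by (simp add: int_pow_mult)
    then show ?thesis using True g turn_closed by (simp add: g'_def m_assoc)
  qed (simp add: g'_def)
  ultimately show ?case using IH by (auto simp: t g'_def)
qed

text \<open>Forward, a row is traversed by the labels \<open>q\<close>, \<open>inv p\<close>,
  \<open>q\<close>, with end point \<open>l \<otimes> t \<otimes> t \<otimes> p\<close>; backward by
  \<open>p\<close>, \<open>inv q\<close>, \<open>p\<close>, with end point
  \<open>l \<otimes> inv t \<otimes> p\<close>. The shifts are 2 and -1, that is, 3 per forward
  visit minus 1 per visit.\<close>

lemma chain_double_pass:
  assumes "\<And>j. i \<le> j \<Longrightarrow> j < i + length ts \<Longrightarrow> \<exists>d\<in>E \<inter> B. Y (Suc j) = Y j \<otimes> (p \<otimes> d)"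
    and "\<And>j. j \<le> i + length ts \<Longrightarrow> Y j \<in> N" "g \<in> N"
  shows "chain (reflection_step E) (Y i \<otimes> g) (double_pass p q Y g i ts)
    (Y (i + length ts) \<otimes> (g \<otimes> t [^] (3 * int (length (filter (\<lambda>s. s) ts)) - int (length ts))))"
  using assms
proof (induction ts arbitrary: g i)
  case Nil
  then show ?case using turn_closed by simp
next
  case (Cons s ts)
  define f where "f = (if s then t else inv t)"
  define r where "r = (if s then q else p)"
  define g' where "g' = (if s then g \<otimes> f \<otimes> f else g \<otimes> f)"
  define K where "K = 3 * int (length (filter (\<lambda>s. s) ts)) - int (length ts)"
  have g: "g \<in> N" "g' \<in> N" and f: "f \<in> N" using Cons.prems turn_closed by (simp_all add: g'_def f_def)
  have r: "r \<in> E" "r \<in> B" using p q by (simp_all add: r_def)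
  obtain d where d: "d \<in> E" "d \<in> B" "Y (Suc i) = Y i \<otimes> (p \<otimes> d)" using Cons.prems(1)[of i] by auto
  have Y: "Y i \<in> N" "Y (Suc i) \<in> N" using Cons.prems(2) by simp_all
  have IH: "chain (reflection_step E) (Y (Suc i) \<otimes> g') (double_pass p q Y g' (Suc i) ts)
    (Y (Suc i + length ts) \<otimes> (g' \<otimes> t [^] K))"
    unfolding K_def using Cons.prems by (intro Cons.IH) (simp_all add: g)
  have e: "Y i \<otimes> g \<otimes> f \<otimes> r = Y i \<otimes> g' \<otimes> p"
    using Y g turn_closed p by (simp add: g'_def r_def f_def turn_mult m_assoc)
  have "Y (Suc i) \<otimes> g' = Y i \<otimes> g' \<otimes> (p \<otimes> d)"
    using Y g p d by (simp add: N_ac)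
  then have 1: "reflection_step E (Y i \<otimes> g \<otimes> f \<otimes> r) (Y (Suc i) \<otimes> g')"
    unfolding e using reflection_step_next[OF d(1,2), of "Y i \<otimes> g'"] Y g by simp
  have "inv (Y i \<otimes> g \<otimes> r) \<otimes> (Y i \<otimes> g \<otimes> f) = inv r \<otimes> f"
    using Y g f r by (simp add: inv_mult_group m_assoc)
  also have "\<dots> = (if s then inv p else inv q)"
    using p q by (simp add: r_def f_def t inv_mult_group)
  finally have 2: "reflection_step E (Y i \<otimes> g \<otimes> r) (Y i \<otimes> g \<otimes> f)"
    using p q E by (simp add: reflection_step_def)
  have 3: "reflection_step E (Y i \<otimes> g) (Y i \<otimes> g \<otimes> r)" "reflection_step E (Y i \<otimes> g \<otimes> f) (Y i \<otimes> g \<otimes> f \<otimes> r)"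
    using reflection_step_right[OF r] Y g f by simp_all
  have 4: "g' \<otimes> t [^] K = g \<otimes> t [^] (3 * int (length (filter (\<lambda>s. s) (s # ts))) - int (length (s # ts)))"
  proof (cases s)
    case True
    have "3 * int (length (filter (\<lambda>s. s) (s # ts))) - int (length (s # ts)) = 1 + (1 + K)"
      using True by (simp add: K_def)
    moreover have "t [^] (1 + (1 + K)) = t \<otimes> (t \<otimes> t [^] K)"
      using turn_closed int_pow_mult[of t 1 "1 + K"] int_pow_mult[of t 1 K] by simp
    ultimately show ?thesis using True g turn_closed by (simp only: g'_def f_def if_True m_assoc N_carrier m_closed int_pow_closed)
  next
    case False
    have "3 * int (length (filter (\<lambda>s. s) (s # ts))) - int (length (s # ts)) = -1 + K"
      using False by (simp add: K_def)
    moreover have "t [^] (-1 + K) = inv t \<otimes> t [^] K"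
      using turn_closed int_pow_mult[of t "-1" K] int_pow_neg[of t 1] by simp
    ultimately show ?thesis using False g turn_closed
      by (simp only: g'_def f_def if_False m_assoc N_carrier inv_closed int_pow_closed)
  qed
  have "double_pass p q Y g i (s # ts) = Y i \<otimes> g # Y i \<otimes> g \<otimes> r # Y i \<otimes> g \<otimes> f # Y i \<otimes> g \<otimes> f \<otimes> r #
      double_pass p q Y g' (Suc i) ts"
    by (simp add: Let_def r_def f_def g'_def t)
  then show ?case using IH 1 2 3 unfolding 4[symmetric] by auto
qed

text \<open>\<open>r\<close> and \<open>k\<close> depend on the directions \<open>ts\<close> only.
  Choosing them before \<open>Y\<close> and \<open>u\<close> makes it possible to compare two passes
  with the same directions: in every row they use the same edge type and differ exactly by
  \<open>u\<close>.\<close>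

lemma single_pass_cover:
  assumes "j < length ts" "g \<in> N"
  shows "\<exists>r\<in>{p, q}. \<exists>k::int. \<forall>Y. \<forall>u\<in>N.
    {Y (i + j) \<otimes> (g \<otimes> u \<otimes> t [^] k), Y (i + j) \<otimes> (g \<otimes> u \<otimes> t [^] k) \<otimes> r}
    \<subseteq> set (single_pass p q Y (g \<otimes> u) i ts)"
  using assms
proof (induction ts arbitrary: g i j)
  case (Cons s ts)
  show ?case
  proof (cases j)
    case 0
    then show ?thesis using Cons.prems
      by (intro bexI[of _ "if s then q else p"] exI[of _ "0::int"]) auto
  next
    case (Suc j')
    define g' where "g' = (if s then g \<otimes> t else g)"
    have g': "g' \<in> N" using Cons.prems turn_closed by (simp add: g'_def)
    obtain r k where r: "r \<in> {p, q}" and k: "\<And>Y u. u \<in> N \<Longrightarrow>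
      {Y (Suc i + j') \<otimes> (g' \<otimes> u \<otimes> t [^] (k::int)), Y (Suc i + j') \<otimes> (g' \<otimes> u \<otimes> t [^] k) \<otimes> r}
      \<subseteq> set (single_pass p q Y (g' \<otimes> u) (Suc i) ts)"
      using Cons.IH[of j' g' "Suc i"] Cons.prems Suc g' by auto
    show ?thesis
    proof (intro bexI[OF _ r] exI[of _ "(if s then 1 else 0) + k"] ballI allI)
      fix Y u assume u: "u \<in> N"
      have 1: "g \<otimes> u \<otimes> t [^] ((if s then 1 else 0) + k) = g' \<otimes> u \<otimes> t [^] k"
        using u Cons.prems turn_closed by (simp add: g'_def int_pow_mult N_ac)
      have "(if s then g \<otimes> u \<otimes> (q \<otimes> inv p) else g \<otimes> u) = g' \<otimes> u"
        using u Cons.prems turn_closed unfolding t[symmetric] by (simp add: g'_def N_ac)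
      then have 2: "set (single_pass p q Y (g' \<otimes> u) (Suc i) ts) \<subseteq> set (single_pass p q Y (g \<otimes> u) i (s # ts))"
        by auto
      show "{Y (i + j) \<otimes> (g \<otimes> u \<otimes> t [^] ((if s then 1 else 0) + k)),
          Y (i + j) \<otimes> (g \<otimes> u \<otimes> t [^] ((if s then 1 else 0) + k)) \<otimes> r}
        \<subseteq> set (single_pass p q Y (g \<otimes> u) i (s # ts))"
        using k[OF u, of Y] 2 Suc unfolding 1 by auto
    qed
  qed
qed simp

lemma single_pass_closed:
  "(\<And>j. Y j \<in> N) \<Longrightarrow> g \<in> N \<Longrightarrow> set (single_pass p q Y g i ts) \<subseteq> carrier G"
  using p q turn_closed by (induction ts arbitrary: g i) (auto simp flip: t)

lemma double_pass_closed:
  "(\<And>j. Y j \<in> N) \<Longrightarrow> g \<in> N \<Longrightarrow> set (double_pass p q Y g i ts) \<subseteq> carrier G"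
  using p q turn_closed by (induction ts arbitrary: g i) (auto simp: Let_def simp flip: t)

text \<open>The four vertices met in a row have two consecutive exponents of \<open>t\<close> in
  each sheet, hence represent all classes of the row modulo \<open>t [^] 2\<close>.\<close>

lemma double_pass_cover:
  assumes "j < length ts" "g \<in> N" "Y (i + j) \<in> N"
  shows "\<exists>r\<in>{p, q}. \<exists>k::int. let l = Y (i + j) \<otimes> (g \<otimes> t [^] k); l' = Y (i + j) \<otimes> (g \<otimes> t [^] (k + 1)) in
    {l, l', l \<otimes> r, l' \<otimes> r} \<subseteq> set (double_pass p q Y g i ts)"
  using assms
proof (induction ts arbitrary: g i j)
  case (Cons s ts)
  define f where "f = (if s then t else inv t)"
  have f: "f \<in> N" "f = (if s then q \<otimes> inv p else inv (q \<otimes> inv p))" using turn_closed by (simp_all add: f_def t)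
  show ?case
  proof (cases j)
    case 0
    have s: "{Y i \<otimes> g, Y i \<otimes> g \<otimes> f, Y i \<otimes> g \<otimes> (if s then q else p), Y i \<otimes> g \<otimes> f \<otimes> (if s then q else p)}
      \<subseteq> set (double_pass p q Y g i (s # ts))"
      by (simp add: Let_def f(2))
    show ?thesis
    proof (cases s)
      case True
      then show ?thesis using s Cons.prems 0 turn_closed
        by (intro bexI[of _ q] exI[of _ "0::int"]) (simp_all add: f_def m_assoc Let_def)
    next
      case False
      \<comment> \<open>A backward visit meets the exponents 0 and -1; \<open>k\<close> denotes the
        smaller one.\<close>
      have "t [^] (-1::int) = inv t" using turn_closed int_pow_neg[of t 1] by simp
      then show ?thesis using s Cons.prems 0 turn_closed False
        by (intro bexI[of _ p] exI[of _ "-1::int"]) (simp_all add: f_def m_assoc Let_def)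
    qed
  next
    case (Suc j')
    define g' where "g' = (if s then g \<otimes> f \<otimes> f else g \<otimes> f)"
    have g': "g' \<in> N" using Cons.prems f(1) by (simp add: g'_def)
    define K where "K = (if s then 2 else -1 :: int)"
    have K: "g \<otimes> t [^] (K + k) = g' \<otimes> t [^] k" for k
    proof (cases s)
      case True
      have "t [^] (1 + (1 + k)) = t \<otimes> (t \<otimes> t [^] k)"
        using turn_closed int_pow_mult[of t 1 "1 + k"] int_pow_mult[of t 1 k] by simp
      moreover have "K + k = 1 + (1 + k)" using True by (simp add: K_def)
      ultimately show ?thesis using True Cons.prems turn_closed by (simp add: g'_def f_def m_assoc)
    next
      case False
      have "t [^] (-1 + k) = inv t \<otimes> t [^] k"
        using turn_closed int_pow_mult[of t "-1" k] int_pow_neg[of t 1] by simp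
      then show ?thesis using False Cons.prems turn_closed by (simp add: K_def g'_def f_def m_assoc)
    qed
    obtain r k where r: "r \<in> {p, q}" and k: "let l = Y (Suc i + j') \<otimes> (g' \<otimes> t [^] (k::int));
        l' = Y (Suc i + j') \<otimes> (g' \<otimes> t [^] (k + 1)) in
      {l, l', l \<otimes> r, l' \<otimes> r} \<subseteq> set (double_pass p q Y g' (Suc i) ts)"
      using Cons.IH[of j' g' "Suc i"] Cons.prems Suc g' by auto
    have "set (double_pass p q Y g' (Suc i) ts) \<subseteq> set (double_pass p q Y g i (s # ts))"
      by (auto simp: Let_def g'_def f(2))
    then show ?thesis
      using k Suc K[of k] K[of "k + 1"]
      by (intro bexI[OF _ r] exI[of _ "K + k"]) (auto simp: Let_def add.assoc)
  qed
qed simp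

end


section \<open>From a closed tour to a two-way infinite sequence of cosets\<close>

text \<open>Counting: a list that meets every coset and has as many entries as there are cosets
  meets each exactly once.\<close>

lemma transversal_of_list:
  assumes P: "subgroup P G" and f: "transversal f I P (carrier G)" and I: "finite I" "card I = length xs"
    and xs: "set xs \<subseteq> carrier G" and cov: "\<And>i. i \<in> I \<Longrightarrow> \<exists>x\<in>set xs. inv (f i) \<otimes> x \<in> P"
  shows "transversal (\<lambda>i. xs ! i) {..<length xs} P (carrier G)"
proof -
  note mem = subgroup.m_closed[OF P] subgroup.m_inv_closed[OF P]
  have fc: "f i \<in> carrier G" if "i \<in> I" for i using f that by (auto simp: transversal_def)
  have "\<exists>i\<in>I. inv (f i) \<otimes> x \<in> P" if "x \<in> carrier G" for x
    using f that by (auto simp: transversal_def)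
  then obtain cl where cl: "\<And>x. x \<in> carrier G \<Longrightarrow> cl x \<in> I \<and> inv (f (cl x)) \<otimes> x \<in> P" by metis
  have uniq: "cl y = cl x" if "x \<in> carrier G" "y \<in> carrier G" "inv x \<otimes> y \<in> P" for x y
  proof -
    have "inv (f (cl x)) \<otimes> f (cl y) = (inv (f (cl x)) \<otimes> x) \<otimes> (inv x \<otimes> y) \<otimes> inv (inv (f (cl y)) \<otimes> y)"
      using that cl fc by (simp add: inv_mult_group m_assoc)
    also have "\<dots> \<in> P" using mem cl that by simp
    finally have "inv (f (cl x)) \<otimes> f (cl y) \<in> P" .
    moreover have "cl x \<in> I" "cl y \<in> I" using cl that by auto
    ultimately show ?thesis using f unfolding transversal_def by metis
  qed
  have same: "inv x \<otimes> y \<in> P" if "x \<in> carrier G" "y \<in> carrier G" "cl x = cl y" for x y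
  proof -
    have "inv x \<otimes> y = inv (inv (f (cl x)) \<otimes> x) \<otimes> (inv (f (cl y)) \<otimes> y)"
      using that cl fc by (simp add: inv_mult_group m_assoc)
    also have "\<dots> \<in> P" using mem cl[OF that(1)] cl[OF that(2)] by blast
    finally show ?thesis .
  qed
  have clf: "cl x = i" if "i \<in> I" "x \<in> carrier G" "inv (f i) \<otimes> x \<in> P" for i x
  proof -
    have "inv (f i) \<otimes> f (cl x) = (inv (f i) \<otimes> x) \<otimes> inv (inv (f (cl x)) \<otimes> x)"
      using that cl fc by (simp add: inv_mult_group m_assoc)
    also have "\<dots> \<in> P" using mem cl that by simp
    finally show ?thesis using f cl[OF that(2)] that(1) unfolding transversal_def by metis
  qed
  have set_cl: "set (map cl xs) = I"
  proof
    show "set (map cl xs) \<subseteq> I" using cl xs by auto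
    show "I \<subseteq> set (map cl xs)" using cov clf xs by force
  qed
  then have dist: "distinct (map cl xs)"
    using I by (intro card_distinct) simp
  show ?thesis
    unfolding transversal_def
  proof (intro conjI ballI impI)
    show "(\<lambda>i. xs ! i) ` {..<length xs} \<subseteq> carrier G" using xs by auto
    fix g assume g: "g \<in> carrier G"
    then have "cl g \<in> set (map cl xs)" using set_cl cl by simp
    then obtain i where "i < length xs" "cl (xs ! i) = cl g"
      by (metis in_set_conv_nth length_map nth_map)
    then show "\<exists>i\<in>{..<length xs}. inv (xs ! i) \<otimes> g \<in> P"
      using same[of "xs ! i" g] g xs by (auto simp: subset_iff)
  next
    fix i j assume ij: "i \<in> {..<length xs}" "j \<in> {..<length xs}" "inv (xs ! i) \<otimes> xs ! j \<in> P"
    then have "cl (xs ! j) = cl (xs ! i)" using uniq xs by (auto simp: subset_iff)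
    then show "i = j" using dist ij nth_eq_iff_index_eq[of "map cl xs" i j] by simp
  qed
qed

text \<open>A transversal of the group generated by \<open>w\<close> and \<open>H\<close> is spread
  out by the translates under powers of \<open>w\<close>, which are distinct modulo
  \<open>H\<close>. The translations act on the left, where they preserve step labels.\<close>

lemma transversal_periodic:
  assumes H: "subgroup H G" "H \<subseteq> N" and w: "w \<in> N" "\<And>k::int. w [^] k \<in> H \<Longrightarrow> k = 0"
    and M: "M > 0" and xs: "transversal xs {..<M} {w [^] k \<otimes> u | (k::int) u. u \<in> H} (carrier G)"
  shows "transversal (\<lambda>i::int. w [^] (i div int M) \<otimes> xs (nat (i mod int M))) UNIV H (carrier G)"
    (is "transversal ?v UNIV H _")
proof -
  note memH = subgroup.one_closed[OF H(1)] subgroup.m_closed[OF H(1)] subgroup.m_inv_closed[OF H(1)]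
  have mM: "nat (i mod int M) < M" for i using M by (simp add: nat_less_iff)
  have xc: "xs i \<in> carrier G" if "i < M" for i using xs that by (auto simp: transversal_def)
  \<comment> \<open>The sign \<open>e\<close> tells whether \<open>x\<close> commutes with
    \<open>w\<close> or inverts it.\<close>
  have comm: "\<exists>e::int. (e = 1 \<or> e = -1) \<and> (\<forall>k::int. w [^] k \<otimes> x = x \<otimes> w [^] (e * k))"
    if "x \<in> carrier G" for x
  proof (cases "x \<in> N")
    case True
    then show ?thesis using w N_comm by (intro exI[of _ 1]) simp
  next
    case False
    then have "x \<in> B" using that carrier_cases by auto
    then have "w [^] k \<otimes> x = x \<otimes> w [^] (-1 * k)" for k :: int
      using refl_commute[of x "w [^] (-k)"] w by (simp add: int_pow_neg)
    then show ?thesis by blast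
  qed
  have dm: "(q * int M + int r) div int M = q" "(q * int M + int r) mod int M = int r" if "r < M" for q r
    using that by simp_all
  show ?thesis
    unfolding transversal_def
  proof (intro conjI ballI impI)
    show "range ?v \<subseteq> carrier G" using w xc mM by auto
    fix g assume "g \<in> carrier G"
    then obtain r k u where r: "r < M" "inv (xs r) \<otimes> g = w [^] (k::int) \<otimes> u" "u \<in> H"
      using xs unfolding transversal_def by blast
    have uN: "u \<in> N" using r H by auto
    obtain e where e: "e = 1 \<or> e = -1" "\<And>k::int. w [^] k \<otimes> xs r = xs r \<otimes> w [^] (e * k)"
      using comm xc r by metis
    have "g = xs r \<otimes> (w [^] k \<otimes> u)"
      using r xc \<open>g \<in> carrier G\<close> by (metis cancel_inv(2) inv_closed)
    also have "\<dots> = (xs r \<otimes> w [^] (e * (e * k))) \<otimes> u"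
      using e(1) xc r w uN by (auto simp: m_assoc)
    also have "\<dots> = w [^] (e * k) \<otimes> xs r \<otimes> u" by (simp add: e(2))
    finally have g: "g = w [^] (e * k) \<otimes> xs r \<otimes> u" .
    have "inv (w [^] (e * k) \<otimes> xs r) \<otimes> g = u"
      unfolding g using w xc[OF r(1)] uN cancel_inv(1)[of "w [^] (e * k) \<otimes> xs r" u] by simp
    then show "\<exists>i\<in>UNIV. inv (?v i) \<otimes> g \<in> H"
      using r dm[OF r(1), of "e * k"] by (intro bexI[of _ "e * k * int M + int r"]) (simp_all del: div_mult_self3)
  next
    fix i j :: int assume ij: "inv (?v i) \<otimes> ?v j \<in> H"
    define r s where "r = nat (i mod int M)" "s = nat (j mod int M)"
    have rs: "r < M" "s < M" using mM by (simp_all add: r_s_def)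
    define k where "k = j div int M - i div int M"
    have eq: "inv (?v i) \<otimes> ?v j = inv (xs r) \<otimes> (w [^] k \<otimes> xs s)"
      using w xc rs unfolding r_s_def[symmetric] k_def
      by (simp add: inv_mult_group m_assoc int_pow_diff) (simp add: N_lcomm flip: m_assoc)
    obtain e where e: "e = 1 \<or> e = -1" "\<And>k::int. w [^] k \<otimes> xs s = xs s \<otimes> w [^] (e * k)"
      using comm xc rs by metis
    define h where "h = inv (xs r) \<otimes> (w [^] k \<otimes> xs s)"
    have h: "h \<in> H" "h \<in> N" using ij eq H by (auto simp: h_def)
    have "inv (xs r) \<otimes> xs s = h \<otimes> w [^] (- (e * k))"
      unfolding h_def e(2) using w xc rs by (simp add: m_assoc int_pow_neg)
    also have "\<dots> = w [^] (- (e * k)) \<otimes> h" using h w by (simp add: N_comm)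
    finally have "r = s" using xs rs h unfolding transversal_def by blast
    then have "h = w [^] (e * k)" unfolding h_def e(2) using w xc rs by simp
    then have "k = 0" using w(2)[of "e * k"] h e(1) by auto
    then have "i div int M = j div int M" "i mod int M = j mod int M"
      using \<open>r = s\<close> M by (simp_all add: k_def r_s_def eq_nat_nat_iff)
    then show "i = j" by (metis div_mult_mod_eq)
  qed
qed

text \<open>Left translation does not change labels within a period. At the seam, the walk ends in
  \<open>w\<close>, which is the translate by \<open>w\<close> of its first entry
  \<open>\<one>\<close>.\<close>

lemma periodic_step:
  assumes w: "w \<in> N" and M: "length xs > 0" and xs: "set xs \<subseteq> carrier G"
    and ch: "chain (reflection_step E) \<one> xs w"
  defines "v \<equiv> \<lambda>i::int. w [^] (i div int (length xs)) \<otimes> xs ! nat (i mod int (length xs))"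
  shows "reflection_step E (v i) (v (i + 1))"
proof -
  let ?M = "length xs"
  define k r where "k = i div int ?M" "r = nat (i mod int ?M)"
  have r: "r < ?M" using M by (simp add: k_r_def nat_less_iff)
  have i: "i = k * int ?M + int r" using M by (simp add: k_r_def)
  have dm: "(q * int n + int r) div int n = q" "(q * int n + int r) mod int n = int r" if "r < n" for q r n
    using that by simp_all
  have x: "xs ! j \<in> carrier G" if "j < ?M" for j using xs that by auto
  have vi: "v i = w [^] k \<otimes> xs ! r" by (simp add: v_def k_r_def)
  have "v (i + 1) = w [^] k \<otimes> (if Suc r < ?M then xs ! Suc r else w)"
  proof (cases "Suc r < ?M")
    case True
    have "i + 1 = k * int ?M + int (Suc r)" using i by simp
    then show ?thesis unfolding v_def using True by (simp only: dm[OF True] nat_int if_True)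
  next
    case False
    then have "int r + 1 = int ?M" using r by simp
    then have "i + 1 = (k + 1) * int ?M + int 0" using i by (simp add: distrib_right)
    then have "v (i + 1) = w [^] (k + 1) \<otimes> xs ! 0" unfolding v_def using dm[OF M] by (simp only: nat_int)
    then show ?thesis using False chain_hd[OF ch] M w by (simp add: int_pow_mult)
  qed
  then have "inv (v i) \<otimes> v (i + 1) = inv (xs ! r) \<otimes> (if Suc r < ?M then xs ! Suc r else w)"
    unfolding vi using w x r by (auto simp: inv_mult_group m_assoc)
  then show ?thesis using chain_nth[OF ch r] by (simp add: reflection_step_def)
qed


lemma trivial_subgroup: "subgroup {\<one>} G" "{\<one>} \<subseteq> N"
  by (auto intro: subgroupI)

lemma ht_refl_inv: "b \<in> B \<Longrightarrow> ht (inv b) = ht b"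
  using ht_B_mult[of b "inv b"] by simp

lemma ht_refl_prod: "b \<in> B \<Longrightarrow> d \<in> B \<Longrightarrow> ht (b \<otimes> d) = ht b - ht d"
  by (simp add: ht_B_mult)

section \<open>A generator in \<open>N\<close> of infinite order\<close>

text \<open>The path across the strip is built in layers: \<open>H\<close> contains all generators
  in \<open>N\<close> and is traversed by them modulo the powers of \<open>c\<close>; a path of
  reflections runs through the cosets of \<open>H\<close>, and \<open>thicken_path\<close> combines
  both.\<close>

lemma double_ray_of_infinite_rotation:
  assumes E: "finite E" "E \<subseteq> carrier G" "\<And>x. x \<in> E \<Longrightarrow> inv x \<in> E" "generate G E = carrier G"
    and c: "c \<in> E" "c \<in> N" "ht c \<noteq> 0"
  shows "\<exists>v. bij_betw v (UNIV::int set) (carrier G) \<and> (\<forall>i. inv (v i) \<otimes> v (i + 1) \<in> E)"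
proof -
  define C where "C = range (\<lambda>k::int. c [^] k)"
  have C: "subgroup C G" "C \<subseteq> N" using powers_subgroup[OF c(2)] by (simp_all add: C_def)
  have tor: "\<exists>n>0. x [^] (n::nat) \<in> C" if "x \<in> N" for x
    using commensurable[OF that c(2,3)] by (force simp: C_def)
  have tor': "\<forall>x\<in>E \<inter> N. \<exists>n>0. x [^] (n::nat) \<in> C" using tor by blast
  have EN: "finite (E \<inter> N)" "E \<inter> N \<subseteq> N" using E(1) by auto
  obtain n h H where n: "n > 0" "h 0 = \<one>"
    and hs: "\<And>i. Suc i < n \<Longrightarrow> inv (h i) \<otimes> h (Suc i) \<in> E \<inter> N"
    and H: "subgroup H G" "H \<subseteq> N" "C \<subseteq> H" "E \<inter> N \<subseteq> H" and h: "transversal h {..<n} C H"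
    using nested_path[OF EN C tor'] by (elim exE conjE) (rule that; (assumption | blast))
  obtain b where b: "b \<in> E" "b \<in> B" using reflection_generator[OF E(2,4)] by blast
  have torH: "\<exists>n>0. x [^] (n::nat) \<in> H" if "x \<in> N" for x using tor[OF that] H(3) by blast
  obtain R y s A where R: "R > 0" "transversal y {..<R} H N"
    and ys: "\<And>i. Suc i < R \<Longrightarrow> \<exists>d\<in>E \<inter> B. y (Suc i) = y i \<otimes> (b \<otimes> d)"
    using row_transversal[OF E b H(1,2,4) torH] by metis
  have yN: "y i \<in> N" if "i < R" for i using R that by (auto simp: transversal_def)
  define l where "l i = y (nat i)" for i
  have l: "transversal l {0..<int R} H N"
    unfolding transversal_def
  proof (intro conjI ballI impI)
    show "l ` {0..<int R} \<subseteq> N" using yN by (auto simp: l_def)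
    fix g assume "g \<in> N"
    then obtain i where "i < R" "inv (y i) \<otimes> g \<in> H" using R by (auto simp: transversal_def)
    then show "\<exists>i\<in>{0..<int R}. inv (l i) \<otimes> g \<in> H" by (intro bexI[of _ "int i"]) (auto simp: l_def)
  next
    fix i j assume "i \<in> {0..<int R}" "j \<in> {0..<int R}" "inv (l i) \<otimes> l j \<in> H"
    then have "nat i = nat j" using R(2) by (auto simp: l_def transversal_def)
    then show "i = j" using \<open>i \<in> _\<close> \<open>j \<in> _\<close> by auto
  qed
  \<comment> \<open>Between \<open>y i\<close> and its successor lies
    \<open>y i \<otimes> b\<close>: the edge \<open>b\<close> changes the sheet and the edge
    \<open>d\<close> returns in the next row.\<close>
  define v where "v i = (if even i then l (i div 2) else l (i div 2) \<otimes> b)" for i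
  have v: "transversal v {i. i div 2 \<in> {0..<int R}} H (carrier G)"
    unfolding v_def by (rule transversal_two_sheets[OF H(1,2) b(2) l l])
  have vs: "inv (v i) \<otimes> v (i + 1) \<in> E \<inter> B"
    if "i \<in> {i. i div 2 \<in> {0..<int R}}" "i + 1 \<in> {i. i div 2 \<in> {0..<int R}}" for i
  proof (cases "even i")
    case True
    then show ?thesis using b yN[of "nat (i div 2)"] that by (auto simp: v_def l_def)
  next
    case False
    then have i: "(i + 1) div 2 = i div 2 + 1" by presburger
    then have "nat ((i + 1) div 2) = Suc (nat (i div 2))" "Suc (nat (i div 2)) < R" using that by auto
    moreover obtain d where "d \<in> E \<inter> B" "y (Suc (nat (i div 2))) = y (nat (i div 2)) \<otimes> (b \<otimes> d)"
      using ys calculation by blast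
    ultimately show ?thesis
      using False b yN[of "nat (i div 2)"] by (simp add: v_def l_def inv_mult_group m_assoc)
  qed
  obtain g where g: "transversal g {j. j div int n \<in> {i. i div 2 \<in> {0..<int R}}} C (carrier G)"
    and gE: "\<And>j. j div int n \<in> {i. i div 2 \<in> {0..<int R}} \<Longrightarrow>
      (j + 1) div int n \<in> {i. i div 2 \<in> {0..<int R}} \<Longrightarrow> inv (g j) \<otimes> g (j + 1) \<in> E"
    using thicken_path[OF C(1) H(1,3,2) n h v, of E] hs vs by blast
  \<comment> \<open>The cosets of the powers of \<open>c\<close> number \<open>2 * R * n\<close>:
    \<open>R\<close> rows, two sheets, and \<open>n\<close> cosets within each coset of
    \<open>H\<close>.\<close>
  have ind: "j div int n \<in> {i. i div 2 \<in> {0..<int R}} \<longleftrightarrow> j \<in> {0..<2 * int R * int n}" for j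
  proof -
    have "j div int n \<in> {i. i div 2 \<in> {0..<int R}} \<longleftrightarrow> j div (int n * 2) \<in> {0..<int R}"
      by (simp add: zdiv_zmult2_eq)
    also have "\<dots> \<longleftrightarrow> 0 \<le> j \<and> j < int R * (int n * 2)"
      using n int_div_less[of "int n * 2" j "int R"] by (simp add: pos_imp_zdiv_nonneg_iff)
    finally show ?thesis by (simp add: mult.commute mult.left_commute)
  qed
  show ?thesis
  proof (rule double_ray_of_grid[OF c(2,3,1) E(3)])
    show "0 < 2 * int R * int n" using R n by simp
    show "transversal g {0..<2 * int R * int n} (range (\<lambda>k::int. c [^] k)) (carrier G)"
    proof -
      have "{j. j div int n \<in> {i. i div 2 \<in> {0..<int R}}} = {0..<2 * int R * int n}"
        using ind by blast
      then show ?thesis using g by (simp add: C_def)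
    qed
    show "inv (g i) \<otimes> g (i + 1) \<in> E" if "0 \<le> i" "i + 1 < 2 * int R * int n" for i
      using gE[of i] that unfolding ind by simp
  qed
qed

section \<open>Generators in \<open>N\<close> of finite order only\<close>

text \<open>If all reflections in \<open>E\<close> had the height of \<open>p\<close>, the elements
  of \<open>N\<close> of height 0 would contain \<open>E \<inter> N\<close> and all products
  \<open>p \<otimes> d\<close>, hence be all of \<open>N\<close>.\<close>

lemma height_gap:
  assumes E: "E \<subseteq> carrier G" "\<And>x. x \<in> E \<Longrightarrow> inv x \<in> E" "generate G E = carrier G"
    and z: "\<And>x. x \<in> E \<Longrightarrow> x \<in> N \<Longrightarrow> ht x = 0" and ex: "g \<in> N" "ht g \<noteq> 0"
    and p: "p \<in> E" "p \<in> B"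
  shows "\<exists>d\<in>E \<inter> B. ht d \<noteq> ht p"
proof (rule ccontr)
  assume "\<not> ?thesis"
  then have eq: "ht d = ht p" if "d \<in> E" "d \<in> B" for d using that by blast
  define U where "U = {x \<in> N. ht x = 0}"
  have "subgroup U G"
    by (rule subgroupI) (auto simp: U_def ht_N_mult ht_N_inv intro: exI[of _ \<one>])
  moreover have "U \<subseteq> N" "E \<inter> N \<subseteq> U" using z by (auto simp: U_def)
  moreover have "p \<otimes> d \<in> U" if "d \<in> E" "d \<in> B" for d
    using that p eq[OF that] by (simp add: U_def ht_refl_prod)
  ultimately have "U = N" using N_generated[OF E p, of U] by blast
  then show False using ex by (auto simp: U_def)
qed

lemma extremal_reflections:
  assumes E: "finite E" "E \<subseteq> carrier G" "\<And>x. x \<in> E \<Longrightarrow> inv x \<in> E" "generate G E = carrier G"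
    and z: "\<And>x. x \<in> E \<Longrightarrow> x \<in> N \<Longrightarrow> ht x = 0" and ex: "g \<in> N" "ht g \<noteq> 0"
  obtains p q where "p \<in> E" "p \<in> B" "q \<in> E" "q \<in> B" "ht p < ht q"
    "\<And>d. d \<in> E \<Longrightarrow> d \<in> B \<Longrightarrow> ht p \<le> ht d \<and> ht d \<le> ht q"
proof -
  obtain b where b: "b \<in> E \<inter> B" using reflection_generator[OF E(2,4)] by blast
  have fin: "finite (E \<inter> B)" "E \<inter> B \<noteq> {}" using E b by auto
  obtain p where p: "p \<in> E \<inter> B" "\<And>d. d \<in> E \<inter> B \<Longrightarrow> ht p \<le> ht d"
    using ex_is_arg_min_if_finite[OF fin, of ht] by (auto simp: is_arg_min_def not_less)
  obtain q where q: "q \<in> E \<inter> B" "\<And>d. d \<in> E \<inter> B \<Longrightarrow> ht d \<le> ht q"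
    using ex_is_arg_min_if_finite[OF fin, of "\<lambda>x. - ht x"] by (auto simp: is_arg_min_def not_less)
  obtain d where d: "d \<in> E \<inter> B" "ht d \<noteq> ht p"
    using height_gap[OF E(2-4) z ex, of p] p by blast
  then have "ht p < ht q" using p(2)[OF d(1)] q(2)[OF d(1)] by linarith
  then show ?thesis using that[of p q] p q by blast
qed


text \<open>Modulo \<open>H\<close>, \<open>w\<close> is \<open>t [^] 2\<close> or its inverse, so
  each coset of the group generated by \<open>t\<close> and \<open>H\<close> splits into two cosets
  of \<open>P\<close>, represented by the exponents 0 and 1 of \<open>t\<close>. The index stores
  the row in its half and the exponent in its parity.\<close>

lemma transversal_two_steps:
  assumes H: "subgroup H G" "H \<subseteq> N" "\<forall>x\<in>H. ht x = 0"
    and t: "t \<in> N" "ht t \<noteq> 0" and w: "w = t [^] (2 * e) \<otimes> a" "a \<in> H" "e * e = (1::int)"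
    and y: "transversal y {..<R} {t [^] k \<otimes> u | (k::int) u. u \<in> H} N"
  defines "P \<equiv> {w [^] k \<otimes> u | (k::int) u. u \<in> H}"
  shows "\<And>k u. even k \<Longrightarrow> u \<in> H \<Longrightarrow> t [^] (k::int) \<otimes> u \<in> P"
    "transversal (\<lambda>i. y (nat (i div 2)) \<otimes> t [^] (i mod 2)) {0..<2 * int R} P N"
proof -
  note memH = subgroup.one_closed[OF H(1)] subgroup.m_closed[OF H(1)] subgroup.m_inv_closed[OF H(1)]
  have HN: "u \<in> N" if "u \<in> H" for u using that H by auto
  have wk: "w [^] k = t [^] (2 * e * k) \<otimes> a [^] k" for k :: int
    using t HN[OF w(2)] int_pow_mult_distrib[of "t [^] (2 * e)" a k] by (simp add: w(1) N_comm int_pow_pow)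
  have ak: "a [^] k \<in> H" for k :: int using subgroup_int_pow_closed[OF H(1) w(2)] .
  show even: "t [^] (k::int) \<otimes> u \<in> P" if "even k" "u \<in> H" for k u
  proof -
    obtain j where j: "k = 2 * j" using \<open>even k\<close> by (elim evenE)
    \<comment> \<open>As \<open>e\<close> is its own inverse, the power \<open>e * j\<close> of
      \<open>w\<close> contains \<open>t\<close> with exponent \<open>2 * j\<close>.\<close>
    have "2 * e * (e * j) = (e * e) * (2 * j)" by (simp only: ac_simps)
    then have "2 * e * (e * j) = k" using w(3) j by simp
    then have "t [^] k \<otimes> u = w [^] (e * j) \<otimes> (inv (a [^] (e * j)) \<otimes> u)"
      using t HN[OF ak] HN[OF that(2)] wk[of "e * j"] by (simp add: m_assoc)
    moreover have "inv (a [^] (e * j)) \<otimes> u \<in> H" using memH ak that by simp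
    ultimately show ?thesis unfolding P_def by blast
  qed
  \<comment> \<open>Invariant that separates \<open>t\<close> from \<open>\<one>\<close> modulo
    \<open>P\<close>: heights in \<open>P\<close> are even multiples of \<open>ht t\<close>.\<close>
  have Pht: "\<exists>k. even k \<and> ht x = k * ht t" if "x \<in> P" for x
  proof -
    obtain k u where "x = w [^] (k::int) \<otimes> u" "u \<in> H" using \<open>x \<in> P\<close> unfolding P_def by blast
    then have "ht x = 2 * e * k * ht t"
      using H(3) ak t HN w(2) by (simp add: wk ht_N_mult ht_N_int_pow)
    then show ?thesis by (intro exI[of _ "2 * e * k"]) simp
  qed
  have PV: "x \<in> {t [^] k \<otimes> u | (k::int) u. u \<in> H}" if "x \<in> P" for x
  proof -
    obtain k u where "x = w [^] (k::int) \<otimes> u" "u \<in> H" using \<open>x \<in> P\<close> unfolding P_def by blast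
    then have "x = t [^] (2 * e * k) \<otimes> (a [^] k \<otimes> u)" using wk t HN ak by (simp add: m_assoc)
    moreover have "a [^] k \<otimes> u \<in> H" using memH ak \<open>u \<in> H\<close> by simp
    ultimately show ?thesis by blast
  qed
  have yN: "y i \<in> N" if "i < R" for i using y that by (auto simp: transversal_def)
  show "transversal (\<lambda>i. y (nat (i div 2)) \<otimes> t [^] (i mod 2)) {0..<2 * int R} P N"
    unfolding transversal_def
  proof (intro conjI ballI impI)
    show "(\<lambda>i. y (nat (i div 2)) \<otimes> t [^] (i mod 2)) ` {0..<2 * int R} \<subseteq> N"
      using t yN by auto
    fix g assume g: "g \<in> N"
    then obtain i k u where i: "i < R" and u: "inv (y i) \<otimes> g = t [^] (k::int) \<otimes> u" "u \<in> H"
      using y unfolding transversal_def by blast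
    have "inv (y i \<otimes> t [^] (k mod 2)) \<otimes> g = inv (t [^] (k mod 2)) \<otimes> (inv (y i) \<otimes> g)"
      using yN[OF i] t g by (simp add: inv_mult_group m_assoc)
    also have "\<dots> = t [^] (- (k mod 2) + k) \<otimes> u"
      unfolding u int_pow_mult[OF N_carrier[OF t(1)]] using t HN u by (simp add: int_pow_neg m_assoc)
    also have "\<dots> \<in> P" using u(2) by (intro even) (auto simp: even_iff_mod_2_eq_zero)
    finally have "inv (y i \<otimes> t [^] (k mod 2)) \<otimes> g \<in> P" .
    moreover have "(2 * int i + k mod 2) div 2 = int i" "(2 * int i + k mod 2) mod 2 = k mod 2"
      by simp_all
    moreover have "2 * int i + k mod 2 \<in> {0..<2 * int R}"
      using i pos_mod_bound[of 2 k] pos_mod_sign[of 2 k] by auto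
    ultimately show "\<exists>i\<in>{0..<2 * int R}. inv (y (nat (i div 2)) \<otimes> t [^] (i mod 2)) \<otimes> g \<in> P"
      by (metis nat_int)
  next
    fix i j assume ij: "i \<in> {0..<2 * int R}" "j \<in> {0..<2 * int R}"
      and m: "inv (y (nat (i div 2)) \<otimes> t [^] (i mod 2)) \<otimes> (y (nat (j div 2)) \<otimes> t [^] (j mod 2)) \<in> P"
    have b: "nat (i div 2) < R" "nat (j div 2) < R" using ij by auto
    have eq: "inv (y (nat (i div 2)) \<otimes> t [^] (i mod 2)) \<otimes> (y (nat (j div 2)) \<otimes> t [^] (j mod 2))
      = t [^] (j mod 2 - i mod 2) \<otimes> (inv (y (nat (i div 2))) \<otimes> y (nat (j div 2)))"
      using yN[OF b(1)] yN[OF b(2)] t by (simp add: inv_mult_group int_pow_diff N_ac)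
    obtain k u where u: "t [^] (j mod 2 - i mod 2) \<otimes> (inv (y (nat (i div 2))) \<otimes> y (nat (j div 2))) = t [^] (k::int) \<otimes> u" "u \<in> H"
      using PV[OF m] unfolding eq by blast
    define z where "z = inv (y (nat (i div 2))) \<otimes> y (nat (j div 2))"
    have z: "z \<in> N" using yN b by (simp add: z_def)
    have "z = t [^] (- (j mod 2 - i mod 2)) \<otimes> (t [^] (j mod 2 - i mod 2) \<otimes> z)"
      using t z by (simp only: int_pow_neg N_carrier int_pow_closed cancel_inv)
    also have "\<dots> = t [^] (- (j mod 2 - i mod 2) + k) \<otimes> u"
      unfolding z_def u int_pow_mult[OF N_carrier[OF t(1)]] using t HN u by (simp add: m_assoc)
    finally have "z \<in> {t [^] k \<otimes> u | (k::int) u. u \<in> H}" using u(2) by blast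
    then have n: "nat (i div 2) = nat (j div 2)"
      using y b unfolding transversal_def z_def by blast
    then have "t [^] (j mod 2 - i mod 2) \<in> P" using m unfolding eq using yN[OF b(1)] t by simp
    then obtain k where "even k" "ht (t [^] (j mod 2 - i mod 2)) = k * ht t" using Pht by blast
    then have "even k" "(j mod 2 - i mod 2) * ht t = k * ht t" by (simp_all only: ht_N_int_pow[OF t(1)])
    then have "even (j mod 2 - i mod 2)" using t by simp
    then have "i mod 2 = j mod 2" by presburger
    moreover have "i div 2 = j div 2" using n ij by auto
    ultimately show "i = j" by presburger
  qed
qed


text \<open>All generators in \<open>N\<close> lie in the finite kernel. They are used only inside
  the cosets of \<open>H\<close>, by the final thickening; the tour \<open>xs\<close> itself has
  reflections as its only labels.\<close>

lemma double_ray_of_finite_rotations: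
  assumes E: "finite E" "E \<subseteq> carrier G" "\<And>x. x \<in> E \<Longrightarrow> inv x \<in> E" "generate G E = carrier G"
    and z: "\<And>x. x \<in> E \<Longrightarrow> x \<in> N \<Longrightarrow> ht x = 0" and ex: "g0 \<in> N" "ht g0 \<noteq> 0"
  shows "\<exists>v. bij_betw v (UNIV::int set) (carrier G) \<and> (\<forall>i. inv (v i) \<otimes> v (i + 1) \<in> E)"
proof -
  have E': "\<forall>x\<in>E. inv x \<in> E" using E(3) by blast
  have EN: "finite (E \<inter> N)" "E \<inter> N \<subseteq> N" using E(1) by auto
  have tor1: "\<forall>x\<in>E \<inter> N. \<exists>n>0. x [^] (n::nat) \<in> {\<one>}" using kernel_torsion z by auto
  obtain n h H where n: "n > 0" "h 0 = \<one>"
    and hs: "\<And>i. Suc i < n \<Longrightarrow> inv (h i) \<otimes> h (Suc i) \<in> E \<inter> N"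
    and H: "subgroup H G" "H \<subseteq> N" "{\<one>} \<subseteq> H" "E \<inter> N \<subseteq> H" and h: "transversal h {..<n} {\<one>} H"
    using nested_path[OF EN trivial_subgroup tor1] by (elim exE conjE) (rule that; (assumption | blast))
  note memH = subgroup.one_closed[OF H(1)] subgroup.m_closed[OF H(1)] subgroup.m_inv_closed[OF H(1)]
  have HN: "u \<in> N" if "u \<in> H" for u using that H by auto
  have hN: "h i \<in> N" if "i < n" for i using h HN that by (auto simp: transversal_def)
  have hth: "ht (h i) = 0" if "i < n" for i
    using that
  proof (induction i)
    case (Suc i)
    have "ht (inv (h i) \<otimes> h (Suc i)) = 0" using hs[OF Suc.prems] z by auto
    then show ?case using Suc hN[of i] hN[of "Suc i"] by (simp add: ht_N_mult ht_N_inv)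
  qed (simp add: n)
  \<comment> \<open>\<open>H\<close> is represented by the path \<open>h\<close>, whose steps have
    height 0; so heights are defined modulo \<open>H\<close>.\<close>
  have htH: "ht u = 0" if u: "u \<in> H" for u
  proof -
    obtain i where i: "i < n" "inv (h i) \<otimes> u = \<one>" using h u by (auto simp: transversal_def)
    have "ht (inv (h i) \<otimes> u) = 0" by (simp add: i(2))
    then show ?thesis using hN[OF i(1)] hth[OF i(1)] HN[OF u] by (simp add: ht_N_mult ht_N_inv)
  qed
  obtain p q where p: "p \<in> E" "p \<in> B" and q: "q \<in> E" "q \<in> B" and pq: "ht p < ht q"
    and ext: "\<And>d. d \<in> E \<Longrightarrow> d \<in> B \<Longrightarrow> ht p \<le> ht d \<and> ht d \<le> ht q"
    using extremal_reflections[OF E z ex] by metis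
  define t where "t = q \<otimes> inv p"
  have t: "t \<in> N" using p q by (simp add: t_def)
  have htt: "ht t = ht q - ht p" using p q by (simp add: t_def ht_refl_prod ht_refl_inv)
  then have t0: "ht t > 0" "ht t \<noteq> 0" using pq by simp_all
  have q_t: "q = t \<otimes> p" using p q by (simp add: t_def m_assoc)
  define V where "V = {t [^] k \<otimes> u | (k::int) u. u \<in> H}"
  note V = cyclic_extension[OF H(1,2) t, folded V_def]
  have torV: "\<exists>n>0. x [^] (n::nat) \<in> V" if "x \<in> N" for x
  proof -
    obtain n k where "n > 0" "x [^] (n::nat) = t [^] (k::int) \<otimes> \<one>"
      using commensurable[OF \<open>x \<in> N\<close> t t0(2)] t by auto
    then show ?thesis using memH(1) unfolding V_def by blast
  qed
  have EV: "E \<inter> N \<subseteq> V" using H(4) V(2) by blast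
  obtain R y s A where R: "R > 0" "y 0 = \<one>" and yV: "transversal y {..<R} V N"
    and ys: "\<And>i. Suc i < R \<Longrightarrow> \<exists>d\<in>E \<inter> B. y (Suc i) = y i \<otimes> (p \<otimes> d)"
    and comp: "\<And>i. i < R \<Longrightarrow> y i \<otimes> y (R - 1 - i) = y (R - 1)"
    and s: "s \<in> E \<inter> B" and A: "2 * A < R" "inv (y A) \<otimes> (y (R - 1) \<otimes> (p \<otimes> s)) \<in> V"
    using row_transversal[OF E p V(1,4) EV torV] by metis
  have yN: "y i \<in> N" if "i < R" for i using yV that by (auto simp: transversal_def)
  have psN: "p \<otimes> d \<in> N" if "d \<in> E \<inter> B" for d using that p by simp
  \<comment> \<open>\<open>A\<close> first rows, \<open>m\<close> middle rows and \<open>A\<close>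
    last rows.\<close>
  define m where "m = R - 2 * A"
  have m: "m \<ge> 1" "R = A + m + A" using A by (simp_all add: m_def)
  \<comment> \<open>\<open>Y\<close> continues past the last row by the closing step
    \<open>p \<otimes> s\<close>; \<open>Y'\<close> leaves by the same step already from row
    \<open>A + m - 1 = R - 1 - A\<close>, the mirror image of row \<open>A\<close>. Both are
    constant from there on, which keeps all values in \<open>N\<close>.\<close>
  define Y where "Y i = (if i < R then y i else y (R - 1) \<otimes> (p \<otimes> s))" for i
  define Y' where "Y' i = (if i < A + m then y i else y (A + m - 1) \<otimes> (p \<otimes> s))" for i
  have YN: "Y i \<in> N" "Y' i \<in> N" for i
    using yN R m psN[OF s] by (auto simp: Y_def Y'_def)
  have Y0: "Y 0 = \<one>" using R by (simp add: Y_def)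
  have Ys: "\<exists>d\<in>E \<inter> B. Y (Suc i) = Y i \<otimes> (p \<otimes> d)" if "i < R" for i
  proof (cases "Suc i < R")
    case True
    then show ?thesis using ys[of i] by (simp add: Y_def)
  next
    case False
    then have "i = R - 1" using that by simp
    then show ?thesis using s R by (auto simp: Y_def)
  qed
  have Y's: "\<exists>d\<in>E \<inter> B. Y' (Suc i) = Y' i \<otimes> (p \<otimes> d)" if "i < A + m" for i
  proof (cases "Suc i < A + m")
    case True
    then show ?thesis using ys[of i] m by (simp add: Y'_def)
  next
    case False
    then have "i = A + m - 1" using that by simp
    then show ?thesis using s m by (auto simp: Y'_def)
  qed

  text \<open>The steps have heights in \<open>[-ht t, 0]\<close>, which bounds the exponent of \<open>t\<close> in the excess
    \<open>inv (y A) \<otimes> Y R\<close>.\<close>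
  have htY: "ht (Y A) - int k * ht t \<le> ht (Y (A + k)) \<and> ht (Y (A + k)) \<le> ht (Y A)" if "A + k \<le> R" for k
    using that
  proof (induction k)
    case (Suc k)
    obtain d where d: "d \<in> E \<inter> B" "Y (Suc (A + k)) = Y (A + k) \<otimes> (p \<otimes> d)"
      using Ys[of "A + k"] Suc.prems by auto
    then have "ht (Y (A + Suc k)) = ht (Y (A + k)) + (ht p - ht d)"
      using YN p by (simp add: ht_N_mult ht_refl_prod)
    moreover have "ht p \<le> ht d" "ht d \<le> ht p + ht t" using ext[of d] d htt by auto
    ultimately show ?case using Suc by (simp add: algebra_simps)
  qed simp
  \<comment> \<open>The closing step leads from the last row to row \<open>A\<close>, displaced by
    the excess \<open>e\<close>, which is a power of \<open>t\<close> modulo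
    \<open>H\<close>.\<close>
  define e where "e = inv (y A) \<otimes> Y R"
  have yA: "y A \<in> N" "Y A = y A" using yN[of A] A by (simp_all add: Y_def)
  have eN: "e \<in> N" using YN yA by (simp add: e_def)
  have "e \<in> V" using A(2) by (simp add: e_def Y_def)
  then obtain kap a where e: "e = t [^] (kap::int) \<otimes> a" "a \<in> H" unfolding V_def by blast
  have "ht e = kap * ht t" using e t HN htH by (simp add: ht_N_mult ht_N_int_pow)
  moreover have "ht e = ht (Y R) - ht (Y A)" using yA YN by (simp add: e_def ht_N_mult ht_N_inv)
  moreover have "ht (Y A) - int (A + m) * ht t \<le> ht (Y R) \<and> ht (Y R) \<le> ht (Y A)"
  proof -
    have "R = A + (A + m)" using m by simp
    then show ?thesis using htY[of "A + m"] by simp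
  qed
  ultimately have "- int (A + m) * ht t \<le> kap * ht t" "kap * ht t \<le> 0"
    unfolding mult_minus_left by linarith+
  then have "- int (A + m) \<le> kap" "kap \<le> 0"
    using t0 mult_le_cancel_right_pos[of "ht t" "- int (A + m)" kap] by (auto simp: mult_le_0_iff)
  then have x: "nat (- kap) \<le> A + m" "int (nat (- kap)) = - kap" by auto
  \<comment> \<open>The numbers of forward visits are chosen so that half a tour shifts by the odd
    exponent \<open>w\<close>.\<close>
  obtain S c w where S: "S \<le> A" "c \<le> m" and w: "w = 1 \<or> w = (-1::int)"
    and Sc: "3 * int S + int c = int A + int (nat (- kap)) + w"
    using split_in_three[OF m(1) x(1)] by blast
  \<comment> \<open>Shifts depend on the numbers of forward visits only, so the forward ones are put
    first.\<close>
  define D where "D = replicate S True @ replicate (A - S) False"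
  define O1 where "O1 = replicate c True @ replicate (m - c) False"
  have D: "length D = A" "length (filter (\<lambda>b. b) D) = S" using S by (simp_all add: D_def)
  have O1: "length O1 = m" "length (filter (\<lambda>b. b) O1) = c" using S by (simp_all add: O1_def)
  \<comment> \<open>\<open>A\<close> complete visits shift by \<open>t [^] K\<close>; adding the
    \<open>c\<close> forward edges of the middle and the excess gives the shift \<open>L\<close> of
    half a tour.\<close>
  define K where "K = 3 * int S - int A"
  define L where "L = e \<otimes> t [^] (K + int c)"
  have Lw: "L = t [^] w \<otimes> a"
  proof -
    have "L = t [^] (kap + (K + int c)) \<otimes> a"
      using t HN e(2) by (simp add: L_def e(1) int_pow_mult N_ac)
    moreover have "kap + (K + int c) = w" using Sc x(2) unfolding K_def by linarith
    ultimately show ?thesis by simp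
  qed
  have LN: "L \<in> N" using t HN e by (simp add: Lw)
  define lam where "lam = L \<otimes> L"
  have lamN: "lam \<in> N" using LN by (simp add: lam_def)
  have lam: "lam = t [^] (2 * w) \<otimes> (a \<otimes> a)"
  proof -
    have "t [^] (2 * w) = t [^] w \<otimes> t [^] w" using t int_pow_mult[of t w w] by simp
    then show ?thesis using t HN e by (simp add: lam_def Lw N_ac)
  qed
  have aa: "a \<otimes> a \<in> H" using e memH by simp
  have "w * w = 1" using w by auto
  \<comment> \<open>\<open>F1\<close> and \<open>F2\<close> visit the first and the last rows
    completely. \<open>S1\<close> and \<open>S2\<close> pass the middle rows with the same
    directions, but \<open>S2\<close> starts displaced by \<open>L\<close> and exits along
    \<open>Y'\<close>.\<close>
  define F1 where "F1 = double_pass p q Y \<one> 0 D"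
  define S1 where "S1 = single_pass p q Y (t [^] K) A O1"
  define F2 where "F2 = double_pass p q Y (t [^] (K + int c)) (A + m) D"
  define S2 where "S2 = single_pass p q Y' (t [^] K \<otimes> L) A O1"
  define xs where "xs = F1 @ S1 @ F2 @ S2"
  note cd = chain_double_pass[OF E' p q t_def]
  note cs = chain_single_pass[OF E' p q t_def]
  have c1: "chain (reflection_step E) \<one> F1 (Y A \<otimes> t [^] K)"
    using cd[of 0 D Y \<one>] Ys YN D m Y0 t by (simp add: F1_def K_def)
  have c2: "chain (reflection_step E) (Y A \<otimes> t [^] K) S1 (Y (A + m) \<otimes> t [^] (K + int c))"
    using cs[of A O1 Y "t [^] K"] Ys YN O1 m t by (simp add: S1_def int_pow_mult)
  have "t [^] (K + int c) \<otimes> t [^] K = t [^] K \<otimes> t [^] (K + int c)" using t by (simp add: N_comm)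
  moreover have "Y R = y A \<otimes> e" using yA YN by (simp add: e_def)
  \<comment> \<open>After \<open>F2\<close> the walk is back in row \<open>A\<close>, displaced by
    \<open>L\<close> from the start of \<open>S1\<close>.\<close>
  ultimately have "Y R \<otimes> (t [^] (K + int c) \<otimes> t [^] K) = Y A \<otimes> (t [^] K \<otimes> L)"
    using yA eN t by (simp add: L_def N_ac)
  then have c3: "chain (reflection_step E) (Y (A + m) \<otimes> t [^] (K + int c)) F2 (Y A \<otimes> (t [^] K \<otimes> L))"
    using cd[of "A + m" D Y "t [^] (K + int c)"] Ys YN D m t by (simp add: F2_def K_def)
  \<comment> \<open>Palindrome symmetry: the mirror row \<open>A + m - 1\<close> lies relative to
    row 0 as the last row lies relative to row \<open>A\<close>. Hence the closing step from it has
    the same excess \<open>e\<close>, this time towards row 0.\<close>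
  have "y (A + m - 1) = inv (y A) \<otimes> y (R - 1)"
  proof -
    have "R - 1 - A = A + m - 1" using m by simp
    then have "y A \<otimes> y (A + m - 1) = y (R - 1)" using comp[of A] A by simp
    moreover have "y (A + m - 1) \<in> N" using yN[of "A + m - 1"] m by simp
    ultimately show ?thesis using yA by (metis N_carrier cancel_inv(1))
  qed
  then have "Y' (A + m) = e"
    using yA yN[of "R - 1"] R psN[OF s] by (simp add: Y'_def e_def Y_def m_assoc)
  \<comment> \<open>The second half of the tour shifts by \<open>L\<close> as well, so the tour
    closes up to \<open>lam = L \<otimes> L\<close>, whose exponent of \<open>t\<close> is
    \<open>2 * w\<close>.\<close>
  then have "Y' (A + m) \<otimes> (t [^] K \<otimes> L \<otimes> t [^] int c) = lam"
    using eN LN t by (simp add: lam_def L_def int_pow_mult N_ac)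
  moreover have "Y' A = Y A" using m by (simp add: Y'_def Y_def)
  ultimately have c4: "chain (reflection_step E) (Y A \<otimes> (t [^] K \<otimes> L)) S2 lam"
    using cs[of A O1 Y' "t [^] K \<otimes> L"] Y's YN O1 m t LN by (simp add: S2_def)
  have ch: "chain (reflection_step E) \<one> xs lam"
    unfolding xs_def chain_append using c1 c2 c3 c4 by blast

  define P where "P = {lam [^] k \<otimes> u | (k::int) u. u \<in> H}"
  note P = cyclic_extension[OF H(1,2) lamN, folded P_def]
  note memP = subgroup.m_inv_closed[OF P(1)]
  have htH': "\<forall>u\<in>H. ht u = 0" using htH by blast
  note two = transversal_two_steps[OF H(1,2) htH' t t0(2) lam aa \<open>w * w = 1\<close> yV[unfolded V_def], folded P_def]
  \<comment> \<open>Modulo \<open>P\<close> only the parity of the exponent of \<open>t\<close>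
    matters. Every row is met with both parities, and both times together with the neighbour along
    the same \<open>r\<close>.\<close>
  have raw: "\<exists>r\<in>{p, q}. \<exists>k k'::int. \<exists>u\<in>H. \<exists>u'\<in>H. odd (k - k') \<and>
      {y j \<otimes> (t [^] k \<otimes> u), y j \<otimes> (t [^] k' \<otimes> u'),
       y j \<otimes> (t [^] k \<otimes> u) \<otimes> r, y j \<otimes> (t [^] k' \<otimes> u') \<otimes> r} \<subseteq> set xs" if j: "j < R" for j
  proof -
    note dc = double_pass_cover[OF E' p q t_def]
    note sc = single_pass_cover[OF E' p q t_def]
    have Yj: "Y j = y j" using j by (simp add: Y_def)
    consider "j < A" | "A \<le> j" "j < A + m" | "A + m \<le> j" by linarith
    then show ?thesis
    proof cases
      case 1
      obtain r k where r: "r \<in> {p, q}" and "let l = Y j \<otimes> (\<one> \<otimes> t [^] (k::int)); l' = Y j \<otimes> (\<one> \<otimes> t [^] (k + 1)) in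
          {l, l', l \<otimes> r, l' \<otimes> r} \<subseteq> set F1"
        using dc[of j D \<one> Y 0] 1 D YN by (auto simp: F1_def)
      then have "{y j \<otimes> (t [^] k \<otimes> \<one>), y j \<otimes> (t [^] (k + 1) \<otimes> \<one>),
          y j \<otimes> (t [^] k \<otimes> \<one>) \<otimes> r, y j \<otimes> (t [^] (k + 1) \<otimes> \<one>) \<otimes> r} \<subseteq> set xs"
        using t by (auto simp: Let_def Yj xs_def)
      moreover have "odd (k - (k + 1))" by simp
      ultimately show ?thesis using r memH(1) by blast
    next
      case 2
      have jA: "j - A < length O1" "A + (j - A) = j" using 2 O1 by simp_all
      obtain r k where r: "r \<in> {p, q}" and k: "\<And>Y u. u \<in> N \<Longrightarrow>
          {Y j \<otimes> (t [^] K \<otimes> u \<otimes> t [^] (k::int)), Y j \<otimes> (t [^] K \<otimes> u \<otimes> t [^] k) \<otimes> r}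
          \<subseteq> set (single_pass p q Y (t [^] K \<otimes> u) A O1)"
        using sc[OF jA(1) N_int_pow[OF t, of K], of A] unfolding jA(2) by blast
      have Y'j: "Y' j = y j" using 2 by (simp add: Y'_def)
      have 3: "t [^] K \<otimes> t [^] k = t [^] (K + k) \<otimes> \<one>" "t [^] K \<otimes> \<one> = t [^] K"
        using t by (simp_all add: int_pow_mult)
      \<comment> \<open>The two passes through a middle row differ by \<open>L\<close>, whose
        exponent \<open>w\<close> is odd; so they meet opposite parities.\<close>
      have 4: "t [^] K \<otimes> L \<otimes> t [^] k = t [^] (K + k + w) \<otimes> a"
        using t HN e by (simp add: Lw int_pow_mult N_ac)
      have "{y j \<otimes> (t [^] (K + k) \<otimes> \<one>), y j \<otimes> (t [^] (K + k + w) \<otimes> a),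
          y j \<otimes> (t [^] (K + k) \<otimes> \<one>) \<otimes> r, y j \<otimes> (t [^] (K + k + w) \<otimes> a) \<otimes> r} \<subseteq> set xs"
        using k[of \<one> Y] k[OF LN, of Y'] unfolding 3 4 Yj Y'j
        by (auto simp: xs_def S1_def S2_def)
      moreover have "odd (K + k - (K + k + w))" using w by auto
      ultimately show ?thesis using r memH(1) e(2) by blast
    next
      case 3
      have jA: "j - (A + m) < length D" "A + m + (j - (A + m)) = j" using 3 j m D by simp_all
      obtain r k where r: "r \<in> {p, q}" and k: "let l = Y j \<otimes> (t [^] (K + int c) \<otimes> t [^] (k::int));
          l' = Y j \<otimes> (t [^] (K + int c) \<otimes> t [^] (k + 1)) in {l, l', l \<otimes> r, l' \<otimes> r} \<subseteq> set F2"
        using dc[OF jA(1) N_int_pow[OF t, of "K + int c"], of Y "A + m"] YN unfolding jA(2) F2_def by blast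
      have eq: "t [^] (K + int c) \<otimes> t [^] i = t [^] (K + int c + i) \<otimes> \<one>" for i :: int
        using t by (simp add: int_pow_mult)
      have "{y j \<otimes> (t [^] (K + int c + k) \<otimes> \<one>), y j \<otimes> (t [^] (K + int c + (k + 1)) \<otimes> \<one>),
          y j \<otimes> (t [^] (K + int c + k) \<otimes> \<one>) \<otimes> r, y j \<otimes> (t [^] (K + int c + (k + 1)) \<otimes> \<one>) \<otimes> r} \<subseteq> set xs"
        using k unfolding Let_def Yj eq by (auto simp: xs_def)
      moreover have "odd (K + int c + k - (K + int c + (k + 1)))" by simp
      ultimately show ?thesis using r memH(1) by blast
    qed
  qed
  have inP: "inv (y j \<otimes> t [^] d) \<otimes> (y j \<otimes> (t [^] k \<otimes> u)) \<in> P"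
    if "even (k - d)" "u \<in> H" "j < R" for j u and k d :: int
  proof -
    have "inv (y j \<otimes> t [^] d) \<otimes> (y j \<otimes> (t [^] k \<otimes> u)) = t [^] (- d + k) \<otimes> u"
      unfolding int_pow_mult[OF N_carrier[OF t]] using t HN that yN
      by (simp add: inv_mult_group int_pow_neg m_assoc)
    then show ?thesis using two(1)[of "- d + k" u] that by simp
  qed
  have conj: "inv (g \<otimes> p) \<otimes> (g' \<otimes> p) = inv (inv g \<otimes> g')" if "g \<in> N" "g' \<in> N" for g g'
  proof -
    have "(inv g \<otimes> g') \<otimes> p = p \<otimes> inv (inv g \<otimes> g')"
      using that p refl_commute[of p "inv (inv g \<otimes> g')"] by simp
    then have "inv p \<otimes> ((inv g \<otimes> g') \<otimes> p) = inv (inv g \<otimes> g')" using that p by simp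
    then show ?thesis using that p by (simp add: inv_mult_group m_assoc)
  qed
  have cov0: "\<exists>x\<in>set xs. inv (y j \<otimes> t [^] d) \<otimes> x \<in> P" if j: "j < R" for j and d :: int
  proof -
    obtain r k k' u u' where *: "u \<in> H" "u' \<in> H" "odd (k - k')"
      "y j \<otimes> (t [^] (k::int) \<otimes> u) \<in> set xs" "y j \<otimes> (t [^] (k'::int) \<otimes> u') \<in> set xs"
      using raw[OF j] by blast
    then have "even (k - d) \<or> even (k' - d)" by presburger
    then show ?thesis using inP[of k d u j] inP[of k' d u' j] * j by blast
  qed
  have cov1: "\<exists>x\<in>set xs. inv (y j \<otimes> t [^] d \<otimes> p) \<otimes> x \<in> P" if j: "j < R" for j and d :: int
  proof -
    obtain r where r0: "r \<in> {p, q}" and "\<exists>k k'::int. \<exists>u\<in>H. \<exists>u'\<in>H. odd (k - k') \<and>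
      {y j \<otimes> (t [^] k \<otimes> u), y j \<otimes> (t [^] k' \<otimes> u'),
       y j \<otimes> (t [^] k \<otimes> u) \<otimes> r, y j \<otimes> (t [^] k' \<otimes> u') \<otimes> r} \<subseteq> set xs"
      using raw[OF j] by (elim bexE)
    then obtain k k' u u' where *: "odd (k - k')" "u \<in> H" "u' \<in> H"
      and sub: "{y j \<otimes> (t [^] (k::int) \<otimes> u), y j \<otimes> (t [^] (k'::int) \<otimes> u'),
       y j \<otimes> (t [^] k \<otimes> u) \<otimes> r, y j \<otimes> (t [^] k' \<otimes> u') \<otimes> r} \<subseteq> set xs"
      by (elim exE bexE conjE)
    have in_xs: "y j \<otimes> (t [^] k \<otimes> u) \<otimes> r \<in> set xs" "y j \<otimes> (t [^] k' \<otimes> u') \<otimes> r \<in> set xs"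
      using sub by auto
    \<comment> \<open>Since \<open>q = t \<otimes> p\<close>, a vertex reached by \<open>q\<close>
      equals one reached by \<open>p\<close> with the exponent raised by one.\<close>
    define o' where "o' = (if r = p then 0 else 1 :: int)"
    have r: "y j \<otimes> (t [^] i \<otimes> v) \<otimes> r = y j \<otimes> (t [^] (o' + i) \<otimes> v) \<otimes> p" if "v \<in> H" for i v
    proof (cases "r = p")
      case False
      then have "r = t \<otimes> p" using r0 q_t by auto
      then show ?thesis using False t HN[OF that] yN[OF j] p by (simp add: o'_def int_pow_mult N_ac)
    qed (simp add: o'_def)
    have fin: "inv (y j \<otimes> t [^] d \<otimes> p) \<otimes> (y j \<otimes> (t [^] i \<otimes> v) \<otimes> r) \<in> P"
      if "v \<in> H" "even (o' + i - d)" for i v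
      unfolding r[OF that(1)] using conj[of "y j \<otimes> t [^] d" "y j \<otimes> (t [^] (o' + i) \<otimes> v)"]
        inP[OF that(2,1) j] memP t HN[OF that(1)] yN[OF j] by simp
    have "even (o' + k - d) \<or> even (o' + k' - d)" using *(1) by presburger
    then show ?thesis using fin[OF *(2)] fin[OF *(3)] in_xs by blast
  qed
  \<comment> \<open>Each row contributes four cosets of \<open>P\<close>: two parities in each of
    two sheets, which matches the length of \<open>xs\<close>.\<close>
  define I where "I = {i::int. i div 2 \<in> {0..<2 * int R}}"
  have I: "I = {0..<4 * int R}" by (auto simp: I_def)
  note f = transversal_two_sheets[OF P(1,4) p(2) two(2) two(2), folded I_def]
  have len: "length xs = 4 * R"
    using m D O1 by (simp add: xs_def F1_def F2_def S1_def S2_def length_single_pass length_double_pass)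
  have xsc: "set xs \<subseteq> carrier G"
    unfolding xs_def F1_def F2_def S1_def S2_def
    using double_pass_closed[OF E' p q t_def] single_pass_closed[OF E' p q t_def] YN t LN by simp
  have "transversal (\<lambda>i. xs ! i) {..<length xs} P (carrier G)"
  proof (rule transversal_of_list[OF P(1) f])
    show "finite I" "card I = length xs" by (simp_all add: I len)
    fix i assume "i \<in> I"
    then have j: "nat (i div 2 div 2) < R" by (auto simp: I_def)
    show "\<exists>x\<in>set xs. inv (if even i then y (nat (i div 2 div 2)) \<otimes> t [^] (i div 2 mod 2)
        else y (nat (i div 2 div 2)) \<otimes> t [^] (i div 2 mod 2) \<otimes> p) \<otimes> x \<in> P"
      using cov0[OF j] cov1[OF j] by auto
  qed (rule xsc)
  moreover have "k = 0" if "lam [^] k \<in> H" for k :: int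
  proof -
    \<comment> \<open>\<open>lam\<close> has nonzero height and \<open>H\<close> has height 0, so no
      nontrivial power of \<open>lam\<close> is in \<open>H\<close>.\<close>
    have "ht lam = 2 * w * ht t" using t HN aa htH by (simp add: lam ht_N_mult ht_N_int_pow)
    then show ?thesis using htH[OF that] t0 w lamN by (auto simp: ht_N_int_pow)
  qed
  ultimately have v: "transversal (\<lambda>i::int. lam [^] (i div int (length xs)) \<otimes> xs ! nat (i mod int (length xs)))
      UNIV H (carrier G)" (is "transversal ?v _ _ _")
    using transversal_periodic[OF H(1,2) lamN, of "length xs" "\<lambda>i. xs ! i"] len R unfolding P_def by simp
  have vs: "inv (?v i) \<otimes> ?v (i + 1) \<in> E \<inter> B" for i
    using periodic_step[OF lamN _ xsc ch, of i] len R unfolding reflection_step_def by simp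
  \<comment> \<open>Each coset of \<open>H\<close> is replaced by a path along generators in
    \<open>N\<close>; modulo the trivial subgroup the resulting transversal is a bijection.\<close>
  obtain g where g: "transversal g {j. j div int n \<in> UNIV} {\<one>} (carrier G)"
    and gE: "\<And>j. inv (g j) \<otimes> g (j + 1) \<in> E"
    using thicken_path[OF trivial_subgroup(1) H(1,3,2) n h v, of E] hs vs by (metis IntD1 UNIV_I)
  have gc: "g i \<in> carrier G" for i using g by (auto simp: transversal_def)
  have "bij_betw g UNIV (carrier G)"
    unfolding bij_betw_def
  proof
    show "inj g"
    proof (rule injI)
      fix i j assume "g i = g j"
      then have "inv (g i) \<otimes> g j \<in> {\<one>}" using gc by simp
      then show "i = j" using g by (auto simp: transversal_def)
    qed
    have "x \<in> range g" if x: "x \<in> carrier G" for x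
    proof -
      obtain i where "inv (g i) \<otimes> x = \<one>" using g x by (auto simp: transversal_def)
      then have "x = g i" using gc x by (metis cancel_inv(2) r_one inv_closed)
      then show ?thesis by simp
    qed
    then show "range g = carrier G" using gc by blast
  qed
  then show ?thesis using gE by blast
qed


text \<open>\<open>S\<close> is closed under inverses first, since edges can be used in both
  directions. Nonzero height expresses infinite order of a generator in \<open>N\<close>, and the
  two cases are the two constructions above.\<close>

lemma hamiltonian_sequence:
  assumes S: "finite S" "S \<subseteq> carrier G" "generate G S = carrier G" and ex: "g0 \<in> N" "ht g0 \<noteq> 0"
  shows "\<exists>v. bij_betw v (UNIV::int set) (carrier G) \<and>
    (\<forall>i. inv (v i) \<otimes> v (i + 1) \<in> S \<union> (\<lambda>x. inv x) ` S)"
proof -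
  define E where "E = S \<union> (\<lambda>x. inv x) ` S"
  have E: "finite E" "E \<subseteq> carrier G" using S by (auto simp: E_def)
  have Ei: "inv x \<in> E" if "x \<in> E" for x using that S by (auto simp: E_def)
  have "generate G S \<subseteq> generate G E" by (rule mono_generate) (auto simp: E_def)
  then have Eg: "generate G E = carrier G" using S(3) generate_incl[OF E(2)] by auto
  show ?thesis
  proof (cases "\<exists>c\<in>E. c \<in> N \<and> ht c \<noteq> 0")
    case True
    then show ?thesis using double_ray_of_infinite_rotation[OF E Ei Eg] unfolding E_def by blast
  next
    case False
    then show ?thesis using double_ray_of_finite_rotations[OF E Ei Eg _ ex] unfolding E_def by blast
  qed
qed

end

section \<open>The amalgamated product\<close>

text \<open>There is only one coset besides \<open>K\<close>, since otherwise three distinct ones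
  would exist; \<open>a\<close>, \<open>b\<close> and \<open>inv b\<close> all lie in it.\<close>

lemma (in group) index_two_mult:
  assumes K: "subgroup K G" "card (rcosets K) = 2"
    and a: "a \<in> carrier G" "a \<notin> K" and b: "b \<in> carrier G" "b \<notin> K"
  shows "a \<otimes> b \<in> K" "a \<otimes> inv b \<in> K"
proof -
  have one: "K #> c = K \<longleftrightarrow> c \<in> K" if "c \<in> carrier G" for c
    using coset_join1[of K c] coset_join2[OF that K(1)] subgroup.subset[OF K(1)] that K(1) by metis
  have "finite (rcosets K)" using K(2) card.infinite by fastforce
  have eq: "K #> c = K #> d" if "c \<in> carrier G" "d \<in> carrier G" "c \<notin> K" "d \<notin> K" for c d
  proof (rule ccontr)
    assume ne: "K #> c \<noteq> K #> d"
    have "{K, K #> c, K #> d} \<subseteq> rcosets K"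
      using that one[of \<one>] subgroup.one_closed[OF K(1)] unfolding RCOSETS_def by blast
    moreover have "card {K, K #> c, K #> d} = 3" 
      using ne one[OF that(1)] one[OF that(2)] that(3,4) by (simp add: card_insert_if eq_commute[of K])
    ultimately show False using card_mono[OF \<open>finite (rcosets K)\<close>, of "{K, K #> c, K #> d}"] K(2) by simp
  qed
  have diff: "c \<otimes> inv d \<in> K" if "c \<in> carrier G" "d \<in> carrier G" "c \<notin> K" "d \<notin> K" for c d
  proof -
    have "c \<in> K #> d" using eq[OF that] rcos_self[OF that(1) K(1)] by simp
    then obtain k where "k \<in> K" "c = k \<otimes> d" by (auto simp: r_coset_def)
    then show ?thesis using that subgroup.mem_carrier[OF K(1)] by (simp add: m_assoc)
  qed
  show "a \<otimes> inv b \<in> K" using diff a b by simp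
  have "inv b \<notin> K" using b subgroup.m_inv_closed[OF K(1), of "inv b"] by auto
  then show "a \<otimes> b \<in> K" using diff[of a "inv b"] a b by simp
qed

lemma (in group) int_pow_commute:
  assumes x: "x \<in> carrier G" "y \<in> carrier G" "x \<otimes> y = y \<otimes> x"
  shows "x [^] (n::int) \<otimes> y = y \<otimes> x [^] n"
proof (cases n)
  case (nonneg m)
  then show ?thesis using group_commutes_pow[OF x(3,1,2)] by (simp add: int_pow_int)
next
  case (neg m)
  define X where "X = x [^] Suc m"
  have X: "X \<in> carrier G" "X \<otimes> y = y \<otimes> X"
    using x group_commutes_pow[OF x(3,1,2), of "Suc m"] by (simp_all only: X_def nat_pow_closed)
  have "inv X \<otimes> y = inv X \<otimes> (y \<otimes> X) \<otimes> inv X" using X(1) x(2) by (simp add: m_assoc)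
  also have "\<dots> = inv X \<otimes> (X \<otimes> y) \<otimes> inv X" by (simp only: X(2))
  also have "\<dots> = y \<otimes> inv X" using X(1) x(2) by (simp flip: m_assoc)
  finally show ?thesis using x neg by (simp only: int_pow_neg_int X_def)
qed

lemma (in group) int_pow_reflect:
  assumes x: "x \<in> carrier G" "v \<in> carrier G" "v \<otimes> x = inv x \<otimes> v"
  shows "v \<otimes> x [^] (n::int) = x [^] (-n) \<otimes> v"
proof -
  have nat: "v \<otimes> y [^] n = inv y [^] n \<otimes> v" if "y \<in> carrier G" "v \<otimes> y = inv y \<otimes> v" for y and n :: nat
  proof (induction n)
    case (Suc n)
    have "v \<otimes> y [^] Suc n = (v \<otimes> y [^] n) \<otimes> y" using that x by (simp add: m_assoc)
    also have "\<dots> = inv y [^] n \<otimes> (v \<otimes> y)" using that x by (simp add: Suc m_assoc)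
    also have "\<dots> = inv y [^] Suc n \<otimes> v" using that x by (simp add: m_assoc)
    finally show ?case .
  qed (use that x in simp)
  show ?thesis
  proof (cases n)
    case (nonneg m)
    then show ?thesis using nat[OF x(1,3), of m] x
      by (simp add: int_pow_int int_pow_neg nat_pow_inv)
  next
    case (neg m)
    have "v \<otimes> inv x = x \<otimes> (inv x \<otimes> v) \<otimes> inv x" using x by (simp flip: m_assoc)
    also have "\<dots> = x \<otimes> (v \<otimes> x) \<otimes> inv x" by (simp only: x(3))
    also have "\<dots> = x \<otimes> v" using x(1,2) by (simp add: m_assoc)
    finally have "v \<otimes> inv x = x \<otimes> v" .
    then have "v \<otimes> inv x [^] Suc m = inv (inv x) [^] Suc m \<otimes> v" using x by (intro nat) simp_all
    moreover have "x [^] n = inv x [^] Suc m" "x [^] (-n) = x [^] Suc m"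
      using x neg by (simp_all only: int_pow_neg_int nat_pow_inv minus_minus int_pow_int)
    ultimately show ?thesis using x by simp
  qed
qed

section \<open>The map onto the infinite dihedral group and normal forms\<close>

text \<open>The pair \<open>(e, m)\<close> is the isometry of the integers sending \<open>n\<close>
  to \<open>m + e * n\<close>, and the product is composition.\<close>

definition infinite_dihedral :: "(int \<times> int) monoid" where
  "infinite_dihedral = \<lparr>carrier = {1, -1} \<times> UNIV,
     monoid.mult = (\<lambda>(e, m) (f, n). (e * f, m + e * n)), one = (1, 0)\<rparr>"

lemma group_infinite_dihedral: "group infinite_dihedral"
proof (rule groupI)
  fix x assume "x \<in> carrier infinite_dihedral"
  then show "\<exists>y\<in>carrier infinite_dihedral. y \<otimes>\<^bsub>infinite_dihedral\<^esub> x = \<one>\<^bsub>infinite_dihedral\<^esub>"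
    by (intro bexI[of _ "(fst x, - fst x * snd x)"]) (auto simp: infinite_dihedral_def)
qed (auto simp: infinite_dihedral_def algebra_simps)

text \<open>\<open>sg\<close> and \<open>ht\<close> come from the universal property. That the
  kernel is finite and that reflections invert \<open>N\<close> follows from a normal form: an
  element of \<open>K\<close>, a power of \<open>t\<close>, and possibly a factor
  \<open>v\<close>.\<close>

lemma amalgam_quasi_dihedral:
  fixes A :: "('a, 'm) monoid_scheme" and K :: "'a set"
  assumes A: "generalized_quasi_dihedral A K" and K: "finite K"
  obtains sg ht g0 where "quasi_dihedral_group (amalgam A K) sg ht"
    "g0 \<in> carrier (amalgam A K)" "sg g0 = 1" "ht g0 \<noteq> 0"
proof -
  define G where "G = amalgam A K"
  obtain b where b: "b \<in> carrier A" "b \<notin> K"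
    and bk: "\<And>k. k \<in> K \<Longrightarrow> b \<otimes>\<^bsub>A\<^esub> k \<otimes>\<^bsub>A\<^esub> inv\<^bsub>A\<^esub> b \<otimes>\<^bsub>A\<^esub> k = \<one>\<^bsub>A\<^esub>"
    and gA: "group A" and sK: "subgroup K A" and cK: "comm_group (A\<lparr>carrier := K\<rparr>)"
    and ind: "card (rcosets\<^bsub>A\<^esub> K) = 2"
    using A by (auto simp: generalized_quasi_dihedral_def)
  interpret A: group A by fact
  interpret G: group G unfolding G_def by (rule group_amalgam[OF gA])
  note memK = subgroup.one_closed[OF sK] subgroup.m_closed[OF sK] subgroup.m_inv_closed[OF sK]
  have Kc: "k \<in> carrier A" if "k \<in> K" for k using subgroup.mem_carrier[OF sK that] .
  have bb: "b \<otimes>\<^bsub>A\<^esub> b \<in> K" and binv: "\<And>a. a \<in> carrier A \<Longrightarrow> a \<notin> K \<Longrightarrow> a \<otimes>\<^bsub>A\<^esub> inv\<^bsub>A\<^esub> b \<in> K"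
    using A.index_two_mult[OF sK ind] b by auto
  have bkA: "b \<otimes>\<^bsub>A\<^esub> k = inv\<^bsub>A\<^esub> k \<otimes>\<^bsub>A\<^esub> b" if k: "k \<in> K" for k
  proof -
    have "b \<otimes>\<^bsub>A\<^esub> k \<otimes>\<^bsub>A\<^esub> inv\<^bsub>A\<^esub> b = inv\<^bsub>A\<^esub> k"
      using bk[OF k] b Kc[OF k] by (simp add: A.inv_equality[symmetric])
    then have "b \<otimes>\<^bsub>A\<^esub> k \<otimes>\<^bsub>A\<^esub> inv\<^bsub>A\<^esub> b \<otimes>\<^bsub>A\<^esub> b = inv\<^bsub>A\<^esub> k \<otimes>\<^bsub>A\<^esub> b" by simp
    then show ?thesis using b Kc[OF k] by (simp add: A.m_assoc)
  qed
  \<comment> \<open>The elements outside \<open>K\<close> act as the reflection sending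
    \<open>n\<close> to \<open>1 - n\<close> for the copy \<open>True\<close>, and to
    \<open>- n\<close> for the copy \<open>False\<close>; \<open>K\<close> acts trivially.\<close>
  define f where "f i a = (if a \<in> K then (1::int, 0::int) else (-1, if i then 1 else 0))" for i :: bool and a
  have "f i \<in> hom A infinite_dihedral" for i
  proof (rule homI)
    show "f i x \<in> carrier infinite_dihedral" for x by (simp add: f_def infinite_dihedral_def)
    fix x y assume xy: "x \<in> carrier A" "y \<in> carrier A"
    have 1: "x \<otimes>\<^bsub>A\<^esub> y \<notin> K" if "x \<in> K" "y \<notin> K"
    proof
      assume "x \<otimes>\<^bsub>A\<^esub> y \<in> K"
      then have "inv\<^bsub>A\<^esub> x \<otimes>\<^bsub>A\<^esub> (x \<otimes>\<^bsub>A\<^esub> y) \<in> K" using that memK by simp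
      then show False using that xy by (simp flip: A.m_assoc)
    qed
    have 2: "x \<otimes>\<^bsub>A\<^esub> y \<notin> K" if "x \<notin> K" "y \<in> K"
    proof
      assume "x \<otimes>\<^bsub>A\<^esub> y \<in> K"
      then have "(x \<otimes>\<^bsub>A\<^esub> y) \<otimes>\<^bsub>A\<^esub> inv\<^bsub>A\<^esub> y \<in> K" using that memK by simp
      then show False using that xy by (simp add: A.m_assoc)
    qed
    show "f i (x \<otimes>\<^bsub>A\<^esub> y) = f i x \<otimes>\<^bsub>infinite_dihedral\<^esub> f i y"
      using 1 2 memK(2)[of x y] A.index_two_mult(1)[OF sK ind, of x y] xy
      by (auto simp: f_def infinite_dihedral_def)
  qed
  then obtain \<phi> where \<phi>: "\<phi> \<in> hom G infinite_dihedral"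
    and \<phi>f: "\<And>i a. a \<in> carrier A \<Longrightarrow> \<phi> (amalgam_incl A K i a) = f i a"
    using amalgam_universal[OF gA group_infinite_dihedral, of f K] unfolding G_def f_def by auto
  define sg where "sg g = fst (\<phi> g)" for g
  define ht where "ht g = snd (\<phi> g)" for g
  have sg_cases: "sg x = 1 \<or> sg x = -1" if "x \<in> carrier G" for x
    using hom_in_carrier[OF \<phi> that] by (auto simp: sg_def infinite_dihedral_def)
  have \<phi>_mult: "sg (x \<otimes>\<^bsub>G\<^esub> y) = sg x * sg y" "ht (x \<otimes>\<^bsub>G\<^esub> y) = ht x + sg x * ht y"
    if "x \<in> carrier G" "y \<in> carrier G" for x y
    using hom_mult[OF \<phi> that] by (simp_all add: sg_def ht_def infinite_dihedral_def split: prod.splits)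
  define \<iota> where "\<iota> = amalgam_incl A K"
  have \<iota>: "\<iota> i \<in> hom A G" for i unfolding \<iota>_def G_def by (rule amalgam_incl_hom[OF gA])
  have \<iota>c: "\<iota> i a \<in> carrier G" if "a \<in> carrier A" for i a using hom_in_carrier[OF \<iota> that] .
  have \<iota>m: "\<iota> i (a \<otimes>\<^bsub>A\<^esub> c) = \<iota> i a \<otimes>\<^bsub>G\<^esub> \<iota> i c" if "a \<in> carrier A" "c \<in> carrier A" for i a c
    using hom_mult[OF \<iota> that] .
  have \<iota>1: "\<iota> i \<one>\<^bsub>A\<^esub> = \<one>\<^bsub>G\<^esub>" for i by (rule hom_one[OF \<iota> gA G.is_group])
  have \<iota>i: "\<iota> i (inv\<^bsub>A\<^esub> a) = inv\<^bsub>G\<^esub> (\<iota> i a)" if "a \<in> carrier A" for i a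
    using group_hom.hom_inv[of A G "\<iota> i" a] \<iota> gA G.is_group that
    by (simp add: group_hom_def group_hom_axioms_def)
  define \<kappa> where "\<kappa> = \<iota> False"
  have glue: "\<iota> i k = \<kappa> k" if "k \<in> K" for i k
    using amalgam_incl_glue[OF gA that Kc[OF that], of i False] by (simp add: \<kappa>_def \<iota>_def)
  define u where "u = \<iota> True b"
  define v where "v = \<iota> False b"
  have uv: "u \<in> carrier G" "v \<in> carrier G" using \<iota>c b by (simp_all add: u_def v_def)
  define z where "z = b \<otimes>\<^bsub>A\<^esub> b"
  have sq: "u \<otimes>\<^bsub>G\<^esub> u = \<kappa> z" "v \<otimes>\<^bsub>G\<^esub> v = \<kappa> z"
    using \<iota>m[of b b] b glue[OF bb] by (simp_all add: u_def v_def z_def flip: glue)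
  have \<kappa>c: "\<kappa> k \<in> carrier G" if "k \<in> K" for k using \<iota>c Kc that by (simp add: \<kappa>_def)
  have \<kappa>m: "\<kappa> (k \<otimes>\<^bsub>A\<^esub> l) = \<kappa> k \<otimes>\<^bsub>G\<^esub> \<kappa> l" if "k \<in> K" "l \<in> K" for k l
    using \<iota>m Kc that by (simp add: \<kappa>_def)
  have \<kappa>i: "\<kappa> (inv\<^bsub>A\<^esub> k) = inv\<^bsub>G\<^esub> \<kappa> k" if "k \<in> K" for k using \<iota>i Kc that by (simp add: \<kappa>_def)
  have \<iota>b: "\<iota> i b \<otimes>\<^bsub>G\<^esub> \<kappa> k = inv\<^bsub>G\<^esub> \<kappa> k \<otimes>\<^bsub>G\<^esub> \<iota> i b" if k: "k \<in> K" for i k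
  proof -
    have "\<iota> i b \<otimes>\<^bsub>G\<^esub> \<iota> i k = \<iota> i (inv\<^bsub>A\<^esub> k) \<otimes>\<^bsub>G\<^esub> \<iota> i b"
      using bkA[OF k] \<iota>m[of b k i] \<iota>m[of "inv\<^bsub>A\<^esub> k" b i] b Kc[OF k] by simp
    then show ?thesis using glue[OF k] glue[OF memK(3)[OF k]] \<kappa>i[OF k] by simp
  qed
  \<comment> \<open>The product of the two reflections is the unit translation. It commutes with
    \<open>K\<close>, which is inverted by \<open>u\<close> and by \<open>v\<close>.\<close>
  define t where "t = u \<otimes>\<^bsub>G\<^esub> inv\<^bsub>G\<^esub> v"
  have t: "t \<in> carrier G" using uv by (simp add: t_def)
  have uvt: "u = t \<otimes>\<^bsub>G\<^esub> v" using uv by (simp add: t_def G.m_assoc)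
  have \<kappa>v: "v \<otimes>\<^bsub>G\<^esub> \<kappa> k = inv\<^bsub>G\<^esub> \<kappa> k \<otimes>\<^bsub>G\<^esub> v" "u \<otimes>\<^bsub>G\<^esub> \<kappa> k = inv\<^bsub>G\<^esub> \<kappa> k \<otimes>\<^bsub>G\<^esub> u" if "k \<in> K" for k
    using \<iota>b[OF that] by (simp_all add: u_def v_def)
  have t\<kappa>: "t \<otimes>\<^bsub>G\<^esub> \<kappa> k = \<kappa> k \<otimes>\<^bsub>G\<^esub> t" if k: "k \<in> K" for k
  proof -
    have "(t \<otimes>\<^bsub>G\<^esub> \<kappa> k) \<otimes>\<^bsub>G\<^esub> v = t \<otimes>\<^bsub>G\<^esub> (v \<otimes>\<^bsub>G\<^esub> \<kappa> (inv\<^bsub>A\<^esub> k))"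
      using \<kappa>v(1)[OF memK(3)[OF k]] \<kappa>i[OF k] \<kappa>c[OF k] uv t by (simp add: G.m_assoc)
    also have "\<dots> = u \<otimes>\<^bsub>G\<^esub> \<kappa> (inv\<^bsub>A\<^esub> k)"
      using \<kappa>c[OF memK(3)[OF k]] uv t by (simp add: uvt G.m_assoc)
    also have "\<dots> = (\<kappa> k \<otimes>\<^bsub>G\<^esub> t) \<otimes>\<^bsub>G\<^esub> v"
      using \<kappa>v(2)[OF memK(3)[OF k]] \<kappa>i[OF k] \<kappa>c[OF k] uv t by (simp add: uvt G.m_assoc)
    finally show ?thesis using uv t \<kappa>c[OF k] by (metis G.m_closed G.right_cancel)
  qed
  \<comment> \<open>Both squares are the same element of \<open>K\<close>. This is what makes
    \<open>v\<close> invert \<open>t\<close>.\<close>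
  have "u = inv\<^bsub>G\<^esub> u \<otimes>\<^bsub>G\<^esub> (v \<otimes>\<^bsub>G\<^esub> v)"
    using uv sq by (metis G.inv_closed G.inv_solve_left G.m_closed)
  then have "v \<otimes>\<^bsub>G\<^esub> u \<otimes>\<^bsub>G\<^esub> inv\<^bsub>G\<^esub> v = v \<otimes>\<^bsub>G\<^esub> (inv\<^bsub>G\<^esub> u \<otimes>\<^bsub>G\<^esub> (v \<otimes>\<^bsub>G\<^esub> v)) \<otimes>\<^bsub>G\<^esub> inv\<^bsub>G\<^esub> v" by simp
  also have "\<dots> = inv\<^bsub>G\<^esub> t \<otimes>\<^bsub>G\<^esub> v"
    using uv by (simp add: t_def G.inv_mult_group G.m_assoc)
  finally have vt: "v \<otimes>\<^bsub>G\<^esub> t = inv\<^bsub>G\<^esub> t \<otimes>\<^bsub>G\<^esub> v"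
    using uv by (simp add: t_def G.m_assoc)
  note t\<kappa>n = G.int_pow_commute[OF t \<kappa>c t\<kappa>] and vtn = G.int_pow_reflect[OF t uv(2) vt]
  define T where "T n = t [^]\<^bsub>G\<^esub> (n::int)" for n
  have Tc: "T n \<in> carrier G" for n using t by (simp add: T_def)
  have TT: "T m \<otimes>\<^bsub>G\<^esub> T n = T (m + n)" for m n using t by (simp add: T_def G.int_pow_mult)
  have Ti: "inv\<^bsub>G\<^esub> T n = T (- n)" for n using t by (simp add: T_def G.int_pow_neg)
  have T\<kappa>: "T n \<otimes>\<^bsub>G\<^esub> \<kappa> k = \<kappa> k \<otimes>\<^bsub>G\<^esub> T n" if "k \<in> K" for n k using t\<kappa>n[OF that that] by (simp add: T_def)
  have vT: "v \<otimes>\<^bsub>G\<^esub> T n = T (- n) \<otimes>\<^bsub>G\<^esub> v" for n using vtn by (simp add: T_def)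
  have v\<kappa>T: "v \<otimes>\<^bsub>G\<^esub> (\<kappa> k \<otimes>\<^bsub>G\<^esub> T n) = \<kappa> (inv\<^bsub>A\<^esub> k) \<otimes>\<^bsub>G\<^esub> T (- n) \<otimes>\<^bsub>G\<^esub> v" if k: "k \<in> K" for k n
  proof -
    have "v \<otimes>\<^bsub>G\<^esub> (\<kappa> k \<otimes>\<^bsub>G\<^esub> T n) = (v \<otimes>\<^bsub>G\<^esub> \<kappa> k) \<otimes>\<^bsub>G\<^esub> T n"
      using uv \<kappa>c[OF k] Tc by (simp add: G.m_assoc)
    also have "\<dots> = \<kappa> (inv\<^bsub>A\<^esub> k) \<otimes>\<^bsub>G\<^esub> (v \<otimes>\<^bsub>G\<^esub> T n)"
      using uv \<kappa>c[OF k] Tc by (simp add: \<kappa>v(1)[OF k] \<kappa>i[OF k] G.m_assoc)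
    also have "\<dots> = \<kappa> (inv\<^bsub>A\<^esub> k) \<otimes>\<^bsub>G\<^esub> T (- n) \<otimes>\<^bsub>G\<^esub> v"
      using uv \<kappa>c[OF memK(3)[OF k]] Tc by (simp add: vT G.m_assoc)
    finally show ?thesis .
  qed
  \<comment> \<open>The set of normal forms contains \<open>\<one>\<close> and is closed under left
    multiplication by letters, hence is the whole group by induction on words.\<close>
  define W where "W = {\<kappa> k \<otimes>\<^bsub>G\<^esub> T n | k n. k \<in> K} \<union> {\<kappa> k \<otimes>\<^bsub>G\<^esub> T n \<otimes>\<^bsub>G\<^esub> v | k n. k \<in> K}"
  have WI: "\<kappa> k \<otimes>\<^bsub>G\<^esub> T n \<in> W" "\<kappa> k \<otimes>\<^bsub>G\<^esub> T n \<otimes>\<^bsub>G\<^esub> v \<in> W" if "k \<in> K" for k n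
    using that by (auto simp: W_def)
  have W_\<kappa>: "\<kappa> l \<otimes>\<^bsub>G\<^esub> w \<in> W" if w: "w \<in> W" and l: "l \<in> K" for w l
  proof -
    obtain k n where k: "k \<in> K" "w = \<kappa> k \<otimes>\<^bsub>G\<^esub> T n \<or> w = \<kappa> k \<otimes>\<^bsub>G\<^esub> T n \<otimes>\<^bsub>G\<^esub> v"
      using w unfolding W_def by blast
    have "\<kappa> l \<otimes>\<^bsub>G\<^esub> (\<kappa> k \<otimes>\<^bsub>G\<^esub> T n) = \<kappa> (l \<otimes>\<^bsub>A\<^esub> k) \<otimes>\<^bsub>G\<^esub> T n"
      using \<kappa>c l k Tc by (simp add: \<kappa>m G.m_assoc)
    then show ?thesis using k WI[OF memK(2)[OF l k(1)], of n] \<kappa>c l Tc uv by (auto simp flip: G.m_assoc)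
  qed
  have W_t: "t \<otimes>\<^bsub>G\<^esub> w \<in> W" if w: "w \<in> W" for w
  proof -
    obtain k n where k: "k \<in> K" "w = \<kappa> k \<otimes>\<^bsub>G\<^esub> T n \<or> w = \<kappa> k \<otimes>\<^bsub>G\<^esub> T n \<otimes>\<^bsub>G\<^esub> v"
      using w unfolding W_def by blast
    have "t = T 1" using t by (simp add: T_def)
    then have "t \<otimes>\<^bsub>G\<^esub> (\<kappa> k \<otimes>\<^bsub>G\<^esub> T n) = \<kappa> k \<otimes>\<^bsub>G\<^esub> T (1 + n)"
      using \<kappa>c k Tc T\<kappa>[OF k(1), of 1] TT[of 1 n, symmetric] by (simp flip: G.m_assoc)
    then show ?thesis using k WI[OF k(1), of "1 + n"] \<kappa>c t Tc uv by (auto simp flip: G.m_assoc)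
  qed
  have W_v: "v \<otimes>\<^bsub>G\<^esub> w \<in> W" if w: "w \<in> W" for w
  proof -
    obtain k n where k: "k \<in> K" "w = \<kappa> k \<otimes>\<^bsub>G\<^esub> T n \<or> w = \<kappa> k \<otimes>\<^bsub>G\<^esub> T n \<otimes>\<^bsub>G\<^esub> v"
      using w unfolding W_def by blast
    note k' = memK(3)[OF k(1)]
    have zK: "z \<in> K" using bb by (simp add: z_def)
    have "v \<otimes>\<^bsub>G\<^esub> (\<kappa> k \<otimes>\<^bsub>G\<^esub> T n \<otimes>\<^bsub>G\<^esub> v) = v \<otimes>\<^bsub>G\<^esub> (\<kappa> k \<otimes>\<^bsub>G\<^esub> T n) \<otimes>\<^bsub>G\<^esub> v"
      using \<kappa>c k Tc uv by (simp add: G.m_assoc)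
    also have "\<dots> = \<kappa> (inv\<^bsub>A\<^esub> k) \<otimes>\<^bsub>G\<^esub> (T (- n) \<otimes>\<^bsub>G\<^esub> \<kappa> z)"
      unfolding v\<kappa>T[OF k(1)] using \<kappa>c[OF k'] Tc uv by (simp add: G.m_assoc sq)
    also have "\<dots> = \<kappa> (inv\<^bsub>A\<^esub> k \<otimes>\<^bsub>A\<^esub> z) \<otimes>\<^bsub>G\<^esub> T (- n)"
      using \<kappa>c k' zK Tc by (simp add: T\<kappa> \<kappa>m G.m_assoc)
    finally show ?thesis
      using k v\<kappa>T[OF k(1), of n] WI[OF k', of "- n"] WI(1)[OF memK(2)[OF k' zK], of "- n"] by auto
  qed
  have W_\<iota>: "\<iota> i a \<otimes>\<^bsub>G\<^esub> w \<in> W" if w: "w \<in> W" and a: "a \<in> carrier A" for w i a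
  proof (cases "a \<in> K")
    case True
    then show ?thesis using W_\<kappa>[OF w] glue by simp
  next
    case False
    define l where "l = a \<otimes>\<^bsub>A\<^esub> inv\<^bsub>A\<^esub> b"
    have l: "l \<in> K" using binv[OF a False] by (simp add: l_def)
    have wc: "w \<in> carrier G" using w \<kappa>c Tc uv by (auto simp: W_def)
    have "a = l \<otimes>\<^bsub>A\<^esub> b" using a b by (simp add: l_def A.m_assoc)
    then have "\<iota> i a = \<kappa> l \<otimes>\<^bsub>G\<^esub> \<iota> i b" using \<iota>m[of l b i] glue[OF l] Kc[OF l] b by simp
    then have "\<iota> i a \<otimes>\<^bsub>G\<^esub> w = \<kappa> l \<otimes>\<^bsub>G\<^esub> (\<iota> i b \<otimes>\<^bsub>G\<^esub> w)"
      using \<kappa>c[OF l] \<iota>c b wc by (simp add: G.m_assoc)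
    moreover have "\<iota> i b \<otimes>\<^bsub>G\<^esub> w \<in> W"
    proof (cases i)
      case True
      then have "\<iota> i b \<otimes>\<^bsub>G\<^esub> w = t \<otimes>\<^bsub>G\<^esub> (v \<otimes>\<^bsub>G\<^esub> w)"
        using uv t wc by (simp add: uvt G.m_assoc flip: u_def)
      then show ?thesis using W_t W_v w by simp
    next
      case False
      then show ?thesis using W_v[OF w] by (simp flip: v_def)
    qed
    ultimately show ?thesis using W_\<kappa> l by simp
  qed
  have one_W: "\<one>\<^bsub>G\<^esub> \<in> W"
    using WI(1)[OF memK(1), of 0] \<iota>1[of False] by (simp add: T_def \<kappa>_def)
  have inW: "x \<in> W" if x: "x \<in> carrier G" for x
  proof -
    obtain w where w: "w \<in> amalgam_words A" "x = amalgam_rel A K `` {w}"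
      using x unfolding G_def by (rule amalgam_carrierE)
    have "amalgam_rel A K `` {w} \<in> W" using w(1)
    proof (induction w)
      case Nil
      then show ?case using one_W by (simp add: G_def amalgam_one)
    next
      case (Cons y w)
      have "amalgam_rel A K `` {y # w} = \<iota> (fst y) (snd y) \<otimes>\<^bsub>G\<^esub> (amalgam_rel A K `` {w})"
        using Cons.prems by (simp add: \<iota>_def amalgam_incl_def G_def amalgam_mult[OF gA])
      then show ?case using Cons W_\<iota> by simp
    qed
    then show ?thesis using w by simp
  qed
  have \<phi>\<kappa>: "sg (\<kappa> k) = 1" "ht (\<kappa> k) = 0" if "k \<in> K" for k
    using \<phi>f[OF Kc[OF that], of False] that by (simp_all add: sg_def ht_def \<kappa>_def \<iota>_def f_def)
  have \<phi>uv: "sg u = -1" "ht u = 1" "sg v = -1" "ht v = 0"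
    using \<phi>f[OF b(1)] b by (simp_all add: sg_def ht_def u_def v_def \<iota>_def f_def)
  have \<phi>t: "sg t = 1" "ht t = 1"
    using \<phi>_mult[OF t uv(2)] \<phi>uv by (simp_all flip: uvt)
  have \<phi>T: "sg (T n) = 1 \<and> ht (T n) = n" for n
  proof -
    have T0: "T 0 = \<one>\<^bsub>G\<^esub>" "T 1 = t" using t by (simp_all add: T_def)
    have one: "sg \<one>\<^bsub>G\<^esub> = 1" "ht \<one>\<^bsub>G\<^esub> = 0"
      using \<phi>\<kappa>[OF memK(1)] \<iota>1[of False] by (simp_all add: \<kappa>_def)
    have nat: "sg (T (int m)) = 1 \<and> ht (T (int m)) = int m" for m
    proof (induction m)
      case (Suc m)
      have "T (int (Suc m)) = t \<otimes>\<^bsub>G\<^esub> T (int m)" using TT[of 1 "int m"] T0 by simp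
      then show ?case using \<phi>_mult[OF t Tc[of "int m"]] Suc \<phi>t by simp
    qed (simp add: T0 one)
    show ?thesis
    proof (cases "n \<ge> 0")
      case True
      then show ?thesis using nat[of "nat n"] by simp
    next
      case False
      have "T (int (nat (-n))) \<otimes>\<^bsub>G\<^esub> T n = \<one>\<^bsub>G\<^esub>" using TT[of "int (nat (-n))" n] False T0 by simp
      then show ?thesis using \<phi>_mult[OF Tc[of "int (nat (-n))"] Tc[of n]] nat[of "nat (-n)"] one False by simp
    qed
  qed
  \<comment> \<open>The sign decides whether the factor \<open>v\<close> occurs, and the height
    determines the power of \<open>t\<close>.\<close>
  have nf_N: "\<exists>k\<in>K. x = \<kappa> k \<otimes>\<^bsub>G\<^esub> T (ht x)" if "x \<in> carrier G" "sg x = 1" for x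
  proof -
    obtain k n where k: "k \<in> K" "x = \<kappa> k \<otimes>\<^bsub>G\<^esub> T n \<or> x = \<kappa> k \<otimes>\<^bsub>G\<^esub> T n \<otimes>\<^bsub>G\<^esub> v"
      using inW[OF \<open>x \<in> carrier G\<close>] unfolding W_def by blast
    have p: "sg (\<kappa> k \<otimes>\<^bsub>G\<^esub> T n) = 1" "ht (\<kappa> k \<otimes>\<^bsub>G\<^esub> T n) = n"
      using \<phi>_mult[OF \<kappa>c[OF k(1)] Tc[of n]] \<phi>\<kappa>[OF k(1)] \<phi>T[of n] by simp_all
    then have "sg (\<kappa> k \<otimes>\<^bsub>G\<^esub> T n \<otimes>\<^bsub>G\<^esub> v) = -1"
      using \<phi>_mult[of "\<kappa> k \<otimes>\<^bsub>G\<^esub> T n" v] \<kappa>c[OF k(1)] Tc uv \<phi>uv by simp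
    then have "x = \<kappa> k \<otimes>\<^bsub>G\<^esub> T n" using k that by auto
    then show ?thesis using k p by auto
  qed
  have nf_B: "\<exists>k\<in>K. \<exists>n. x = \<kappa> k \<otimes>\<^bsub>G\<^esub> T n \<otimes>\<^bsub>G\<^esub> v" if "x \<in> carrier G" "sg x = -1" for x
  proof -
    obtain k n where k: "k \<in> K" "x = \<kappa> k \<otimes>\<^bsub>G\<^esub> T n \<or> x = \<kappa> k \<otimes>\<^bsub>G\<^esub> T n \<otimes>\<^bsub>G\<^esub> v"
      using inW[OF \<open>x \<in> carrier G\<close>] unfolding W_def by blast
    have "sg (\<kappa> k \<otimes>\<^bsub>G\<^esub> T n) = 1"
      using \<phi>_mult[OF \<kappa>c[OF k(1)] Tc[of n]] \<phi>\<kappa>[OF k(1)] \<phi>T[of n] by simp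
    then show ?thesis using k that by auto
  qed
  have Kcomm: "k \<otimes>\<^bsub>A\<^esub> l = l \<otimes>\<^bsub>A\<^esub> k" if "k \<in> K" "l \<in> K" for k l
    using comm_groupE(4)[OF cK] that by simp
  have qd: "quasi_dihedral_group G sg ht"
  proof unfold_locales
    show "x \<in> carrier G \<Longrightarrow> sg x = 1 \<or> sg x = -1" for x by (rule sg_cases)
    show "x \<in> carrier G \<Longrightarrow> y \<in> carrier G \<Longrightarrow> sg (x \<otimes>\<^bsub>G\<^esub> y) = sg x * sg y"
      "x \<in> carrier G \<Longrightarrow> y \<in> carrier G \<Longrightarrow> ht (x \<otimes>\<^bsub>G\<^esub> y) = ht x + sg x * ht y" for x y
      by (rule \<phi>_mult; assumption)+
    show "\<exists>d\<in>carrier G. sg d = -1" using uv \<phi>uv by blast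
    \<comment> \<open>At height 0 the power of \<open>t\<close> in the normal form is trivial, so
      only the image of \<open>K\<close> remains.\<close>
    have "{x \<in> carrier G. sg x = 1 \<and> ht x = 0} \<subseteq> \<kappa> ` K"
      using nf_N \<kappa>c by (force simp: T_def)
    then show "finite {x \<in> carrier G. sg x = 1 \<and> ht x = 0}" using K finite_surj by blast
    fix d x assume d: "d \<in> carrier G" and x: "x \<in> carrier G" and sd: "sg d = -1" and sx: "sg x = 1"
    obtain k n where k: "k \<in> K" "d = \<kappa> k \<otimes>\<^bsub>G\<^esub> T n \<otimes>\<^bsub>G\<^esub> v" using nf_B[OF d sd] by blast
    obtain l m where l: "l \<in> K" "x = \<kappa> l \<otimes>\<^bsub>G\<^esub> T m" using nf_N[OF x sx] by blast
    note l' = memK(3)[OF l(1)]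
    define x' where "x' = \<kappa> (inv\<^bsub>A\<^esub> l) \<otimes>\<^bsub>G\<^esub> T (- m)"
    have x': "inv\<^bsub>G\<^esub> x = x'"
      using \<kappa>c[OF l(1)] Tc by (simp add: x'_def l G.inv_mult_group Ti flip: \<kappa>i T\<kappa>[OF l'])
    have "\<kappa> k \<otimes>\<^bsub>G\<^esub> T n \<otimes>\<^bsub>G\<^esub> x' = \<kappa> (k \<otimes>\<^bsub>A\<^esub> inv\<^bsub>A\<^esub> l) \<otimes>\<^bsub>G\<^esub> T (n + (- m))"
    proof -
      have "\<kappa> k \<otimes>\<^bsub>G\<^esub> T n \<otimes>\<^bsub>G\<^esub> x' = \<kappa> k \<otimes>\<^bsub>G\<^esub> (T n \<otimes>\<^bsub>G\<^esub> \<kappa> (inv\<^bsub>A\<^esub> l)) \<otimes>\<^bsub>G\<^esub> T (- m)"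
        using \<kappa>c k l' Tc by (simp add: x'_def G.m_assoc)
      also have "\<dots> = \<kappa> k \<otimes>\<^bsub>G\<^esub> \<kappa> (inv\<^bsub>A\<^esub> l) \<otimes>\<^bsub>G\<^esub> (T n \<otimes>\<^bsub>G\<^esub> T (- m))"
        unfolding T\<kappa>[OF l'] using \<kappa>c k l' Tc by (simp add: G.m_assoc)
      finally show ?thesis unfolding TT using \<kappa>m[OF k(1) l'] by simp
    qed
    moreover have "x' \<otimes>\<^bsub>G\<^esub> (\<kappa> k \<otimes>\<^bsub>G\<^esub> T n) = \<kappa> (inv\<^bsub>A\<^esub> l \<otimes>\<^bsub>A\<^esub> k) \<otimes>\<^bsub>G\<^esub> T (- m + n)"
    proof -
      have "x' \<otimes>\<^bsub>G\<^esub> (\<kappa> k \<otimes>\<^bsub>G\<^esub> T n) = \<kappa> (inv\<^bsub>A\<^esub> l) \<otimes>\<^bsub>G\<^esub> (T (- m) \<otimes>\<^bsub>G\<^esub> \<kappa> k) \<otimes>\<^bsub>G\<^esub> T n"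
        using \<kappa>c k l' Tc by (simp add: x'_def G.m_assoc)
      also have "\<dots> = \<kappa> (inv\<^bsub>A\<^esub> l) \<otimes>\<^bsub>G\<^esub> \<kappa> k \<otimes>\<^bsub>G\<^esub> (T (- m) \<otimes>\<^bsub>G\<^esub> T n)"
        unfolding T\<kappa>[OF k(1)] using \<kappa>c k l' Tc by (simp add: G.m_assoc)
      finally show ?thesis unfolding TT using \<kappa>m[OF l' k(1)] by simp
    qed
    ultimately have comm: "\<kappa> k \<otimes>\<^bsub>G\<^esub> T n \<otimes>\<^bsub>G\<^esub> x' = x' \<otimes>\<^bsub>G\<^esub> (\<kappa> k \<otimes>\<^bsub>G\<^esub> T n)"
      using Kcomm[OF k(1) l'] by (simp add: add.commute)
    have x'c: "x' \<in> carrier G" using \<kappa>c[OF l'] Tc by (simp add: x'_def)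
    have "d \<otimes>\<^bsub>G\<^esub> x = \<kappa> k \<otimes>\<^bsub>G\<^esub> T n \<otimes>\<^bsub>G\<^esub> (v \<otimes>\<^bsub>G\<^esub> (\<kappa> l \<otimes>\<^bsub>G\<^esub> T m))"
      using \<kappa>c k l Tc uv by (simp add: G.m_assoc)
    also have "\<dots> = \<kappa> k \<otimes>\<^bsub>G\<^esub> T n \<otimes>\<^bsub>G\<^esub> x' \<otimes>\<^bsub>G\<^esub> v"
      unfolding v\<kappa>T[OF l(1)] x'_def using \<kappa>c k l' Tc uv by (simp add: G.m_assoc)
    also have "\<dots> = x' \<otimes>\<^bsub>G\<^esub> d"
      unfolding comm using x'c \<kappa>c k Tc uv by (simp add: G.m_assoc)
    finally show "d \<otimes>\<^bsub>G\<^esub> x = inv\<^bsub>G\<^esub> x \<otimes>\<^bsub>G\<^esub> d" unfolding x' .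
  qed
  show ?thesis using that[of sg ht t] qd t \<phi>t unfolding G_def by simp
qed

theorem theorem1p1:
  fixes A :: "('a, 'm) monoid_scheme" and K :: "'a set"
    and G :: "(bool \<times> 'a) list set monoid" and S :: "(bool \<times> 'a) list set set"
  assumes "generalized_quasi_dihedral A K"
    and "finite K"
    and "G = amalgam A K"
    and "finite S" and "S \<subseteq> carrier G" and "\<one>\<^bsub>G\<^esub> \<notin> S"
    and "generate G S = carrier G"
  shows "\<exists>R. hamiltonian_double_ray R (Cay G S)"
proof -
  obtain sg ht g0 where "quasi_dihedral_group G sg ht"
    and g0: "g0 \<in> carrier G" "sg g0 = 1" "ht g0 \<noteq> 0"
    using amalgam_quasi_dihedral[OF assms(1,2)] unfolding assms(3) by metis
  then interpret quasi_dihedral_group G sg ht by simp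
  obtain v where bij: "bij_betw v (UNIV::int set) (carrier G)"
    and adj: "\<And>i. inv\<^bsub>G\<^esub> v i \<otimes>\<^bsub>G\<^esub> v (i + 1) \<in> S \<union> (\<lambda>x. inv\<^bsub>G\<^esub> x) ` S"
    using hamiltonian_sequence[OF assms(4,5,7), of g0] g0 unfolding N_def by blast
  have vc: "v i \<in> carrier G" for i using bij by (auto simp: bij_betw_def)
  have "(v i, v (i + 1)) \<in> parcs (Cay G S)" for i
  proof -
    have "inv\<^bsub>G\<^esub> v i \<otimes>\<^bsub>G\<^esub> v (i + 1) \<in> S \<or> (\<exists>s\<in>S. inv\<^bsub>G\<^esub> v i \<otimes>\<^bsub>G\<^esub> v (i + 1) = inv\<^bsub>G\<^esub> s)" using adj[of i] by blast
    then show ?thesis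
    proof (elim disjE bexE)
      assume s: "inv\<^bsub>G\<^esub> v i \<otimes>\<^bsub>G\<^esub> v (i + 1) \<in> S"
      have "v (i + 1) = v i \<otimes>\<^bsub>G\<^esub> (inv\<^bsub>G\<^esub> v i \<otimes>\<^bsub>G\<^esub> v (i + 1))" using vc by simp
      then show ?thesis using s vc[of i] by (auto simp: Cay_def)
    next
      \<comment> \<open>A label \<open>inv s\<close> is the arc of \<open>s\<close> starting at
        \<open>v (i + 1)\<close>, read backwards.\<close>
      fix s assume s: "s \<in> S" "inv\<^bsub>G\<^esub> v i \<otimes>\<^bsub>G\<^esub> v (i + 1) = inv\<^bsub>G\<^esub> s"
      have sc: "s \<in> carrier G" using s assms(5) by auto
      have "v (i + 1) = v i \<otimes>\<^bsub>G\<^esub> inv\<^bsub>G\<^esub> s" using vc s(2) by (metis cancel_inv(2))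
      then have "v i = v (i + 1) \<otimes>\<^bsub>G\<^esub> s" using vc sc by (simp add: m_assoc)
      then show ?thesis using s vc[of "i + 1"] by (auto simp: Cay_def)
    qed
  qed
  then show ?thesis
    using hamiltonian_double_ray_of_bij[OF pair_bidirected_digraph_Cay[OF is_group assms(5,6)], of v] bij
    by (simp add: Cay_def)
qed

end
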